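(* Let $G$ be an sp-group such that for every prime $p$ the $p$-component $G_p$ is elementary, and write $\prod=\prod_{p\in\mathbb{P}}\mathrm{End}_{\mathbb{Z}}(G_p)$ and $\oplus=\bigoplus_{p\in\mathbb{P}}\mathrm{End}_{\mathbb{Z}}(G_p)$. Let $T$ be a subring of $\prod$ and let $$\mathbb{M}_T=\{x\in\textstyle\prod \mid \exists k\in\mathbb{N} \text{ such that } kx\in T\}.$$ Then the following hold. (1) $\mathbb{M}_T$ is a pure subring of $\prod$ containing $\oplus+T$. (2) $\mathbb{M}_T/\oplus$ is isomorphic, as a ring, to $T\otimes_{\mathbb{Z}}\mathbb{Q}$. (3) $\mathbb{M}_T$ is a (von Neumann) regular ring if and only if $T\otimes_{\mathbb{Z}}\mathbb{Q}$ is a (von Neumann) regular ring. If in addition $G_p$ is finite for every prime $p$, then also: (4) $\mathbb{M}_T$ is right and left non-singular. (5) $\prod$ is a right maximal quotient ring of $\mathbb{M}_T$, and also a left maximal quotient ring of $\mathbb{M}_T$. (6) $\mathbb{M}_T$ is never right or left $\aleph_0$-self-injective unless $\mathbb{M}_T=\prod$. (7) $|\mathbb{M}_T|=|T|$.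
   Context: All groups are abelian; $\mathbb{P}$ is the set of primes and $\mathbb{N}$ the set of positive integers. Rings have an identity and a subring of $\prod$ contains the identity of $\prod$. For a group $G$, $G_p$ is its $p$-component (elements of $p$-power order) and $G_t=\bigoplus_p G_p$ its torsion subgroup. $G_p$ is elementary if it is a direct sum of cyclic groups of order $p$ (equivalently $pG_p=0$; $G_p=0$ is allowed). A subgroup $H$ of a group $A$ is pure if $nH=H\cap nA$ for all $n\in\mathbb{N}$. A subring of $\prod$ is called pure if its additive group is a pure subgroup of $\prod$. An sp-group is a reduced mixed (neither torsion nor torsion-free) group $G$ with infinitely many nonzero $p$-components such that, for every prime $p$, $G=G_p\oplus B_p$ for some group $B_p$ with $pB_p=B_p$ (equivalently: there are embeddings $\bigoplus_pG_p<G\le\prod_pG_p$ with $G$ pure in $\prod_p G_p$). In general, for a subset $T$ of $\prod$, the paper defines $\mathbb{M}_T=\{x\in\prod\mid\exists k\in\mathbb{N},\ kx\in\oplus+T\}$; when $T$ is closed under multiplication by integers (e.g. a subring) this coincides with the set displayed in the claim. A ring $R$ is right $\aleph_0$-self-injective if for every countably generated right ideal $I$ of $R$, every right $R$-module homomorphism $f:I\to R$ extends to a right $R$-module homomorphism $\bar f:R\to R$; left $\aleph_0$-self-injective is defined symmetrically. *)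

theory Defs
  imports "HOL-Algebra.Algebra" "HOL-Algebra.Algebraic_Closure_Type"
begin

section \<open>Abelian groups\<close>

text \<open>Abelian groups are written multiplicatively, as in HOL-Algebra: the multiple \<open>n x\<close> is
  \<open>x [^] n\<close>, and a group is zero if its carrier is \<open>{\<one>}\<close>.\<close>

text \<open>Here primes are those of HOL-Computational-Algebra; \<open>prime\<close> alone would denote the
  constant of HOL-Algebra's theory of divisibility in monoids.\<close>

abbreviation primes :: "nat set" where
  "primes \<equiv> {p. Factorial_Ring.prime p}"

definition p_component :: "('a, 'b) monoid_scheme \<Rightarrow> nat \<Rightarrow> 'a set" where
  "p_component G p = {x \<in> carrier G. \<exists>n::nat. x [^]\<^bsub>G\<^esub> (p ^ n) = \<one>\<^bsub>G\<^esub>}"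

abbreviation p_part :: "('a, 'b) monoid_scheme \<Rightarrow> nat \<Rightarrow> ('a, 'b) monoid_scheme" where
  "p_part G p \<equiv> G\<lparr>carrier := p_component G p\<rparr>"

definition torsion_part :: "('a, 'b) monoid_scheme \<Rightarrow> 'a set" where
  "torsion_part G = {x \<in> carrier G. \<exists>n::nat. n > 0 \<and> x [^]\<^bsub>G\<^esub> n = \<one>\<^bsub>G\<^esub>}"

definition mixed_group :: "('a, 'b) monoid_scheme \<Rightarrow> bool" where
  "mixed_group G \<longleftrightarrow> torsion_part G \<noteq> carrier G \<and> torsion_part G \<noteq> {\<one>\<^bsub>G\<^esub>}"

definition divisible_subgroup :: "'a set \<Rightarrow> ('a, 'b) monoid_scheme \<Rightarrow> bool" where
  "divisible_subgroup D G \<longleftrightarrow>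
     subgroup D G \<and> (\<forall>n::nat. n > 0 \<longrightarrow> (\<lambda>x. x [^]\<^bsub>G\<^esub> n) ` D = D)"

definition reduced_group :: "('a, 'b) monoid_scheme \<Rightarrow> bool" where
  "reduced_group G \<longleftrightarrow> (\<forall>D. divisible_subgroup D G \<longrightarrow> D = {\<one>\<^bsub>G\<^esub>})"

definition pure_subgroup :: "'a set \<Rightarrow> ('a, 'b) monoid_scheme \<Rightarrow> bool" where
  "pure_subgroup H G \<longleftrightarrow> subgroup H G \<and>
     (\<forall>n::nat. n > 0 \<longrightarrow>
        (\<lambda>x. x [^]\<^bsub>G\<^esub> n) ` H = H \<inter> (\<lambda>x. x [^]\<^bsub>G\<^esub> n) ` carrier G)"

text \<open>A direct sum of copies of \<open>\<int>/p\<close>. Index sets of type \<^typ>\<open>'a set\<close> suffice,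
  since a basis of such a group \<open>H\<close> is a subset of its carrier.\<close>

definition elementary_group :: "nat \<Rightarrow> ('a, 'b) monoid_scheme \<Rightarrow> bool" where
  "elementary_group p H \<longleftrightarrow> (\<exists>I :: 'a set. H \<cong> sum_group I (\<lambda>_. integer_mod_group p))"

definition sp_group :: "('a, 'b) monoid_scheme \<Rightarrow> bool" where
  "sp_group G \<longleftrightarrow>
     comm_group G \<and> reduced_group G \<and> mixed_group G \<and>
     infinite {p \<in> primes. p_component G p \<noteq> {\<one>\<^bsub>G\<^esub>}} \<and>
     (\<forall>p \<in> primes.
        (\<exists>B. subgroup B G \<and>
             p_component G p <#>\<^bsub>G\<^esub> B = carrier G \<and> p_component G p \<inter> B = {\<one>\<^bsub>G\<^esub>} \<and>
             (\<lambda>x. x [^]\<^bsub>G\<^esub> p) ` B = B))"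


section \<open>The rings\<close>

text \<open>Endomorphisms are restricted to be \<^const>\<open>extensional\<close>, so that equality of functions
  is equality on the carrier.\<close>

definition end_ring :: "('a, 'b) monoid_scheme \<Rightarrow> ('a \<Rightarrow> 'a) ring" where
  "end_ring H =
     \<lparr>carrier = hom H H \<inter> extensional (carrier H),
      monoid.mult = (\<lambda>f g. compose (carrier H) f g),
      one = (\<lambda>x\<in>carrier H. x),
      ring.zero = (\<lambda>x\<in>carrier H. \<one>\<^bsub>H\<^esub>),
      ring.add = (\<lambda>f g. \<lambda>x\<in>carrier H. f x \<otimes>\<^bsub>H\<^esub> g x)\<rparr>"

definition product_ring :: "'i set \<Rightarrow> ('i \<Rightarrow> ('a, 'b) ring_scheme) \<Rightarrow> ('i \<Rightarrow> 'a) ring" where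
  "product_ring I R =
     \<lparr>carrier = (\<Pi>\<^sub>E i\<in>I. carrier (R i)),
      monoid.mult = (\<lambda>x y. \<lambda>i\<in>I. x i \<otimes>\<^bsub>R i\<^esub> y i),
      one = (\<lambda>i\<in>I. \<one>\<^bsub>R i\<^esub>),
      ring.zero = (\<lambda>i\<in>I. \<zero>\<^bsub>R i\<^esub>),
      ring.add = (\<lambda>x y. \<lambda>i\<in>I. x i \<oplus>\<^bsub>R i\<^esub> y i)\<rparr>"

definition direct_sum :: "'i set \<Rightarrow> ('i \<Rightarrow> ('a, 'b) ring_scheme) \<Rightarrow> ('i \<Rightarrow> 'a) set" where
  "direct_sum I R = {x \<in> carrier (product_ring I R). finite {i \<in> I. x i \<noteq> \<zero>\<^bsub>R i\<^esub>}}"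

definition end_prod :: "('a, 'b) monoid_scheme \<Rightarrow> (nat \<Rightarrow> 'a \<Rightarrow> 'a) ring" where
  "end_prod G = product_ring primes (\<lambda>p. end_ring (p_part G p))"

definition end_sum :: "('a, 'b) monoid_scheme \<Rightarrow> (nat \<Rightarrow> 'a \<Rightarrow> 'a) set" where
  "end_sum G = direct_sum primes (\<lambda>p. end_ring (p_part G p))"

definition M_set ::
    "('a, 'b) monoid_scheme \<Rightarrow> (nat \<Rightarrow> 'a \<Rightarrow> 'a) set \<Rightarrow> (nat \<Rightarrow> 'a \<Rightarrow> 'a) set" where
  "M_set G T = {x \<in> carrier (end_prod G). \<exists>k::nat. k > 0 \<and> add_pow (end_prod G) k x \<in> T}"

abbreviation M_ring ::
    "('a, 'b) monoid_scheme \<Rightarrow> (nat \<Rightarrow> 'a \<Rightarrow> 'a) set \<Rightarrow> (nat \<Rightarrow> 'a \<Rightarrow> 'a) ring" where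
  "M_ring G T \<equiv> (end_prod G)\<lparr>carrier := M_set G T\<rparr>"


section \<open>Tensor product of rings over the integers\<close>

text \<open>The free abelian group on \<open>A \<times> B\<close>, with the biadditive multiplication determined by
  \<open>(a, b) (a', b') = (a a', b b')\<close> on generators.\<close>

definition free_pair_ring ::
    "('a, 'm) ring_scheme \<Rightarrow> ('b, 'n) ring_scheme \<Rightarrow> ('a \<times> 'b \<Rightarrow>\<^sub>0 int) ring" where
  "free_pair_ring A B =
     \<lparr>carrier = carrier (free_Abelian_group (carrier A \<times> carrier B)),
      monoid.mult = (\<lambda>c d. frag_extend (\<lambda>(a, b).
                frag_extend (\<lambda>(a', b'). frag_of (a \<otimes>\<^bsub>A\<^esub> a', b \<otimes>\<^bsub>B\<^esub> b')) d) c),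
      one = frag_of (\<one>\<^bsub>A\<^esub>, \<one>\<^bsub>B\<^esub>),
      ring.zero = 0,
      ring.add = (+)\<rparr>"

definition tensor_relations ::
    "('a, 'm) ring_scheme \<Rightarrow> ('b, 'n) ring_scheme \<Rightarrow> ('a \<times> 'b \<Rightarrow>\<^sub>0 int) set" where
  "tensor_relations A B =
     {frag_of (a \<oplus>\<^bsub>A\<^esub> a', b) - frag_of (a, b) - frag_of (a', b) | a a' b.
        a \<in> carrier A \<and> a' \<in> carrier A \<and> b \<in> carrier B} \<union>
     {frag_of (a, b \<oplus>\<^bsub>B\<^esub> b') - frag_of (a, b) - frag_of (a, b') | a b b'.
        a \<in> carrier A \<and> b \<in> carrier B \<and> b' \<in> carrier B}"

text \<open>The subgroup generated by the relations is an ideal, so the quotient below is the usual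
  tensor product of abelian groups with \<open>(a \<otimes> b) (a' \<otimes> b') = a a' \<otimes> b b'\<close>. Over the
  integers, balancedness follows from biadditivity.\<close>

definition tensor_ring ::
    "('a, 'm) ring_scheme \<Rightarrow> ('b, 'n) ring_scheme \<Rightarrow> ('a \<times> 'b \<Rightarrow>\<^sub>0 int) set ring" where
  "tensor_ring A B =
     free_pair_ring A B Quot
       generate (add_monoid (free_pair_ring A B)) (tensor_relations A B)"

abbreviation rat_ring :: "rat ring" where
  "rat_ring \<equiv> ring_of_type_algebra"


section \<open>Noncommutative ring theory\<close>

text \<open>Left-hand notions are the right-hand notions for the opposite ring.\<close>

definition opposite_ring :: "('a, 'm) ring_scheme \<Rightarrow> ('a, 'm) ring_scheme" where
  "opposite_ring R = R\<lparr>monoid.mult := (\<lambda>x y. y \<otimes>\<^bsub>R\<^esub> x)\<rparr>"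

definition regular_ring :: "('a, 'm) ring_scheme \<Rightarrow> bool" where
  "regular_ring R \<longleftrightarrow>
     ring R \<and> (\<forall>a \<in> carrier R. \<exists>x \<in> carrier R. a \<otimes>\<^bsub>R\<^esub> x \<otimes>\<^bsub>R\<^esub> a = a)"

definition right_ideal :: "'a set \<Rightarrow> ('a, 'm) ring_scheme \<Rightarrow> bool" where
  "right_ideal I R \<longleftrightarrow>
     additive_subgroup I R \<and> (\<forall>x \<in> I. \<forall>r \<in> carrier R. x \<otimes>\<^bsub>R\<^esub> r \<in> I)"

definition essential_right_ideal :: "'a set \<Rightarrow> ('a, 'm) ring_scheme \<Rightarrow> bool" where
  "essential_right_ideal I R \<longleftrightarrow>
     right_ideal I R \<and>
     (\<forall>J. right_ideal J R \<and> J \<noteq> {\<zero>\<^bsub>R\<^esub>} \<longrightarrow> I \<inter> J \<noteq> {\<zero>\<^bsub>R\<^esub>})"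

definition right_annihilator :: "('a, 'm) ring_scheme \<Rightarrow> 'a \<Rightarrow> 'a set" where
  "right_annihilator R x = {r \<in> carrier R. x \<otimes>\<^bsub>R\<^esub> r = \<zero>\<^bsub>R\<^esub>}"

definition right_singular_ideal :: "('a, 'm) ring_scheme \<Rightarrow> 'a set" where
  "right_singular_ideal R =
     {x \<in> carrier R. essential_right_ideal (right_annihilator R x) R}"

definition right_nonsingular :: "('a, 'm) ring_scheme \<Rightarrow> bool" where
  "right_nonsingular R \<longleftrightarrow> ring R \<and> right_singular_ideal R = {\<zero>\<^bsub>R\<^esub>}"

definition left_nonsingular :: "('a, 'm) ring_scheme \<Rightarrow> bool" where
  "left_nonsingular R \<longleftrightarrow> right_nonsingular (opposite_ring R)"

text \<open>Utumi's definition: \<open>R\<close> is a subring of \<open>Q\<close> that is dense as a right \<open>R\<close>-submodule.\<close>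

definition right_quotient_ring :: "('a, 'm) ring_scheme \<Rightarrow> 'a set \<Rightarrow> bool" where
  "right_quotient_ring Q R \<longleftrightarrow>
     ring Q \<and> subring R Q \<and>
     (\<forall>x \<in> carrier Q. \<forall>y \<in> carrier Q. x \<noteq> \<zero>\<^bsub>Q\<^esub> \<longrightarrow>
        (\<exists>r \<in> R. x \<otimes>\<^bsub>Q\<^esub> r \<noteq> \<zero>\<^bsub>Q\<^esub> \<and> y \<otimes>\<^bsub>Q\<^esub> r \<in> R))"

text \<open>\<open>Q\<close> is a right maximal quotient ring of \<open>R\<close> if it is a right quotient ring of \<open>R\<close> into
  which every right quotient ring \<open>S\<close> of \<open>R\<close> embeds over \<open>R\<close>. A type token names the type
  over which \<open>S\<close> ranges; as a conclusion, the property is to be stated with a type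
  variable there.\<close>

definition right_maximal_quotient_ring ::
    "'s itself \<Rightarrow> ('a, 'm) ring_scheme \<Rightarrow> 'a set \<Rightarrow> bool" where
  "right_maximal_quotient_ring (_ :: 's itself) Q R \<longleftrightarrow>
     right_quotient_ring Q R \<and>
     (\<forall>(S :: 's ring) i.
        i \<in> ring_hom (Q\<lparr>carrier := R\<rparr>) S \<and> inj_on i R \<and> right_quotient_ring S (i ` R) \<longrightarrow>
        (\<exists>g. g \<in> ring_hom S Q \<and> inj_on g (carrier S) \<and> (\<forall>r \<in> R. g (i r) = r)))"

definition left_maximal_quotient_ring ::
    "'s itself \<Rightarrow> ('a, 'm) ring_scheme \<Rightarrow> 'a set \<Rightarrow> bool" where
  "left_maximal_quotient_ring t Q R \<longleftrightarrow> right_maximal_quotient_ring t (opposite_ring Q) R"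

definition countably_generated_right_ideal :: "'a set \<Rightarrow> ('a, 'm) ring_scheme \<Rightarrow> bool" where
  "countably_generated_right_ideal I R \<longleftrightarrow>
     right_ideal I R \<and>
     (\<exists>S. countable S \<and> S \<subseteq> carrier R \<and> I = \<Inter> {J. right_ideal J R \<and> S \<subseteq> J})"

definition right_module_hom :: "('a, 'm) ring_scheme \<Rightarrow> 'a set \<Rightarrow> ('a \<Rightarrow> 'a) \<Rightarrow> bool" where
  "right_module_hom R I f \<longleftrightarrow>
     f \<in> I \<rightarrow> carrier R \<and>
     (\<forall>x \<in> I. \<forall>y \<in> I. f (x \<oplus>\<^bsub>R\<^esub> y) = f x \<oplus>\<^bsub>R\<^esub> f y) \<and>
     (\<forall>x \<in> I. \<forall>r \<in> carrier R. f (x \<otimes>\<^bsub>R\<^esub> r) = f x \<otimes>\<^bsub>R\<^esub> r)"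

definition right_aleph0_self_injective :: "('a, 'm) ring_scheme \<Rightarrow> bool" where
  "right_aleph0_self_injective R \<longleftrightarrow>
     ring R \<and>
     (\<forall>I f. countably_generated_right_ideal I R \<and> right_module_hom R I f \<longrightarrow>
        (\<exists>g. right_module_hom R (carrier R) g \<and> (\<forall>x \<in> I. g x = f x)))"

definition left_aleph0_self_injective :: "('a, 'm) ring_scheme \<Rightarrow> bool" where
  "left_aleph0_self_injective R \<longleftrightarrow> right_aleph0_self_injective (opposite_ring R)"

end

theory Submission
  imports Defs
begin

text \<open>
  Write \<open>R\<^sub>p = End G\<^sub>p\<close>. As \<open>p G\<^sub>p = 0\<close>, the ring \<open>R\<^sub>p\<close> is regular and killed by \<open>p\<close>.
  A positive integer acts bijectively on all but finitely many \<open>R\<^sub>p\<close>, so the direct sum is the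
  torsion subgroup of \<open>\<Prod> R\<^sub>p\<close> and \<open>\<Prod> R\<^sub>p/\<Oplus> R\<^sub>p\<close> is a \<open>\<rat>\<close>-algebra, in which the
  \<open>\<rat>\<close>-span of the image of \<open>T\<close> is \<open>\<M>\<^sub>T/\<Oplus> R\<^sub>p \<cong> T \<otimes> \<rat>\<close>. Regularity lifts
  along the regular ideal \<open>\<Oplus> R\<^sub>p\<close>. The remaining ring-theoretic claims hold for any subring
  between the sum and the product of regular rings: restrict to a single component through its
  central idempotent \<open>e\<^sub>p\<close>. Left-hand versions follow by passing to opposite rings.
\<close>

section \<open>Products of rings\<close>

text \<open>The set \<open>M_set\<close> asks for \<open>k x\<close> in \<open>T\<close> alone, yet
  it absorbs the direct sum: each \<open>d\<close> there has \<open>k d = 0\<close> for some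
  \<open>k > 0\<close>, and \<open>0\<close> lies in \<open>T\<close>. Finite components matter in
  two places. In a finite regular ring an essential right ideal contains \<open>1\<close>; for an
  infinite-dimensional space the endomorphisms of finite rank form a proper essential right ideal.
  Finiteness also bounds the fibres of multiplication by \<open>k\<close>. The tensor ring is a free
  group modulo relations, and its elements have no evident normal form, so injectivity of a map out
  of it cannot be read off. The remedy is to show that every element is congruent to a single
  generator \<open>(a, 1/k)\<close>; then only generators have to be tested. The map goes into the
  whole quotient of the product by the sum, where division by positive integers is possible and
  unique, and the part belonging to \<open>T\<close> is located afterwards as its image.\<close>

lemma product_ring_simps [simp]:
  "carrier (product_ring I R) = (\<Pi>\<^sub>E i\<in>I. carrier (R i))"
  "x \<otimes>\<^bsub>product_ring I R\<^esub> y = (\<lambda>i\<in>I. x i \<otimes>\<^bsub>R i\<^esub> y i)"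
  "\<one>\<^bsub>product_ring I R\<^esub> = (\<lambda>i\<in>I. \<one>\<^bsub>R i\<^esub>)"
  "\<zero>\<^bsub>product_ring I R\<^esub> = (\<lambda>i\<in>I. \<zero>\<^bsub>R i\<^esub>)"
  "x \<oplus>\<^bsub>product_ring I R\<^esub> y = (\<lambda>i\<in>I. x i \<oplus>\<^bsub>R i\<^esub> y i)"
  by (simp_all add: product_ring_def)

lemma ring_product_ring:
  assumes "\<And>i. i \<in> I \<Longrightarrow> ring (R i)"
  shows "ring (product_ring I R)"
proof (rule ringI)
  show "abelian_group (product_ring I R)"
  proof (rule abelian_groupI)
    fix x assume x: "x \<in> carrier (product_ring I R)"
    have "(\<lambda>i\<in>I. \<ominus>\<^bsub>R i\<^esub> x i) \<oplus>\<^bsub>product_ring I R\<^esub> x = \<zero>\<^bsub>product_ring I R\<^esub>"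
      using x by (auto simp: fun_eq_iff dest!: PiE_mem intro!: abelian_group.l_neg[OF ring.is_abelian_group[OF assms]])
    moreover have "(\<lambda>i\<in>I. \<ominus>\<^bsub>R i\<^esub> x i) \<in> carrier (product_ring I R)"
      using x by (auto dest!: PiE_mem intro!: abelian_group.a_inv_closed[OF ring.is_abelian_group[OF assms]])
    ultimately show "\<exists>y\<in>carrier (product_ring I R). y \<oplus>\<^bsub>product_ring I R\<^esub> x = \<zero>\<^bsub>product_ring I R\<^esub>"
      by blast
  qed (auto simp: fun_eq_iff PiE_iff extensional_def ring.ring_simprules(1,2,7,8) assms
      intro: ring.ring_simprules(10) assms)
  show "Group.monoid (product_ring I R)"
    by (rule monoidI)
      (auto simp: fun_eq_iff PiE_iff extensional_def ring.ring_simprules(5,6,11,12)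
        monoid.r_one[OF ring.is_monoid] assms)
qed (auto simp: fun_eq_iff PiE_iff extensional_def ring.ring_simprules assms)

lemma product_ring_a_inv:
  assumes "\<And>i. i \<in> I \<Longrightarrow> ring (R i)" and "x \<in> carrier (product_ring I R)" and "i \<in> I"
  shows "(\<ominus>\<^bsub>product_ring I R\<^esub> x) i = \<ominus>\<^bsub>R i\<^esub> x i"
proof -
  interpret P: ring "product_ring I R"
    by (rule ring_product_ring[OF assms(1)])
  interpret R: ring "R i"
    by (rule assms(1)[OF assms(3)])
  have "(\<ominus>\<^bsub>product_ring I R\<^esub> x \<oplus>\<^bsub>product_ring I R\<^esub> x) i = \<zero>\<^bsub>R i\<^esub>"
    unfolding P.l_neg[OF assms(2)] by (simp add: assms(3))
  moreover have "(\<ominus>\<^bsub>product_ring I R\<^esub> x) i \<in> carrier (R i)"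
    using P.a_inv_closed[OF assms(2)] assms(3) by auto
  ultimately show ?thesis
    using assms(2,3) by (auto intro!: R.minus_equality[symmetric])
qed

lemma product_ring_add_pow:
  assumes "i \<in> I"
  shows "(add_pow (product_ring I R) (k::nat) x) i = add_pow (R i) k (x i)"
  using assms by (induction k) (simp_all add: add_pow_def nat_pow_def)

locale ring_product =
  fixes I :: "'i set" and R :: "'i \<Rightarrow> ('a, 'm) ring_scheme"
  assumes ring_component: "i \<in> I \<Longrightarrow> ring (R i)"
begin

abbreviation P where "P \<equiv> product_ring I R"

sublocale P: ring P
  by (rule ring_product_ring) (rule ring_component)

lemmas component_simps = ring.ring_simprules[OF ring_component]

lemma P_eqI:
  assumes "x \<in> carrier P" "y \<in> carrier P" "\<And>i. i \<in> I \<Longrightarrow> x i = y i"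
  shows "x = y"
  using assms by (auto intro: PiE_ext)

text \<open>Any finite superset of the support will do, so closure proofs can use unions of supports
  instead of exact ones.\<close>

lemma direct_sumI:
  assumes "x \<in> carrier P" "finite F" "\<And>i. i \<in> I \<Longrightarrow> i \<notin> F \<Longrightarrow> x i = \<zero>\<^bsub>R i\<^esub>"
  shows "x \<in> direct_sum I R"
proof -
  have "{i \<in> I. x i \<noteq> \<zero>\<^bsub>R i\<^esub>} \<subseteq> F"
    using assms(3) by auto
  then show ?thesis
    using assms(1,2) finite_subset by (simp add: direct_sum_def)
qed

lemma direct_sumE:
  assumes "x \<in> direct_sum I R"
  obtains F where "x \<in> carrier P" "finite F" "\<And>i. i \<in> I \<Longrightarrow> i \<notin> F \<Longrightarrow> x i = \<zero>\<^bsub>R i\<^esub>"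
proof
  show "x \<in> carrier P" "finite {i \<in> I. x i \<noteq> \<zero>\<^bsub>R i\<^esub>}"
    using assms by (simp_all add: direct_sum_def)
qed simp

lemma ideal_direct_sum: "ideal (direct_sum I R) P"
proof (rule idealI[OF P.ring_axioms])
  show "subgroup (direct_sum I R) (add_monoid P)"
  proof (rule P.add.subgroupI)
    show "direct_sum I R \<subseteq> carrier P"
      by (auto simp: direct_sum_def)
    have "\<zero>\<^bsub>P\<^esub> \<in> direct_sum I R"
      by (rule direct_sumI[OF P.zero_closed, of "{}"]) simp_all
    then show "direct_sum I R \<noteq> {}"
      by blast
    fix x assume "x \<in> direct_sum I R"
    then obtain F where F: "x \<in> carrier P" "finite F" "\<And>i. i \<in> I \<Longrightarrow> i \<notin> F \<Longrightarrow> x i = \<zero>\<^bsub>R i\<^esub>"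
      by (rule direct_sumE) auto
    then show "\<ominus>\<^bsub>P\<^esub> x \<in> direct_sum I R"
      using component_simps(21)
      by (intro direct_sumI[OF P.a_inv_closed, of _ F]) (auto simp: product_ring_a_inv ring_component)
    fix y assume "y \<in> direct_sum I R"
    then obtain F' where "y \<in> carrier P" "finite F'" "\<And>i. i \<in> I \<Longrightarrow> i \<notin> F' \<Longrightarrow> y i = \<zero>\<^bsub>R i\<^esub>"
      by (rule direct_sumE) auto
    then show "x \<oplus>\<^bsub>P\<^esub> y \<in> direct_sum I R"
      using F component_simps(2,8) by (intro direct_sumI[OF P.a_closed, of _ _ "F \<union> F'"]) auto
  qed
  fix a x assume a: "a \<in> direct_sum I R" and x: "x \<in> carrier P"
  from a obtain F where F: "a \<in> carrier P" "finite F" "\<And>i. i \<in> I \<Longrightarrow> i \<notin> F \<Longrightarrow> a i = \<zero>\<^bsub>R i\<^esub>"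
    by (rule direct_sumE) auto
  show "x \<otimes>\<^bsub>P\<^esub> a \<in> direct_sum I R"
    using x F by (intro direct_sumI[OF P.m_closed, of _ _ F]) (auto dest!: PiE_mem intro: component_simps(25))
  show "a \<otimes>\<^bsub>P\<^esub> x \<in> direct_sum I R"
    using x F by (intro direct_sumI[OF P.m_closed, of _ _ F]) (auto dest!: PiE_mem intro: component_simps(24))
qed

end

section \<open>Opposite rings\<close>

lemma opposite_ring_simps [simp]:
  "carrier (opposite_ring R) = carrier R"
  "x \<otimes>\<^bsub>opposite_ring R\<^esub> y = y \<otimes>\<^bsub>R\<^esub> x"
  "\<one>\<^bsub>opposite_ring R\<^esub> = \<one>\<^bsub>R\<^esub>"
  "\<zero>\<^bsub>opposite_ring R\<^esub> = \<zero>\<^bsub>R\<^esub>"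
  "ring.add (opposite_ring R) = ring.add R"
  "opposite_ring (R\<lparr>carrier := C\<rparr>) = (opposite_ring R)\<lparr>carrier := C\<rparr>"
  by (simp_all add: opposite_ring_def)

lemma add_monoid_opposite_ring [simp]: "add_monoid (opposite_ring R) = add_monoid R"
  by (simp add: opposite_ring_def)

lemma ring_opposite_ring:
  assumes "ring R" shows "ring (opposite_ring R)"
proof -
  interpret ring R by fact
  show ?thesis
  proof (rule ringI)
    show "abelian_group (opposite_ring R)"
      by (rule comm_group_abelian_groupI) (simp add: a_comm_group)
    show "Group.monoid (opposite_ring R)"
      by (rule monoidI) (simp_all add: m_assoc)
  qed (simp_all add: l_distr r_distr)
qed

lemma opposite_product_ring:
  "opposite_ring (product_ring I R) = product_ring I (\<lambda>i. opposite_ring (R i))"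
  by (simp add: opposite_ring_def product_ring_def)

lemma direct_sum_opposite_ring:
  "direct_sum I (\<lambda>i. opposite_ring (R i)) = direct_sum I R"
  by (simp add: direct_sum_def)

lemma subring_opposite_ring:
  assumes "subring S R" shows "subring S (opposite_ring R)"
  using assms by (simp add: subring_def submonoid_def)

lemma regular_opposite_ring:
  assumes "regular_ring R" shows "regular_ring (opposite_ring R)"
proof -
  interpret ring R
    using assms by (simp add: regular_ring_def)
  have "\<exists>x \<in> carrier R. a \<otimes>\<^bsub>R\<^esub> (x \<otimes>\<^bsub>R\<^esub> a) = a" if "a \<in> carrier R" for a
    using assms that by (fastforce simp: regular_ring_def m_assoc)
  then show ?thesis
    using assms by (simp add: regular_ring_def ring_opposite_ring)
qed

section \<open>Subrings of products of regular rings\<close>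

text \<open>Negatives come for free, since \<open>-x = x (-1)\<close>.\<close>

lemma right_ideal_iff:
  assumes "ring R"
  shows "right_ideal J R \<longleftrightarrow>
    J \<subseteq> carrier R \<and> \<zero>\<^bsub>R\<^esub> \<in> J \<and> (\<forall>x\<in>J. \<forall>y\<in>J. x \<oplus>\<^bsub>R\<^esub> y \<in> J) \<and>
    (\<forall>x\<in>J. \<forall>r\<in>carrier R. x \<otimes>\<^bsub>R\<^esub> r \<in> J)" (is "?L \<longleftrightarrow> ?R")
proof
  interpret ring R by fact
  show ?R if ?L
    using that unfolding right_ideal_def
    by (auto dest: additive_subgroup.a_Hcarr additive_subgroup.zero_closed
        additive_subgroup.a_closed)
  assume R: ?R
  have "\<ominus>\<^bsub>R\<^esub> x \<in> J" if "x \<in> J" for x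
    using R that by (metis a_inv_closed one_closed r_minus r_one subsetD)
  then have "subgroup J (add_monoid R)"
    using R by (intro add.subgroupI) auto
  then show ?L
    using R by (simp add: right_ideal_def additive_subgroup_def)
qed

text \<open>The hypothesis \<open>dense\<close> is essentiality of \<open>D\<close> in terms of
  elements. By finiteness some idempotent \<open>f\<close> in \<open>D\<close> has
  \<open>f A\<close> maximal. If \<open>1\<close> were not in \<open>D\<close>, density would give a
  nonzero \<open>b = (1 - f) r\<close> in \<open>D\<close>, and regularity turns \<open>b\<close>
  into an idempotent of \<open>D\<close> that enlarges \<open>f A\<close>.\<close>

lemma one_in_dense_right_ideal:
  assumes "regular_ring A" "finite (carrier A)" and D: "right_ideal D A"
    and dense: "\<And>b. b \<in> carrier A \<Longrightarrow> b \<noteq> \<zero>\<^bsub>A\<^esub> \<Longrightarrow>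
      \<exists>r\<in>carrier A. b \<otimes>\<^bsub>A\<^esub> r \<noteq> \<zero>\<^bsub>A\<^esub> \<and> b \<otimes>\<^bsub>A\<^esub> r \<in> D"
  shows "\<one>\<^bsub>A\<^esub> \<in> D"
proof (rule ccontr)
  assume one: "\<one>\<^bsub>A\<^esub> \<notin> D"
  interpret ring A
    using assms(1) by (simp add: regular_ring_def)
  note Dr = D[unfolded right_ideal_iff[OF ring_axioms]]
  let ?F = "{f \<in> D. f \<otimes>\<^bsub>A\<^esub> f = f}"
  let ?gen = "\<lambda>f. (\<lambda>a. f \<otimes>\<^bsub>A\<^esub> a) ` carrier A"
  have "\<zero>\<^bsub>A\<^esub> \<in> ?F"
    using Dr by simp
  then have nonempty: "?gen ` ?F \<noteq> {}"
    by blast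
  have "?F \<subseteq> carrier A"
    using Dr by blast
  then have "finite (?gen ` ?F)"
    using assms(2) by (intro finite_imageI) (rule finite_subset)
  from finite_has_maximal[OF this nonempty] obtain m
    where m: "m \<in> ?gen ` ?F" and max: "\<forall>l \<in> ?gen ` ?F. m \<subseteq> l \<longrightarrow> m = l"
    by (rule bexE)
  obtain f where "m = ?gen f" "f \<in> ?F"
    using m by (rule imageE)
  then have f: "f \<in> D" "f \<otimes>\<^bsub>A\<^esub> f = f" and max: "\<And>h. h \<in> ?F \<Longrightarrow> ?gen f \<subseteq> ?gen h \<Longrightarrow> ?gen f = ?gen h"
    using max by simp_all
  have fc: "f \<in> carrier A"
    using f Dr by blast
  have "\<one>\<^bsub>A\<^esub> \<ominus>\<^bsub>A\<^esub> f \<noteq> \<zero>\<^bsub>A\<^esub>"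
    using one f fc by (metis one_closed r_right_minus_eq)
  then obtain r where r: "r \<in> carrier A" "(\<one>\<^bsub>A\<^esub> \<ominus>\<^bsub>A\<^esub> f) \<otimes>\<^bsub>A\<^esub> r \<noteq> \<zero>\<^bsub>A\<^esub>" "(\<one>\<^bsub>A\<^esub> \<ominus>\<^bsub>A\<^esub> f) \<otimes>\<^bsub>A\<^esub> r \<in> D"
    using dense[of "\<one>\<^bsub>A\<^esub> \<ominus>\<^bsub>A\<^esub> f"] fc by auto
  define b where "b = (\<one>\<^bsub>A\<^esub> \<ominus>\<^bsub>A\<^esub> f) \<otimes>\<^bsub>A\<^esub> r"
  have b: "b \<in> carrier A" "b \<in> D" "b \<noteq> \<zero>\<^bsub>A\<^esub>"
    using r fc by (simp_all add: b_def)
  have "f \<otimes>\<^bsub>A\<^esub> (\<one>\<^bsub>A\<^esub> \<ominus>\<^bsub>A\<^esub> f) = \<zero>\<^bsub>A\<^esub>"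
    using fc f by (simp add: minus_eq r_distr r_minus r_neg)
  then have fb: "f \<otimes>\<^bsub>A\<^esub> b = \<zero>\<^bsub>A\<^esub>"
    using fc r by (simp add: b_def m_assoc[symmetric])
  obtain y where y: "y \<in> carrier A" "b \<otimes>\<^bsub>A\<^esub> y \<otimes>\<^bsub>A\<^esub> b = b"
    using assms(1) b by (auto simp: regular_ring_def)
  \<comment> \<open>By \<open>b y b = b\<close> this is an idempotent with \<open>g A = b A\<close>;
    it lies in \<open>D\<close>, and \<open>f g = 0\<close> because \<open>f b = 0\<close>.\<close>
  define g where "g = b \<otimes>\<^bsub>A\<^esub> y"
  have g: "g \<in> carrier A" "g \<in> D"
    using b y Dr by (auto simp: g_def)
  have gg: "g \<otimes>\<^bsub>A\<^esub> g = g"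
    using b y by (simp add: g_def m_assoc[symmetric])
  have fg: "f \<otimes>\<^bsub>A\<^esub> g = \<zero>\<^bsub>A\<^esub>"
    using fb fc b y by (simp add: g_def m_assoc[symmetric])
  have g0: "g \<noteq> \<zero>\<^bsub>A\<^esub>"
    using b y by (auto simp: g_def)
  \<comment> \<open>The product \<open>g f\<close> may be nonzero, so \<open>f + g\<close> need not
    be idempotent. The factor \<open>1 - f\<close> repairs this: \<open>h\<close> is a left identity
    for both \<open>f\<close> and \<open>g\<close>, hence idempotent, and \<open>h A\<close>
    contains \<open>f A\<close> and \<open>g\<close>.\<close>
  define h where "h = f \<oplus>\<^bsub>A\<^esub> g \<otimes>\<^bsub>A\<^esub> (\<one>\<^bsub>A\<^esub> \<ominus>\<^bsub>A\<^esub> f)"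
  have h: "h \<in> carrier A" "h \<in> D"
    using fc g f Dr by (auto simp: h_def)
  have "(\<one>\<^bsub>A\<^esub> \<ominus>\<^bsub>A\<^esub> f) \<otimes>\<^bsub>A\<^esub> f = \<zero>\<^bsub>A\<^esub>" "(\<one>\<^bsub>A\<^esub> \<ominus>\<^bsub>A\<^esub> f) \<otimes>\<^bsub>A\<^esub> g = g"
    using fc f g fg by (simp_all add: minus_eq l_distr l_minus r_neg)
  then have hf: "h \<otimes>\<^bsub>A\<^esub> f = f" and hg: "h \<otimes>\<^bsub>A\<^esub> g = g"
    using fc f g fg gg by (simp_all add: h_def l_distr m_assoc)
  have "h \<otimes>\<^bsub>A\<^esub> h = h \<otimes>\<^bsub>A\<^esub> f \<oplus>\<^bsub>A\<^esub> h \<otimes>\<^bsub>A\<^esub> g \<otimes>\<^bsub>A\<^esub> (\<one>\<^bsub>A\<^esub> \<ominus>\<^bsub>A\<^esub> f)"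
    using h(1) fc g by (subst (2) h_def) (simp add: r_distr m_assoc)
  then have hh: "h \<otimes>\<^bsub>A\<^esub> h = h"
    by (simp add: hf hg) (simp add: h_def)
  have "?gen f \<subseteq> ?gen h"
  proof
    fix z assume "z \<in> ?gen f"
    then obtain a where a: "a \<in> carrier A" "z = f \<otimes>\<^bsub>A\<^esub> a"
      by blast
    then have "z = h \<otimes>\<^bsub>A\<^esub> (f \<otimes>\<^bsub>A\<^esub> a)"
      using hf h fc by (simp add: m_assoc[symmetric])
    then show "z \<in> ?gen h"
      using a fc by blast
  qed
  then have "?gen f = ?gen h"
    using h hh by (intro max) auto
  \<comment> \<open>If \<open>g\<close> lay in \<open>f A\<close>, then \<open>g = f g = 0\<close>,
    although \<open>b = g b\<close> is nonzero.\<close>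
  moreover have "g \<in> ?gen h"
    using hg g by force
  ultimately obtain a where a: "a \<in> carrier A" "g = f \<otimes>\<^bsub>A\<^esub> a"
    by blast
  then have "f \<otimes>\<^bsub>A\<^esub> g = g"
    using f fc by (simp add: m_assoc[symmetric])
  with fg g0 show False
    by simp
qed

section \<open>Rings between a direct sum and a product of regular rings\<close>

definition single :: "'i set \<Rightarrow> ('i \<Rightarrow> ('a, 'm) ring_scheme) \<Rightarrow> 'i \<Rightarrow> 'a \<Rightarrow> 'i \<Rightarrow> 'a" where
  "single I R i a = (\<lambda>j\<in>I. if j = i then a else \<zero>\<^bsub>R j\<^esub>)"

locale regular_product = ring_product I R
  for I :: "'i set" and R :: "'i \<Rightarrow> ('a, 'm) ring_scheme" +
  fixes S :: "('i \<Rightarrow> 'a) set"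
  assumes regular: "i \<in> I \<Longrightarrow> regular_ring (R i)"
    and subring: "subring S (product_ring I R)"
    and direct_sum_subset: "direct_sum I R \<subseteq> S"
begin

abbreviation RS where "RS \<equiv> P\<lparr>carrier := S\<rparr>"

sublocale RS: ring RS
  by (rule P.subring_is_ring) (rule subring)

text \<open>Regularity is symmetric in the two sides, and neither the direct sum nor the set
  \<open>S\<close> changes when all multiplications are reversed. Every right-hand result of this
  locale therefore has its left-hand version as an instance.\<close>

lemma opposite: "regular_product I (\<lambda>i. opposite_ring (R i)) S"
proof (intro regular_product.intro regular_product_axioms.intro ring_product.intro)
  show "ring (opposite_ring (R i))" if "i \<in> I" for i
    by (rule ring_opposite_ring[OF ring_component[OF that]])
  show "subring S (product_ring I (\<lambda>i. opposite_ring (R i)))"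
    using subring_opposite_ring[OF subring] by (simp only: opposite_product_ring)
qed (simp_all add: regular_opposite_ring regular direct_sum_opposite_ring direct_sum_subset)

lemma S_subset: "S \<subseteq> carrier P"
  by (rule subringE(1)[OF subring])

lemma component_closed: "x \<in> S \<Longrightarrow> i \<in> I \<Longrightarrow> x i \<in> carrier (R i)"
  using S_subset by auto

lemma single_apply: "j \<in> I \<Longrightarrow> single I R i a j = (if j = i then a else \<zero>\<^bsub>R j\<^esub>)"
  by (simp add: single_def)

lemma single_in_direct_sum:
  assumes "i \<in> I" "a \<in> carrier (R i)"
  shows "single I R i a \<in> direct_sum I R"
proof -
  have "finite {j \<in> I. single I R i a j \<noteq> \<zero>\<^bsub>R j\<^esub>}"
    by (rule finite_subset[of _ "{i}"]) (auto simp: single_def)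
  then show ?thesis
    using assms component_simps(2)
    by (auto simp: direct_sum_def single_def)
qed

lemma single_in_S: "i \<in> I \<Longrightarrow> a \<in> carrier (R i) \<Longrightarrow> single I R i a \<in> S"
  using single_in_direct_sum direct_sum_subset by blast

lemma single_closed: "i \<in> I \<Longrightarrow> a \<in> carrier (R i) \<Longrightarrow> single I R i a \<in> carrier P"
  using single_in_S S_subset by blast

lemma single_mult:
  assumes "i \<in> I" "x \<in> carrier P"
  shows "single I R i a \<otimes>\<^bsub>P\<^esub> x = single I R i (a \<otimes>\<^bsub>R i\<^esub> x i)"
  using assms component_simps(24)
  by (auto simp: single_def fun_eq_iff)

lemma mult_single:
  assumes "i \<in> I" "x \<in> carrier P"
  shows "x \<otimes>\<^bsub>P\<^esub> single I R i a = single I R i (x i \<otimes>\<^bsub>R i\<^esub> a)"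
  using assms component_simps(25)
  by (auto simp: single_def fun_eq_iff)

lemma nonzero_component:
  assumes "x \<in> carrier P" "x \<noteq> \<zero>\<^bsub>P\<^esub>"
  obtains i where "i \<in> I" "x i \<noteq> \<zero>\<^bsub>R i\<^esub>"
  using assms P_eqI[OF assms(1) P.zero_closed] by auto

text \<open>If \<open>x\<^sub>i y x\<^sub>i = x\<^sub>i \<noteq> 0\<close>, the right ideal generated by the idempotent \<open>y x\<^sub>i\<close>
  of the \<open>i\<close>-th component meets the right annihilator of \<open>x\<close> trivially.\<close>

lemma right_nonsingular: "right_nonsingular RS"
proof -
  have zero: "x = \<zero>\<^bsub>P\<^esub>" if x: "x \<in> S" and ess: "essential_right_ideal (right_annihilator RS x) RS" for x
  proof (rule ccontr)
    assume "x \<noteq> \<zero>\<^bsub>P\<^esub>"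
    then obtain i where i: "i \<in> I" and xi: "x i \<noteq> \<zero>\<^bsub>R i\<^esub>"
      using x S_subset nonzero_component[of x] by blast
    interpret Ri: ring "R i"
      by (rule ring_component[OF i])
    have xc: "x i \<in> carrier (R i)"
      using x i by (rule component_closed)
    then obtain y where y: "y \<in> carrier (R i)" "x i \<otimes>\<^bsub>R i\<^esub> y \<otimes>\<^bsub>R i\<^esub> x i = x i"
      using regular[OF i] by (auto simp: regular_ring_def)
    define e where "e = y \<otimes>\<^bsub>R i\<^esub> x i"
    have e: "e \<in> carrier (R i)" "e \<otimes>\<^bsub>R i\<^esub> e = e"
      using xc y by (auto simp: e_def) (metis Ri.m_assoc Ri.m_closed)
    have es: "single I R i e \<in> S"
      using i e by (intro single_in_S)
    \<comment> \<open>The right ideal generated by the idempotent, written as the fixed points of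
      left multiplication by it, so that membership is an equation.\<close>
    define J where "J = {r \<in> S. single I R i e \<otimes>\<^bsub>P\<^esub> r = r}"
    have "right_ideal J RS"
      unfolding right_ideal_iff[OF RS.ring_axioms]
    proof (intro conjI ballI)
      show "J \<subseteq> carrier RS"
        by (auto simp: J_def)
      show "\<zero>\<^bsub>RS\<^esub> \<in> J"
        using RS.zero_closed RS.r_null[of "single I R i e"] es by (auto simp: J_def)
      show "a \<oplus>\<^bsub>RS\<^esub> b \<in> J" if "a \<in> J" "b \<in> J" for a b
        using that RS.a_closed[of a b] RS.r_distr[of a b "single I R i e"] es
        by (simp add: J_def del: product_ring_simps)
      show "a \<otimes>\<^bsub>RS\<^esub> r \<in> J" if "a \<in> J" "r \<in> carrier RS" for a r
        using that RS.m_closed[of a r] RS.m_assoc[of "single I R i e" a r] es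
        by (simp add: J_def del: product_ring_simps)
    qed
    moreover have "single I R i e \<in> J"
      using es S_subset i e by (auto simp: J_def single_mult single_apply simp del: product_ring_simps)
    moreover have "single I R i e \<noteq> \<zero>\<^bsub>P\<^esub>"
    proof
      assume "single I R i e = \<zero>\<^bsub>P\<^esub>"
      then have "e = \<zero>\<^bsub>R i\<^esub>"
        using i single_apply[of i i e] by simp
      then show False
        using xi xc y Ri.m_assoc[of "x i" y "x i"] by (simp add: e_def)
    qed
    ultimately obtain r where r: "r \<in> J" "r \<in> right_annihilator RS x" "r \<noteq> \<zero>\<^bsub>P\<^esub>"
    proof -
      have "right_annihilator RS x \<inter> J \<noteq> {\<zero>\<^bsub>P\<^esub>}"
        using ess \<open>right_ideal J RS\<close> \<open>single I R i e \<in> J\<close> \<open>single I R i e \<noteq> \<zero>\<^bsub>P\<^esub>\<close>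
        unfolding essential_right_ideal_def by fastforce
      moreover have "\<zero>\<^bsub>P\<^esub> \<in> right_annihilator RS x \<inter> J"
        using RS.zero_closed RS.r_null[of x] RS.r_null[of "single I R i e"] x es
        by (simp add: right_annihilator_def J_def del: product_ring_simps)
      ultimately show ?thesis
        using that by blast
    qed
    have rS: "r \<in> S" and req: "r = single I R i (e \<otimes>\<^bsub>R i\<^esub> r i)"
      using r i S_subset single_mult[OF i, of r e] by (auto simp: J_def simp del: product_ring_simps)
    have rc: "r i \<in> carrier (R i)"
      using rS i by (rule component_closed)
    have "(x \<otimes>\<^bsub>P\<^esub> r) i = \<zero>\<^bsub>R i\<^esub>"
      using r(2) i by (simp add: right_annihilator_def)
    then have "x i \<otimes>\<^bsub>R i\<^esub> r i = \<zero>\<^bsub>R i\<^esub>"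
      using i by simp
    then have "e \<otimes>\<^bsub>R i\<^esub> r i = \<zero>\<^bsub>R i\<^esub>"
      using y xc rc by (simp add: e_def Ri.m_assoc)
    then have "r = \<zero>\<^bsub>P\<^esub>"
      using req by (auto simp: single_def fun_eq_iff)
    with r(3) show False ..
  qed
  have "essential_right_ideal (right_annihilator RS \<zero>\<^bsub>P\<^esub>) RS"
  proof -
    have "right_annihilator RS \<zero>\<^bsub>P\<^esub> = carrier RS"
      using RS.l_null by (auto simp: right_annihilator_def simp del: product_ring_simps)
    moreover have "right_ideal (carrier RS) RS"
      unfolding right_ideal_iff[OF RS.ring_axioms]
      using RS.m_closed RS.a_closed RS.zero_closed by blast
    moreover have "carrier RS \<inter> J = J" if "right_ideal J RS" for J
      using that unfolding right_ideal_iff[OF RS.ring_axioms] by blast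
    ultimately show ?thesis
      by (simp add: essential_right_ideal_def)
  qed
  then have "\<zero>\<^bsub>RS\<^esub> \<in> right_singular_ideal RS"
    using RS.zero_closed by (simp add: right_singular_ideal_def del: product_ring_simps)
  moreover have "right_singular_ideal RS \<subseteq> {\<zero>\<^bsub>RS\<^esub>}"
    using zero by (auto simp: right_singular_ideal_def simp del: product_ring_simps)
  ultimately show ?thesis
    using RS.ring_axioms unfolding right_nonsingular_def by blast
qed

text \<open>Multiplication by the idempotent \<open>e_i\<close> of a component where
  \<open>x\<close> is nonzero keeps \<open>x\<close> nonzero and moves \<open>y\<close> into the
  direct sum, hence into \<open>S\<close>.\<close>

lemma right_quotient_ring: "right_quotient_ring P S"
  unfolding right_quotient_ring_def
proof (intro conjI ballI impI)
  fix x y assume x: "x \<in> carrier P" and y: "y \<in> carrier P" and "x \<noteq> \<zero>\<^bsub>P\<^esub>"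
  then obtain i where i: "i \<in> I" and xi: "x i \<noteq> \<zero>\<^bsub>R i\<^esub>"
    using nonzero_component[of x] by blast
  interpret Ri: ring "R i"
    by (rule ring_component[OF i])
  define e where "e = single I R i \<one>\<^bsub>R i\<^esub>"
  have c: "x i \<in> carrier (R i)" "y i \<in> carrier (R i)"
    using x y i by auto
  have "x \<otimes>\<^bsub>P\<^esub> e = single I R i (x i)" "y \<otimes>\<^bsub>P\<^esub> e = single I R i (y i)"
    using x y c i by (simp_all add: e_def mult_single del: product_ring_simps)
  moreover have "single I R i (x i) \<noteq> \<zero>\<^bsub>P\<^esub>"
    using xi i single_apply[of i i "x i"] by auto
  ultimately show "\<exists>r\<in>S. x \<otimes>\<^bsub>P\<^esub> r \<noteq> \<zero>\<^bsub>P\<^esub> \<and> y \<otimes>\<^bsub>P\<^esub> r \<in> S"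
    using c i single_in_S by (intro bexI[of _ e]) (auto simp: e_def simp del: product_ring_simps)
qed (rule P.ring_axioms subring)+

text \<open>Left multiplication by some \<open>x\<close> in the product but outside \<open>S\<close>
  maps the direct sum into itself, as the sum is an ideal of the product. An extension to all of
  \<open>S\<close> is left multiplication by the value \<open>g 1\<close> in \<open>S\<close>;
  evaluating at each idempotent \<open>e_i\<close> forces \<open>g 1 = x\<close>. Countability of
  \<open>I\<close> makes the direct sum countably generated, by the \<open>e_i\<close>.\<close>

lemma not_right_aleph0_self_injective:
  assumes "countable I" "S \<noteq> carrier P"
  shows "\<not> right_aleph0_self_injective RS"
proof
  assume inj: "right_aleph0_self_injective RS"
  obtain x where x: "x \<in> carrier P" "x \<notin> S"
    using assms(2) S_subset by blast
  let ?D = "direct_sum I R"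
  have D: "d \<in> ?D \<longleftrightarrow> d \<in> carrier P \<and> finite {i \<in> I. d i \<noteq> \<zero>\<^bsub>R i\<^esub>}" for d
    by (simp add: direct_sum_def)
  interpret D: ideal ?D P
    by (rule ideal_direct_sum)
  have right_ideal: "right_ideal ?D RS"
    unfolding right_ideal_iff[OF RS.ring_axioms]
  proof (intro conjI ballI)
    show "?D \<subseteq> carrier RS"
      using direct_sum_subset by simp
  qed (use S_subset D.zero_closed D.a_closed D.I_r_closed in auto)
  define E where "E = (\<lambda>i. single I R i \<one>\<^bsub>R i\<^esub>) ` I"
  have E: "E \<subseteq> ?D"
    using single_in_direct_sum component_simps(6) by (auto simp: E_def)
  have D_subset: "?D \<subseteq> J" if J: "right_ideal J RS" "E \<subseteq> J" for J
  proof
    note Jr = J(1)[unfolded right_ideal_iff[OF RS.ring_axioms]]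
    \<comment> \<open>Induction on the support: one coordinate is split off as \<open>e_i\<close>
      times an element of the i-th component, which lies in \<open>J\<close> because
      \<open>e_i\<close> does.\<close>
    have "d \<in> J" if "finite F" "d \<in> ?D" "{i \<in> I. d i \<noteq> \<zero>\<^bsub>R i\<^esub>} = F" for F d
      using that
    proof (induction F arbitrary: d)
      case empty
      then have "d = \<zero>\<^bsub>P\<^esub>"
        by (intro P_eqI P.zero_closed) (auto simp: D)
      moreover have "\<zero>\<^bsub>P\<^esub> \<in> J"
        using Jr by simp
      ultimately show ?case
        by (simp only:)
    next
      case (insert i F)
      then have i: "i \<in> I"
        by auto
      interpret Ri: ring "R i"
        by (rule ring_component[OF i])
      have dc: "d \<in> carrier P" "d i \<in> carrier (R i)"
        using insert.prems i by (auto simp: D)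
      define d' where "d' = (\<lambda>j\<in>I. if j = i then \<zero>\<^bsub>R j\<^esub> else d j)"
      have d'c: "d' \<in> carrier P"
        using dc component_simps(2) by (auto simp: d'_def)
      have F: "{j \<in> I. d' j \<noteq> \<zero>\<^bsub>R j\<^esub>} = F"
        using insert.prems(2) insert.hyps(2) by (auto simp: d'_def)
      then have "d' \<in> J"
        using d'c insert.hyps(1) by (intro insert.IH) (auto simp only: D)
      moreover have "single I R i (d i) \<in> J"
      proof -
        have "single I R i \<one>\<^bsub>R i\<^esub> \<in> J"
          using i J(2) by (auto simp: E_def)
        then have "single I R i \<one>\<^bsub>R i\<^esub> \<otimes>\<^bsub>P\<^esub> single I R i (d i) \<in> J"
          using Jr single_in_S[OF i dc(2)] by simp
        then show ?thesis
          using single_mult[OF i single_closed[OF i dc(2)]] i dc(2)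
          by (simp add: single_apply del: product_ring_simps)
      qed
      ultimately have "d' \<oplus>\<^bsub>P\<^esub> single I R i (d i) \<in> J"
        using Jr by simp
      moreover have "d' \<oplus>\<^bsub>P\<^esub> single I R i (d i) = d"
      proof (rule P_eqI[OF P.a_closed[OF d'c single_closed[OF i dc(2)]] dc(1)])
        fix j assume j: "j \<in> I"
        then have "d j \<in> carrier (R j)"
          using dc by auto
        then show "(d' \<oplus>\<^bsub>P\<^esub> single I R i (d i)) j = d j"
          using j component_simps(8,15)[OF j] by (cases "j = i") (simp_all add: d'_def single_apply)
      qed
      ultimately show ?case
        by simp
    qed
    note this[OF _ _ refl]
    then show "d \<in> J" if "d \<in> ?D" for d
      using that by (simp add: D)
  qed
  have "countably_generated_right_ideal ?D RS"
    unfolding countably_generated_right_ideal_def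
  proof (intro conjI exI)
    show "?D = \<Inter> {J. right_ideal J RS \<and> E \<subseteq> J}"
      using D_subset E right_ideal by blast
    show "countable E"
      using assms(1) by (simp add: E_def)
    show "E \<subseteq> carrier RS"
      using E direct_sum_subset by auto
  qed (rule right_ideal)
  moreover have "right_module_hom RS ?D (\<lambda>r. x \<otimes>\<^bsub>P\<^esub> r)"
    unfolding right_module_hom_def
  proof (intro conjI ballI)
    have "x \<otimes>\<^bsub>P\<^esub> r \<in> ?D" if "r \<in> ?D" for r
      using that x by (intro D.I_l_closed)
    then show "(\<lambda>r. x \<otimes>\<^bsub>P\<^esub> r) \<in> ?D \<rightarrow> carrier RS"
      using direct_sum_subset by auto
    show "x \<otimes>\<^bsub>P\<^esub> (r \<oplus>\<^bsub>RS\<^esub> s) = x \<otimes>\<^bsub>P\<^esub> r \<oplus>\<^bsub>RS\<^esub> x \<otimes>\<^bsub>P\<^esub> s" if "r \<in> ?D" "s \<in> ?D" for r s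
      using P.r_distr[of r s x] that x(1) by (simp add: D del: product_ring_simps)
    show "x \<otimes>\<^bsub>P\<^esub> (r \<otimes>\<^bsub>RS\<^esub> s) = x \<otimes>\<^bsub>P\<^esub> r \<otimes>\<^bsub>RS\<^esub> s" if "r \<in> ?D" "s \<in> carrier RS" for r s
      using P.m_assoc[of x r s] that x(1) S_subset by (auto simp add: D simp del: product_ring_simps)
  qed
  ultimately obtain g where g: "right_module_hom RS S g" "\<And>r. r \<in> ?D \<Longrightarrow> g r = x \<otimes>\<^bsub>P\<^esub> r"
    using inj unfolding right_aleph0_self_injective_def by fastforce
  have m: "g \<one>\<^bsub>P\<^esub> \<in> S"
    using g(1) RS.one_closed by (auto simp: right_module_hom_def simp del: product_ring_simps)
  have "g \<one>\<^bsub>P\<^esub> i = x i" if i: "i \<in> I" for i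
  proof -
    interpret Ri: ring "R i"
      by (rule ring_component[OF i])
    let ?e = "single I R i \<one>\<^bsub>R i\<^esub>"
    have e: "?e \<in> S" "?e \<in> ?D"
      using i single_in_S single_in_direct_sum by auto
    have "g (s \<otimes>\<^bsub>P\<^esub> r) = g s \<otimes>\<^bsub>P\<^esub> r" if "s \<in> S" "r \<in> S" for s r
      using g(1) that by (simp add: right_module_hom_def del: product_ring_simps)
    from this[of "\<one>\<^bsub>P\<^esub>" ?e] have "g ?e = g \<one>\<^bsub>P\<^esub> \<otimes>\<^bsub>P\<^esub> ?e"
      using RS.l_one[of ?e] RS.one_closed e by (simp del: product_ring_simps)
    then have "single I R i (x i \<otimes>\<^bsub>R i\<^esub> \<one>\<^bsub>R i\<^esub>) = single I R i (g \<one>\<^bsub>P\<^esub> i \<otimes>\<^bsub>R i\<^esub> \<one>\<^bsub>R i\<^esub>)"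
      using g(2)[OF e(2)] i x m S_subset mult_single[OF i, of x] mult_single[OF i, of "g \<one>\<^bsub>P\<^esub>"]
      by (auto simp del: product_ring_simps)
    then have "x i \<otimes>\<^bsub>R i\<^esub> \<one>\<^bsub>R i\<^esub> = g \<one>\<^bsub>P\<^esub> i \<otimes>\<^bsub>R i\<^esub> \<one>\<^bsub>R i\<^esub>"
      using i single_apply[of i i] by metis
    then show ?thesis
      using component_closed[OF m i] PiE_mem[of x I "\<lambda>i. carrier (R i)", OF _ i] x(1)
      by (simp del: product_ring_simps(2-))
  qed
  then have "g \<one>\<^bsub>P\<^esub> = x"
    using m S_subset x by (intro P_eqI) auto
  with m x show False
    by simp
qed

lemma single_add:
  assumes "i \<in> I"
  shows "single I R i a \<oplus>\<^bsub>P\<^esub> single I R i b = single I R i (a \<oplus>\<^bsub>R i\<^esub> b)"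
  using component_simps(2,8) by (auto simp: single_def fun_eq_iff)

lemma single_zero: "single I R i \<zero>\<^bsub>R i\<^esub> = \<zero>\<^bsub>P\<^esub>"
  by (auto simp: single_def)

text \<open>For a right quotient ring \<open>A\<close> of \<open>S\<close> and \<open>a \<in> A\<close>, the elements \<open>r\<close> of the \<open>i\<close>-th
  component with \<open>a r \<in> S\<close> form an essential right ideal, which contains the identity \<open>e\<^sub>i\<close>
  because the component is finite and regular.
  So \<open>a e\<^sub>i\<close> lies in the \<open>i\<close>-th component, and \<open>a\<close> is sent to the family of the \<open>a e\<^sub>i\<close>.\<close>

lemma right_maximal_quotient_ring:
  assumes finite: "\<And>i. i \<in> I \<Longrightarrow> finite (carrier (R i))"
  shows "right_maximal_quotient_ring TYPE('s) P S"
  unfolding right_maximal_quotient_ring_def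
proof (intro conjI allI impI right_quotient_ring)
  fix A :: "'s ring" and h
  assume "h \<in> ring_hom RS A \<and> inj_on h S \<and> right_quotient_ring A (h ` S)"
  then have h: "h \<in> ring_hom RS A" and inj: "inj_on h S" and "ring A"
    and sub: "subring (h ` S) A"
    and dense: "\<And>x y. x \<in> carrier A \<Longrightarrow> y \<in> carrier A \<Longrightarrow> x \<noteq> \<zero>\<^bsub>A\<^esub> \<Longrightarrow>
      \<exists>r\<in>S. x \<otimes>\<^bsub>A\<^esub> h r \<noteq> \<zero>\<^bsub>A\<^esub> \<and> y \<otimes>\<^bsub>A\<^esub> h r \<in> h ` S"
    by (auto simp: right_quotient_ring_def)
  interpret A: ring A by fact
  interpret h: ring_hom_ring RS A h
    by (rule ring_hom_ringI2[OF RS.ring_axioms A.ring_axioms h])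
  have h_closed: "h s \<in> carrier A" if "s \<in> S" for s
    using that h.hom_closed by simp
  have h_mult: "h (s \<otimes>\<^bsub>P\<^esub> t) = h s \<otimes>\<^bsub>A\<^esub> h t" if "s \<in> S" "t \<in> S" for s t
    using that h.hom_mult by simp
  have h_add: "h (s \<oplus>\<^bsub>P\<^esub> t) = h s \<oplus>\<^bsub>A\<^esub> h t" if "s \<in> S" "t \<in> S" for s t
    using that h.hom_add by simp
  have h_zero_iff: "h s = \<zero>\<^bsub>A\<^esub> \<longleftrightarrow> s = \<zero>\<^bsub>P\<^esub>" if "s \<in> S" for s
    using that h.hom_zero RS.zero_closed inj_onD[OF inj, of s "\<zero>\<^bsub>P\<^esub>"]
    by (auto simp del: product_ring_simps)
  define e where "e i = single I R i \<one>\<^bsub>R i\<^esub>" for i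
  have e: "e i \<in> S" if "i \<in> I" for i
    using that single_in_S component_simps(6) by (simp add: e_def)
  have e_mult: "e i \<otimes>\<^bsub>P\<^esub> s = single I R i (s i)" "s \<otimes>\<^bsub>P\<^esub> e i = single I R i (s i)"
    if "i \<in> I" "s \<in> S" for i s
    using that S_subset single_mult[of i s] mult_single[of i s] component_simps(12)
      monoid.r_one[OF ring.is_monoid[OF ring_component]] component_closed
    by (auto simp: e_def simp del: product_ring_simps)
  have ex: "\<exists>c \<in> carrier (R i). h (single I R i c) = a \<otimes>\<^bsub>A\<^esub> h (e i)"
    if a: "a \<in> carrier A" and i: "i \<in> I" for a i
  proof -
    interpret Ri: ring "R i"
      by (rule ring_component[OF i])
    define D where "D = {r \<in> carrier (R i). a \<otimes>\<^bsub>A\<^esub> h (single I R i r) \<in> h ` S}"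
    have "\<one>\<^bsub>R i\<^esub> \<in> D"
    proof (rule one_in_dense_right_ideal[OF regular[OF i] finite[OF i]])
      show "right_ideal D (R i)"
        unfolding right_ideal_iff[OF Ri.ring_axioms]
      proof (intro conjI ballI)
        show "\<zero>\<^bsub>R i\<^esub> \<in> D"
          using a subringE(2)[OF sub] h.hom_zero
          by (simp add: D_def single_zero del: product_ring_simps)
        fix x assume x: "x \<in> D"
        show "x \<oplus>\<^bsub>R i\<^esub> y \<in> D" if y: "y \<in> D" for y
        proof -
          have c: "single I R i x \<in> S" "single I R i y \<in> S"
            using x y i single_in_S by (auto simp: D_def)
          have "a \<otimes>\<^bsub>A\<^esub> h (single I R i (x \<oplus>\<^bsub>R i\<^esub> y)) =
              a \<otimes>\<^bsub>A\<^esub> h (single I R i x) \<oplus>\<^bsub>A\<^esub> a \<otimes>\<^bsub>A\<^esub> h (single I R i y)"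
            using c a h_closed by (simp add: single_add[OF i, symmetric] h_add A.r_distr del: product_ring_simps)
          then show ?thesis
            using x y subringE(7)[OF sub] by (simp add: D_def)
        qed
        show "x \<otimes>\<^bsub>R i\<^esub> r \<in> D" if r: "r \<in> carrier (R i)" for r
        proof -
          have c: "single I R i x \<in> S" "single I R i r \<in> S"
            using x r i single_in_S by (auto simp: D_def)
          have "single I R i (x \<otimes>\<^bsub>R i\<^esub> r) = single I R i x \<otimes>\<^bsub>P\<^esub> single I R i r"
            using c S_subset i by (subst single_mult[OF i]) (auto simp: single_apply simp del: product_ring_simps)
          then have "a \<otimes>\<^bsub>A\<^esub> h (single I R i (x \<otimes>\<^bsub>R i\<^esub> r)) =
              a \<otimes>\<^bsub>A\<^esub> h (single I R i x) \<otimes>\<^bsub>A\<^esub> h (single I R i r)"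
            using c a h_closed by (simp add: h_mult A.m_assoc del: product_ring_simps)
          then show ?thesis
            using x r c subringE(6)[OF sub] by (simp add: D_def)
        qed
      qed (auto simp: D_def)
      fix b assume b: "b \<in> carrier (R i)" "b \<noteq> \<zero>\<^bsub>R i\<^esub>"
      have s: "single I R i b \<in> S" "single I R i b \<noteq> \<zero>\<^bsub>P\<^esub>"
        using b i single_in_S single_apply[OF i, of i b] by auto
      \<comment> \<open>Density is applied to the pair \<open>h b\<close>, \<open>a (h b)\<close>.
        Since \<open>b\<close> is supported at \<open>i\<close>, only the component
        \<open>t i\<close> survives in the products, and it is the multiplier required in
        \<open>R i\<close>.\<close>
      then obtain t where t: "t \<in> S" "h (single I R i b) \<otimes>\<^bsub>A\<^esub> h t \<noteq> \<zero>\<^bsub>A\<^esub>"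
        "a \<otimes>\<^bsub>A\<^esub> h (single I R i b) \<otimes>\<^bsub>A\<^esub> h t \<in> h ` S"
        using dense[of "h (single I R i b)" "a \<otimes>\<^bsub>A\<^esub> h (single I R i b)"] a h_closed h_zero_iff by blast
      have ti: "t i \<in> carrier (R i)"
        using t(1) i by (rule component_closed)
      have "h (single I R i b) \<otimes>\<^bsub>A\<^esub> h t = h (single I R i (b \<otimes>\<^bsub>R i\<^esub> t i))"
        using s t(1) S_subset single_mult[OF i, of t b] by (auto simp: h_mult[symmetric] simp del: product_ring_simps)
      moreover from this have "b \<otimes>\<^bsub>R i\<^esub> t i \<noteq> \<zero>\<^bsub>R i\<^esub>"
        using t(2) h.hom_zero by (auto simp: single_zero simp del: product_ring_simps)
      ultimately show "\<exists>r\<in>carrier (R i). b \<otimes>\<^bsub>R i\<^esub> r \<noteq> \<zero>\<^bsub>R i\<^esub> \<and> b \<otimes>\<^bsub>R i\<^esub> r \<in> D"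
        using ti t a s b h_closed by (intro bexI[of _ "t i"]) (auto simp: D_def A.m_assoc)
    qed
    then obtain s where s: "s \<in> S" "h s = a \<otimes>\<^bsub>A\<^esub> h (e i)"
      by (auto simp: D_def e_def)
    \<comment> \<open>The element \<open>s\<close> need not be supported at \<open>i\<close>.
      Multiplying by the idempotent \<open>e i\<close> cuts it down to its i-th component without
      changing \<open>a (h (e i))\<close>.\<close>
    have "e i \<otimes>\<^bsub>P\<^esub> e i = e i"
      using e_mult(1)[OF i e[OF i]] i by (simp add: e_def single_apply del: product_ring_simps)
    then have "h (s \<otimes>\<^bsub>P\<^esub> e i) = a \<otimes>\<^bsub>A\<^esub> h (e i)"
      using s a e[OF i] h_closed h_mult[of "e i" "e i"]
      by (simp add: h_mult A.m_assoc del: product_ring_simps)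
    then show ?thesis
      using e_mult(2)[OF i s(1)] component_closed[OF s(1) i] by auto
  qed
  define g where "g a = (\<lambda>i\<in>I. SOME c. c \<in> carrier (R i) \<and> h (single I R i c) = a \<otimes>\<^bsub>A\<^esub> h (e i))" for a
  have g: "g a i \<in> carrier (R i)" "h (single I R i (g a i)) = a \<otimes>\<^bsub>A\<^esub> h (e i)"
    if "a \<in> carrier A" "i \<in> I" for a i
    using someI_ex[OF ex[OF that, unfolded Bex_def]] that(2) by (simp_all add: g_def)
  have g_closed: "g a \<in> carrier P" if "a \<in> carrier A" for a
    using g(1)[OF that] by (auto simp: g_def)
  \<comment> \<open>Injectivity of \<open>h\<close> makes the chosen component unique, so each law
    for \<open>g\<close> reduces to one equation between values of \<open>h\<close>.\<close>
  have g_eq: "g a i = c"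
    if "a \<in> carrier A" "i \<in> I" "c \<in> carrier (R i)" "h (single I R i c) = a \<otimes>\<^bsub>A\<^esub> h (e i)" for a i c
  proof -
    have "single I R i (g a i) = single I R i c"
      using that g[OF that(1,2)] single_in_S by (intro inj_onD[OF inj]) auto
    then show ?thesis
      using single_apply[OF that(2), of i] by metis
  qed
  have "g \<in> ring_hom A P"
  proof (rule ring_hom_memI)
    fix a b assume a: "a \<in> carrier A" and b: "b \<in> carrier A"
    show "g (a \<otimes>\<^bsub>A\<^esub> b) = g a \<otimes>\<^bsub>P\<^esub> g b"
    proof (rule P_eqI)
      fix i assume i: "i \<in> I"
      have c: "single I R i (g a i) \<in> S" "single I R i (g b i) \<in> S"
        using g(1) a b i single_in_S by auto
      have "single I R i (g a i \<otimes>\<^bsub>R i\<^esub> g b i) = single I R i (g a i) \<otimes>\<^bsub>P\<^esub> single I R i (g b i)"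
        using c(2) S_subset i by (subst single_mult[OF i]) (auto simp: single_apply simp del: product_ring_simps)
      then have "h (single I R i (g a i \<otimes>\<^bsub>R i\<^esub> g b i)) = a \<otimes>\<^bsub>A\<^esub> (h (e i) \<otimes>\<^bsub>A\<^esub> h (single I R i (g b i)))"
        using c a e[OF i] g(2)[OF a i] h_closed by (simp add: h_mult A.m_assoc del: product_ring_simps)
      \<comment> \<open>The idempotent \<open>h (e i)\<close> is not known to be central in
        \<open>A\<close>. But \<open>b (h (e i))\<close> is the image of an element of the i-th
        component, so a further factor \<open>h (e i)\<close> on its left is absorbed.\<close>
      also have "h (e i) \<otimes>\<^bsub>A\<^esub> h (single I R i (g b i)) = h (single I R i (g b i))"
        using e[OF i] c(2) e_mult(1)[OF i c(2)] i
        by (simp add: h_mult[symmetric] single_apply del: product_ring_simps)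
      finally have "h (single I R i (g a i \<otimes>\<^bsub>R i\<^esub> g b i)) = a \<otimes>\<^bsub>A\<^esub> b \<otimes>\<^bsub>A\<^esub> h (e i)"
        using g(2)[OF b i] a b e[OF i] h_closed by (simp add: A.m_assoc)
      then show "g (a \<otimes>\<^bsub>A\<^esub> b) i = (g a \<otimes>\<^bsub>P\<^esub> g b) i"
        using a b i g(1) component_simps(5)[OF i] by (simp add: g_eq)
    qed (use a b g_closed P.m_closed in blast)+
    show "g (a \<oplus>\<^bsub>A\<^esub> b) = g a \<oplus>\<^bsub>P\<^esub> g b"
    proof (rule P_eqI)
      fix i assume i: "i \<in> I"
      have c: "single I R i (g a i) \<in> S" "single I R i (g b i) \<in> S"
        using g(1) a b i single_in_S by auto
      then have "h (single I R i (g a i \<oplus>\<^bsub>R i\<^esub> g b i)) = (a \<oplus>\<^bsub>A\<^esub> b) \<otimes>\<^bsub>A\<^esub> h (e i)"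
        using a b e[OF i] g(2)[OF a i] g(2)[OF b i] h_closed
        by (simp add: single_add[OF i, symmetric] h_add A.l_distr del: product_ring_simps)
      then show "g (a \<oplus>\<^bsub>A\<^esub> b) i = (g a \<oplus>\<^bsub>P\<^esub> g b) i"
        using a b i g(1) component_simps(1)[OF i] by (simp add: g_eq)
    qed (use a b g_closed P.a_closed in blast)+
  next
    show "g \<one>\<^bsub>A\<^esub> = \<one>\<^bsub>P\<^esub>"
    proof (rule P_eqI)
      show "g \<one>\<^bsub>A\<^esub> i = \<one>\<^bsub>P\<^esub> i" if i: "i \<in> I" for i
        using i e[OF i] h_closed component_simps(6)[OF i] by (simp add: g_eq e_def)
    qed (use g_closed P.one_closed A.one_closed in blast)+
  qed (use g_closed in blast)
  moreover have "g (h s) = s" if s: "s \<in> S" for s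
  proof (rule P_eqI)
    show "g (h s) i = s i" if i: "i \<in> I" for i
    proof (rule g_eq[OF h_closed[OF s] i component_closed[OF s i]])
      show "h (single I R i (s i)) = h s \<otimes>\<^bsub>A\<^esub> h (e i)"
        using e_mult(2)[OF i s] h_mult[OF s e[OF i]] by (simp del: product_ring_simps)
    qed
  qed (use s g_closed h_closed S_subset in blast)+
  moreover have "inj_on g (carrier A)"
  proof (rule inj_onI, rule ccontr)
    fix a b assume a: "a \<in> carrier A" and b: "b \<in> carrier A" and gab: "g a = g b" and "a \<noteq> b"
    define d where "d = a \<ominus>\<^bsub>A\<^esub> b"
    have d: "d \<in> carrier A" "d \<noteq> \<zero>\<^bsub>A\<^esub>"
      using a b \<open>a \<noteq> b\<close> A.r_right_minus_eq by (auto simp: d_def)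
    have de: "d \<otimes>\<^bsub>A\<^esub> h (e i) = \<zero>\<^bsub>A\<^esub>" if i: "i \<in> I" for i
    proof -
      have "a \<otimes>\<^bsub>A\<^esub> h (e i) = b \<otimes>\<^bsub>A\<^esub> h (e i)"
        using g(2)[OF a i] g(2)[OF b i] gab by simp
      then show ?thesis
        using a b h_closed[OF e[OF i]]
        by (simp add: d_def A.minus_eq A.l_distr A.l_minus A.r_neg)
    qed
    obtain t where t: "t \<in> S" "d \<otimes>\<^bsub>A\<^esub> h t \<noteq> \<zero>\<^bsub>A\<^esub>" "d \<otimes>\<^bsub>A\<^esub> h t \<in> h ` S"
      using dense[OF d(1) d(1) d(2)] by blast
    then obtain s where s: "s \<in> S" "h s = d \<otimes>\<^bsub>A\<^esub> h t"
      by auto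
    have "s \<noteq> \<zero>\<^bsub>P\<^esub>"
      using s t(2) h_zero_iff by metis
    then obtain i where i: "i \<in> I" "s i \<noteq> \<zero>\<^bsub>R i\<^esub>"
      using nonzero_component[of s] s S_subset by blast
    \<comment> \<open>Inside \<open>S\<close> the idempotent \<open>e i\<close> commutes with
      \<open>t\<close>, so it can be moved next to \<open>d\<close>, which annihilates it. Hence the
      i-th component of \<open>s\<close> vanishes, against the choice of \<open>i\<close>.\<close>
    have "h (s \<otimes>\<^bsub>P\<^esub> e i) = d \<otimes>\<^bsub>A\<^esub> h (t \<otimes>\<^bsub>P\<^esub> e i)"
      using s t(1) d(1) e[OF i(1)] h_closed by (simp add: h_mult A.m_assoc del: product_ring_simps)
    also have "\<dots> = d \<otimes>\<^bsub>A\<^esub> h (e i) \<otimes>\<^bsub>A\<^esub> h t"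
      using e_mult[OF i(1) t(1)] t(1) d(1) e[OF i(1)] h_closed h_mult[of "e i" t]
      by (simp add: A.m_assoc del: product_ring_simps)
    also have "\<dots> = \<zero>\<^bsub>A\<^esub>"
      using de[OF i(1)] t(1) h_closed by simp
    finally have "single I R i (s i) = \<zero>\<^bsub>P\<^esub>"
      using e_mult(2)[OF i(1) s(1)] h_zero_iff[OF single_in_S[OF i(1) component_closed[OF s(1) i(1)]]]
      by (simp del: product_ring_simps)
    then show False
      using i single_apply[OF i(1), of i "s i"] by simp
  qed
  ultimately show "\<exists>g. g \<in> ring_hom A P \<and> inj_on g (carrier A) \<and> (\<forall>r\<in>S. g (h r) = r)"
    by blast
qed

section \<open>Left-hand versions\<close>

lemma left_nonsingular: "left_nonsingular RS"
proof -
  interpret opp: regular_product I "\<lambda>i. opposite_ring (R i)" S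
    by (rule opposite)
  show ?thesis
    using opp.right_nonsingular
    by (simp add: left_nonsingular_def opposite_product_ring del: product_ring_simps)
qed

lemma left_maximal_quotient_ring:
  assumes "\<And>i. i \<in> I \<Longrightarrow> finite (carrier (R i))"
  shows "left_maximal_quotient_ring TYPE('s) P S"
proof -
  interpret opp: regular_product I "\<lambda>i. opposite_ring (R i)" S
    by (rule opposite)
  show ?thesis
    using opp.right_maximal_quotient_ring assms
    by (simp add: left_maximal_quotient_ring_def opposite_product_ring del: product_ring_simps)
qed

lemma not_left_aleph0_self_injective:
  assumes "countable I" "S \<noteq> carrier P"
  shows "\<not> left_aleph0_self_injective RS"
proof -
  interpret opp: regular_product I "\<lambda>i. opposite_ring (R i)" S
    by (rule opposite)
  have "S \<noteq> carrier (product_ring I (\<lambda>i. opposite_ring (R i)))"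
    using assms(2) by simp
  from opp.not_right_aleph0_self_injective[OF assms(1) this] show ?thesis
    by (simp add: left_aleph0_self_injective_def opposite_product_ring del: product_ring_simps)
qed

end

section \<open>Tensor products with the rationals\<close>

lemma (in ring_hom_ring) hom_add_pow_nat:
  "x \<in> carrier R \<Longrightarrow> h (add_pow R (k::nat) x) = add_pow S k (h x)"
  using group_hom.hom_nat_pow[OF a_group_hom, of x k] by (simp add: add_pow_def)

lemma (in ring_hom_ring) hom_add_pow_int:
  "x \<in> carrier R \<Longrightarrow> h (add_pow R (k::int) x) = add_pow S k (h x)"
  using group_hom.hom_int_pow[OF a_group_hom, of x k] by (simp add: add_pow_def)

lemma add_pow_int_of_nat: "add_pow R (int k) x = add_pow R k x"
  by (simp add: add_pow_def int_pow_int)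

lemma frag_extend_fun_add:
  "frag_extend (\<lambda>x. f x + g x) c = frag_extend f c + frag_extend g c"
  by (simp add: frag_extend_def frag_cmul_distrib2 sum.distrib)

section \<open>The free ring on pairs and its quotient by the tensor relations\<close>

context
  fixes A :: "('a, 'm) ring_scheme" and B :: "('b, 'n) ring_scheme"
  assumes A: "ring A" and B: "ring B"
begin

interpretation A: ring A by (rule A)
interpretation B: ring B by (rule B)

abbreviation F where "F \<equiv> free_pair_ring A B"

lemma free_pair_ring_simps [simp]:
  "carrier F = {c. Poly_Mapping.keys c \<subseteq> carrier A \<times> carrier B}"
  "\<one>\<^bsub>F\<^esub> = frag_of (\<one>\<^bsub>A\<^esub>, \<one>\<^bsub>B\<^esub>)"
  "\<zero>\<^bsub>F\<^esub> = 0"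
  "ring.add F = (+)"
  "frag_of (a, b) \<otimes>\<^bsub>F\<^esub> frag_of (a', b') = frag_of (a \<otimes>\<^bsub>A\<^esub> a', b \<otimes>\<^bsub>B\<^esub> b')"
  by (simp_all add: free_pair_ring_def free_Abelian_group_def)

lemma add_monoid_free_pair_ring:
  "add_monoid F = free_Abelian_group (carrier A \<times> carrier B)"
  by (simp add: free_pair_ring_def free_Abelian_group_def)

lemma free_pair_ring_l_distr: "(c + c') \<otimes>\<^bsub>F\<^esub> d = c \<otimes>\<^bsub>F\<^esub> d + c' \<otimes>\<^bsub>F\<^esub> d"
  by (simp add: free_pair_ring_def frag_extend_add)

lemma free_pair_ring_r_distr: "c \<otimes>\<^bsub>F\<^esub> (d + d') = c \<otimes>\<^bsub>F\<^esub> d + c \<otimes>\<^bsub>F\<^esub> d'"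
  by (simp add: free_pair_ring_def frag_extend_add case_prod_unfold frag_extend_fun_add)

lemma free_pair_ring_l_diff: "(c - c') \<otimes>\<^bsub>F\<^esub> d = c \<otimes>\<^bsub>F\<^esub> d - c' \<otimes>\<^bsub>F\<^esub> d"
  using free_pair_ring_l_distr[of "c - c'" c' d] by (simp add: eq_diff_eq)

lemma free_pair_ring_r_diff: "c \<otimes>\<^bsub>F\<^esub> (d - d') = c \<otimes>\<^bsub>F\<^esub> d - c \<otimes>\<^bsub>F\<^esub> d'"
  using free_pair_ring_r_distr[of c "d - d'" d'] by (simp add: eq_diff_eq)

lemma free_pair_ring_null: "0 \<otimes>\<^bsub>F\<^esub> d = 0" "c \<otimes>\<^bsub>F\<^esub> 0 = 0"
  using free_pair_ring_l_diff[of 0 0 d] free_pair_ring_r_diff[of c 0 0] by simp_all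

text \<open>Matched to \<open>frag_induction\<close>, whose cases are zero, a generator and a
  difference.\<close>

lemmas free_pair_ring_bilinear =
  free_pair_ring_l_diff free_pair_ring_r_diff free_pair_ring_null

lemma free_pair_ring_diff_closed:
  assumes "c \<in> carrier F" "d \<in> carrier F"
  shows "c - d \<in> carrier F"
  using assms keys_diff[of c d] unfolding free_pair_ring_simps by blast

lemma free_pair_ring_m_closed:
  assumes c: "c \<in> carrier F" and d: "d \<in> carrier F"
  shows "c \<otimes>\<^bsub>F\<^esub> d \<in> carrier F"
proof -
  note diff = free_pair_ring_diff_closed
  have "frag_of (a, b) \<otimes>\<^bsub>F\<^esub> d \<in> carrier F" if "a \<in> carrier A" "b \<in> carrier B" for a b
    using d[simplified] 
    by (induction d rule: frag_induction) (use that diff in \<open>auto simp: free_pair_ring_bilinear\<close>)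
  with c[simplified] show ?thesis
    by (induction c rule: frag_induction) (use diff in \<open>auto simp: free_pair_ring_bilinear\<close>)
qed

text \<open>Associativity is additive in each of the three arguments, so successive inductions on
  \<open>e\<close>, \<open>d\<close> and \<open>c\<close> reduce it to generators, where it is
  associativity in \<open>A\<close> and \<open>B\<close>.\<close>

lemma ring_free_pair_ring: "ring F"
proof (rule ringI)
  show "abelian_group F"
    by (rule comm_group_abelian_groupI)
      (simp only: add_monoid_free_pair_ring abelian_free_Abelian_group)
  show "Group.monoid F"
  proof (rule monoidI)
    fix c d e assume c: "c \<in> carrier F" and d: "d \<in> carrier F" and e: "e \<in> carrier F"
    show "c \<otimes>\<^bsub>F\<^esub> d \<in> carrier F"
      by (rule free_pair_ring_m_closed) fact+
    have "x \<otimes>\<^bsub>F\<^esub> y \<otimes>\<^bsub>F\<^esub> e = x \<otimes>\<^bsub>F\<^esub> (y \<otimes>\<^bsub>F\<^esub> e)"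
      if "x = frag_of (a, b)" "y = frag_of (a', b')" "a \<in> carrier A" "b \<in> carrier B"
        "a' \<in> carrier A" "b' \<in> carrier B" for x y a a' b b'
      using e[simplified]
      by (induction e rule: frag_induction)
        (use that in \<open>auto simp: free_pair_ring_bilinear A.m_assoc B.m_assoc\<close>)
    note gen = this[OF refl refl]
    have "x \<otimes>\<^bsub>F\<^esub> d \<otimes>\<^bsub>F\<^esub> e = x \<otimes>\<^bsub>F\<^esub> (d \<otimes>\<^bsub>F\<^esub> e)"
      if "x = frag_of (a, b)" "a \<in> carrier A" "b \<in> carrier B" for x a b
      using d[simplified]
      by (induction d rule: frag_induction) (use that gen in \<open>auto simp: free_pair_ring_bilinear\<close>)
    with c[simplified] show "c \<otimes>\<^bsub>F\<^esub> d \<otimes>\<^bsub>F\<^esub> e = c \<otimes>\<^bsub>F\<^esub> (d \<otimes>\<^bsub>F\<^esub> e)"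
      by (induction c rule: frag_induction) (auto simp: free_pair_ring_bilinear)
  next
    fix c assume "c \<in> carrier F"
    then have c: "Poly_Mapping.keys c \<subseteq> carrier A \<times> carrier B"
      by simp
    then show "\<one>\<^bsub>F\<^esub> \<otimes>\<^bsub>F\<^esub> c = c"
      by (induction c rule: frag_induction) (auto simp: free_pair_ring_bilinear)
    from c show "c \<otimes>\<^bsub>F\<^esub> \<one>\<^bsub>F\<^esub> = c"
      by (induction c rule: frag_induction) (auto simp: free_pair_ring_bilinear)
  qed simp
qed (simp_all add: free_pair_ring_l_distr free_pair_ring_r_distr)

text \<open>The additive extension of \<open>\<beta>\<close> exists because the group is free. It
  respects products since both sides of the multiplicativity law are biadditive and agree on
  generators.\<close>

lemma free_pair_ring_universal:
  assumes "ring V"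
    and closed: "\<And>a b. a \<in> carrier A \<Longrightarrow> b \<in> carrier B \<Longrightarrow> \<beta> a b \<in> carrier V"
    and mult: "\<And>a b a' b'. a \<in> carrier A \<Longrightarrow> b \<in> carrier B \<Longrightarrow> a' \<in> carrier A \<Longrightarrow> b' \<in> carrier B \<Longrightarrow>
      \<beta> (a \<otimes>\<^bsub>A\<^esub> a') (b \<otimes>\<^bsub>B\<^esub> b') = \<beta> a b \<otimes>\<^bsub>V\<^esub> \<beta> a' b'"
    and one: "\<beta> \<one>\<^bsub>A\<^esub> \<one>\<^bsub>B\<^esub> = \<one>\<^bsub>V\<^esub>"
  obtains h where "ring_hom_ring F V h"
    "\<And>a b. a \<in> carrier A \<Longrightarrow> b \<in> carrier B \<Longrightarrow> h (frag_of (a, b)) = \<beta> a b"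
proof -
  interpret V: ring V by fact
  obtain h where h: "h \<in> hom (free_Abelian_group (carrier A \<times> carrier B)) (add_monoid V)"
    and gen: "\<And>x. x \<in> carrier A \<times> carrier B \<Longrightarrow> h (frag_of x) = \<beta> (fst x) (snd x)"
    using V.add.free_Abelian_group_universal[of "\<lambda>x. \<beta> (fst x) (snd x)" "carrier A \<times> carrier B"]
      closed by (auto simp: image_subset_iff)
  interpret h: group_hom "add_monoid F" "add_monoid V" h
    using h V.a_group unfolding add_monoid_free_pair_ring
    by (simp add: group_hom_def group_hom_axioms_def)
  have h_closed: "h c \<in> carrier V" if "c \<in> carrier F" for c
    using h.hom_closed[of c] that by simp
  have h_add: "h (c + d) = h c \<oplus>\<^bsub>V\<^esub> h d" if "c \<in> carrier F" "d \<in> carrier F" for c d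
    using h.hom_mult[of c d] that by simp
  have h_zero: "h 0 = \<zero>\<^bsub>V\<^esub>"
    using h.hom_one by simp
  note F_diff = free_pair_ring_diff_closed
  have h_diff: "h (c - d) = h c \<ominus>\<^bsub>V\<^esub> h d" if "c \<in> carrier F" "d \<in> carrier F" for c d
  proof -
    have "h c = h (c - d) \<oplus>\<^bsub>V\<^esub> h d"
      using h_add[OF F_diff[OF that] that(2)] by simp
    then show ?thesis
      using h_closed that F_diff[OF that] by (simp add: V.minus_eq V.a_assoc V.r_neg)
  qed
  have h_mult: "h (c \<otimes>\<^bsub>F\<^esub> d) = h c \<otimes>\<^bsub>V\<^esub> h d" if c: "c \<in> carrier F" and d: "d \<in> carrier F" for c d
  proof -
    have F_gen: "frag_of (a, b) \<in> carrier F" if "a \<in> carrier A" "b \<in> carrier B" for a b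
      using that by simp
    have 1: "h (frag_of (a, b) \<otimes>\<^bsub>F\<^esub> d) = \<beta> a b \<otimes>\<^bsub>V\<^esub> h d" if ab: "a \<in> carrier A" "b \<in> carrier B" for a b
    proof -
      \<comment> \<open>Membership is carried through the induction because \<open>h_diff\<close>
        needs both terms of a difference in the carrier.\<close>
      have "d \<in> carrier F \<and> h (frag_of (a, b) \<otimes>\<^bsub>F\<^esub> d) = \<beta> a b \<otimes>\<^bsub>V\<^esub> h d"
        using d[simplified]
      proof (induction d rule: frag_induction)
        case (one x)
        then show ?case
          using ab gen mult by auto
      next
        case (diff x y)
        then show ?case
          using ab closed F_diff h_closed free_pair_ring_m_closed[OF F_gen[OF ab]]
          by (auto simp: free_pair_ring_bilinear h_diff V.minus_eq V.r_distr V.r_minus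
              simp del: free_pair_ring_simps(1))
      qed (use ab closed in \<open>simp add: free_pair_ring_bilinear h_zero\<close>)
      then show ?thesis ..
    qed
    have "c \<in> carrier F \<and> h (c \<otimes>\<^bsub>F\<^esub> d) = h c \<otimes>\<^bsub>V\<^esub> h d"
      using c[simplified]
    proof (induction c rule: frag_induction)
      case (one x)
      then show ?case
        using 1 gen by auto
    next
      case (diff x y)
      then show ?case
        using d F_diff h_closed free_pair_ring_m_closed[OF _ d]
        by (auto simp: free_pair_ring_bilinear h_diff V.minus_eq V.l_distr V.l_minus
            simp del: free_pair_ring_simps(1))
    qed (use d h_closed in \<open>simp add: free_pair_ring_bilinear h_zero del: free_pair_ring_simps(1)\<close>, simp)
    then show ?thesis ..
  qed
  have "ring_hom_ring F V h"
  proof (rule ring_hom_ringI[OF ring_free_pair_ring V.ring_axioms])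
    show "h \<one>\<^bsub>F\<^esub> = \<one>\<^bsub>V\<^esub>"
      using gen one by simp
  qed (use h_closed h_add h_mult in auto)
  then show thesis
    using that gen by simp
qed

text \<open>By construction only an additive subgroup. It is recognised as an ideal in
  \<open>tensor_ring_iso\<close>, where it turns out to be the kernel of a ring
  homomorphism.\<close>

definition tensor_ideal where "tensor_ideal = generate (add_monoid F) (tensor_relations A B)"

lemma tensor_relations_subset: "tensor_relations A B \<subseteq> carrier F"
proof -
  have gen: "frag_of p - frag_of q - frag_of r \<in> carrier F"
    if "p \<in> carrier A \<times> carrier B" "q \<in> carrier A \<times> carrier B" "r \<in> carrier A \<times> carrier B" for p q r
    using that by (intro free_pair_ring_diff_closed) simp_all
  show ?thesis
    unfolding tensor_relations_def by (auto intro!: gen simp del: free_pair_ring_simps)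
qed

lemma subgroup_tensor_ideal: "subgroup tensor_ideal (add_monoid F)"
  unfolding tensor_ideal_def add_monoid_free_pair_ring
  using tensor_relations_subset by (intro group.generate_is_subgroup) auto

lemma tensor_ideal_zero: "0 \<in> tensor_ideal" and tensor_ideal_add: "c \<in> tensor_ideal \<Longrightarrow> d \<in> tensor_ideal \<Longrightarrow> c + d \<in> tensor_ideal"
  using subgroup.one_closed[OF subgroup_tensor_ideal] subgroup.m_closed[OF subgroup_tensor_ideal, of c d] by simp_all

lemma tensor_ideal_uminus: "c \<in> tensor_ideal \<Longrightarrow> - c \<in> tensor_ideal"
  using subgroup.m_inv_closed[OF subgroup_tensor_ideal, of c] subgroup.mem_carrier[OF subgroup_tensor_ideal, of c]
  unfolding add_monoid_free_pair_ring by simp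

lemma tensor_ideal_diff: "c \<in> tensor_ideal \<Longrightarrow> d \<in> tensor_ideal \<Longrightarrow> c - d \<in> tensor_ideal"
  using tensor_ideal_add[of c "- d"] tensor_ideal_uminus by simp

lemma tensor_ideal_left:
  "a \<in> carrier A \<Longrightarrow> a' \<in> carrier A \<Longrightarrow> b \<in> carrier B \<Longrightarrow>
    frag_of (a \<oplus>\<^bsub>A\<^esub> a', b) - frag_of (a, b) - frag_of (a', b) \<in> tensor_ideal"
  unfolding tensor_ideal_def tensor_relations_def by (rule generate.incl) blast

lemma tensor_ideal_right:
  "a \<in> carrier A \<Longrightarrow> b \<in> carrier B \<Longrightarrow> b' \<in> carrier B \<Longrightarrow>
    frag_of (a, b \<oplus>\<^bsub>B\<^esub> b') - frag_of (a, b) - frag_of (a, b') \<in> tensor_ideal"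
  unfolding tensor_ideal_def tensor_relations_def by (rule generate.incl) blast

text \<open>For \<open>a = a' = 0\<close> the additivity relation collapses to the negative of this
  generator.\<close>

lemma tensor_ideal_zero_left: "b \<in> carrier B \<Longrightarrow> frag_of (\<zero>\<^bsub>A\<^esub>, b) \<in> tensor_ideal"
  using tensor_ideal_left[of "\<zero>\<^bsub>A\<^esub>" "\<zero>\<^bsub>A\<^esub>" b] tensor_ideal_uminus by fastforce

lemma tensor_ideal_zero_right: "a \<in> carrier A \<Longrightarrow> frag_of (a, \<zero>\<^bsub>B\<^esub>) \<in> tensor_ideal"
  using tensor_ideal_right[of a "\<zero>\<^bsub>B\<^esub>" "\<zero>\<^bsub>B\<^esub>"] tensor_ideal_uminus by fastforce

text \<open>Passing from \<open>n\<close> to \<open>n + 1\<close> changes the element by a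
  difference of two defining relations, one for each factor. Induction upwards and downwards from
  \<open>0\<close> therefore covers all integers.\<close>

lemma tensor_ideal_balanced:
  fixes n :: int
  assumes a: "a \<in> carrier A" and b: "b \<in> carrier B"
  shows "frag_of (add_pow A n a, b) - frag_of (a, add_pow B n b) \<in> tensor_ideal"
proof -
  let ?D = "\<lambda>n::int. frag_of (add_pow A n a, b) - frag_of (a, add_pow B n b)"
  have step: "?D (n + 1) - ?D n \<in> tensor_ideal" for n
  proof -
    have "add_pow A (n + 1) a = add_pow A n a \<oplus>\<^bsub>A\<^esub> a" "add_pow B (n + 1) b = add_pow B n b \<oplus>\<^bsub>B\<^esub> b"
      using a b A.add.int_pow_mult[of a n 1] B.add.int_pow_mult[of b n 1] by simp_all
    then show ?thesis
      using tensor_ideal_diff[OF tensor_ideal_left[of "add_pow A n a" a b] tensor_ideal_right[of a "add_pow B n b" b]] a b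
      by (simp add: algebra_simps)
  qed
  show ?thesis
  proof (induction n rule: int_induct[of _ 0])
    case base
    show ?case
      using tensor_ideal_diff[OF tensor_ideal_zero_left[OF b] tensor_ideal_zero_right[OF a]] by (simp add: add_pow_def)
  next
    case (step1 i)
    show ?case
      using tensor_ideal_add[OF step[of i] step1(2)] by simp
  next
    case (step2 i)
    show ?case
      using tensor_ideal_diff[OF step2(2) step[of "i - 1"]] by simp
  qed
qed

text \<open>Biadditivity puts the relations into the kernel of the homomorphism \<open>h\<close>
  induced by \<open>\<beta>\<close>. Conversely, \<open>pure\<close> replaces an element of the
  kernel by a single generator modulo the relations, and \<open>kernel\<close> handles that
  generator. By \<open>pure\<close> again, the values of \<open>\<beta>\<close> already form the
  whole image, so they make up a subring of \<open>V\<close>.\<close>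

lemma tensor_ring_iso:
  assumes V: "ring V"
    and closed: "\<And>a b. a \<in> carrier A \<Longrightarrow> b \<in> carrier B \<Longrightarrow> \<beta> a b \<in> carrier V"
    and mult: "\<And>a b a' b'. a \<in> carrier A \<Longrightarrow> b \<in> carrier B \<Longrightarrow> a' \<in> carrier A \<Longrightarrow> b' \<in> carrier B \<Longrightarrow>
      \<beta> (a \<otimes>\<^bsub>A\<^esub> a') (b \<otimes>\<^bsub>B\<^esub> b') = \<beta> a b \<otimes>\<^bsub>V\<^esub> \<beta> a' b'"
    and one: "\<beta> \<one>\<^bsub>A\<^esub> \<one>\<^bsub>B\<^esub> = \<one>\<^bsub>V\<^esub>"
    and left: "\<And>a a' b. a \<in> carrier A \<Longrightarrow> a' \<in> carrier A \<Longrightarrow> b \<in> carrier B \<Longrightarrow>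
      \<beta> (a \<oplus>\<^bsub>A\<^esub> a') b = \<beta> a b \<oplus>\<^bsub>V\<^esub> \<beta> a' b"
    and right: "\<And>a b b'. a \<in> carrier A \<Longrightarrow> b \<in> carrier B \<Longrightarrow> b' \<in> carrier B \<Longrightarrow>
      \<beta> a (b \<oplus>\<^bsub>B\<^esub> b') = \<beta> a b \<oplus>\<^bsub>V\<^esub> \<beta> a b'"
    and pure: "\<And>c. c \<in> carrier F \<Longrightarrow> \<exists>a\<in>carrier A. \<exists>b\<in>carrier B. c - frag_of (a, b) \<in> tensor_ideal"
    and kernel: "\<And>a b. a \<in> carrier A \<Longrightarrow> b \<in> carrier B \<Longrightarrow> \<beta> a b = \<zero>\<^bsub>V\<^esub> \<Longrightarrow> frag_of (a, b) \<in> tensor_ideal"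
  shows "ring (tensor_ring A B) \<and> tensor_ring A B \<simeq> V\<lparr>carrier := {\<beta> a b |a b. a \<in> carrier A \<and> b \<in> carrier B}\<rparr>"
proof
  interpret V: ring V by fact
  obtain h where h: "ring_hom_ring F V h"
    and gen: "\<And>a b. a \<in> carrier A \<Longrightarrow> b \<in> carrier B \<Longrightarrow> h (frag_of (a, b)) = \<beta> a b"
    using free_pair_ring_universal[OF V closed mult one] by blast
  interpret h: ring_hom_ring F V h by (rule h)
  have h_add: "h (c + d) = h c \<oplus>\<^bsub>V\<^esub> h d" if "c \<in> carrier F" "d \<in> carrier F" for c d
    using h.hom_add[OF that] by simp
  have tensor_ideal_carrier: "tensor_ideal \<subseteq> carrier F"
    using subgroup.subset[OF subgroup_tensor_ideal] by simp
  have kernel_iff: "c \<in> a_kernel F V h \<longleftrightarrow> c \<in> carrier F \<and> h c = \<zero>\<^bsub>V\<^esub>" for c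
    by (simp only: a_kernel_def' mem_Collect_eq)
  have tensor_ideal_kernel: "tensor_ideal \<subseteq> a_kernel F V h"
    unfolding tensor_ideal_def
  proof (rule h.R.add.generate_subgroup_incl)
    show "subgroup (a_kernel F V h) (add_monoid F)"
      using h.kernel_is_ideal by (intro additive_subgroup.a_subgroup ideal.axioms(1))
    have ker: "x - y - z \<in> a_kernel F V h"
      if "x \<in> carrier F" "y \<in> carrier F" "z \<in> carrier F" "h x = h y \<oplus>\<^bsub>V\<^esub> h z" for x y z
    proof -
      have c: "x - y - z \<in> carrier F" "y + z \<in> carrier F"
        using that free_pair_ring_diff_closed h.R.a_closed[of y z] by auto
      have "h (y + z) = h x"
        using h_add[OF that(2,3)] that(4) by (simp only:)
      moreover have "x - y - z + (y + z) = x"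
        by simp
      ultimately have "h (x - y - z) \<oplus>\<^bsub>V\<^esub> h x = h x"
        using h_add[OF c] by (simp only:)
      then have "h (x - y - z) \<oplus>\<^bsub>V\<^esub> h x = \<zero>\<^bsub>V\<^esub> \<oplus>\<^bsub>V\<^esub> h x"
        unfolding V.l_zero[OF h.hom_closed[OF that(1)]] .
      from V.add.r_cancel[OF this h.hom_closed[OF c(1)] V.zero_closed h.hom_closed[OF that(1)]]
      show ?thesis
        using c(1) kernel_iff by blast
    qed
    show "tensor_relations A B \<subseteq> a_kernel F V h"
    proof
      fix r assume "r \<in> tensor_relations A B"
      then consider
          a a' b where "r = frag_of (a \<oplus>\<^bsub>A\<^esub> a', b) - frag_of (a, b) - frag_of (a', b)"
            "a \<in> carrier A" "a' \<in> carrier A" "b \<in> carrier B"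
        | a b b' where "r = frag_of (a, b \<oplus>\<^bsub>B\<^esub> b') - frag_of (a, b) - frag_of (a, b')"
            "a \<in> carrier A" "b \<in> carrier B" "b' \<in> carrier B"
        unfolding tensor_relations_def by blast
      then show "r \<in> a_kernel F V h"
        by cases (simp_all only:, (rule ker; simp add: gen left right)+)
    qed
  qed
  have h_pure: "h c = \<beta> a b"
    if "c \<in> carrier F" "a \<in> carrier A" "b \<in> carrier B" "c - frag_of (a, b) \<in> tensor_ideal" for a b c
  proof -
    have F: "c - frag_of (a, b) \<in> carrier F" "frag_of (a, b) \<in> carrier F"
      using that tensor_ideal_carrier by auto
    have "h (c - frag_of (a, b)) = \<zero>\<^bsub>V\<^esub>"
      using that(4) tensor_ideal_kernel kernel_iff by blast
    then show ?thesis
      using h_add[OF F] V.l_zero[OF closed[OF that(2,3)]] by (simp only: gen[OF that(2,3)] diff_add_cancel)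
  qed
  have "c \<in> tensor_ideal" if c: "c \<in> carrier F" "h c = \<zero>\<^bsub>V\<^esub>" for c
  proof -
    obtain a b where ab: "a \<in> carrier A" "b \<in> carrier B" "c - frag_of (a, b) \<in> tensor_ideal"
      using pure[OF c(1)] by blast
    then have "\<beta> a b = \<zero>\<^bsub>V\<^esub>"
      using h_pure[OF c(1) ab] c(2) by (simp only:)
    then show ?thesis
      using tensor_ideal_add[OF ab(3) kernel[OF ab(1,2)]] by simp
  qed
  then have kernel_eq: "a_kernel F V h = tensor_ideal"
    using tensor_ideal_kernel kernel_iff by blast
  have image_eq: "h ` carrier F = {\<beta> a b |a b. a \<in> carrier A \<and> b \<in> carrier B}"
  proof (intro equalityI subsetI)
    fix v assume "v \<in> h ` carrier F"
    then obtain c where c: "c \<in> carrier F" "v = h c"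
      by blast
    then show "v \<in> {\<beta> a b |a b. a \<in> carrier A \<and> b \<in> carrier B}"
      using pure[OF c(1)] h_pure[OF c(1)] by blast
  next
    fix v assume "v \<in> {\<beta> a b |a b. a \<in> carrier A \<and> b \<in> carrier B}"
    then obtain a b where ab: "v = \<beta> a b" "a \<in> carrier A" "b \<in> carrier B"
      by blast
    then have "frag_of (a, b) \<in> carrier F"
      by simp
    then show "v \<in> h ` carrier F"
      unfolding ab(1) gen[OF ab(2,3), symmetric] by (rule imageI)
  qed
  \<comment> \<open>The isomorphism theorem needs a surjection, so the target is cut down to the
    image; the kernel stays the same.\<close>
  let ?W = "V\<lparr>carrier := h ` carrier F\<rparr>"
  have "h \<in> ring_hom F ?W"
    using h.homh unfolding ring_hom_def by (simp del: free_pair_ring_simps)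
  then have "ring_hom_ring F ?W h"
    by (rule ring_hom_ringI2[OF h.R.ring_axioms h.img_is_ring])
  then interpret W: ring_hom_ring F ?W h .
  have "F Quot (a_kernel F ?W h) \<simeq> ?W"
    by (rule W.FactRing_iso) simp
  moreover have W_kernel: "a_kernel F ?W h = tensor_ideal"
    using kernel_eq unfolding a_kernel_def' by simp
  ultimately show "tensor_ring A B \<simeq> V\<lparr>carrier := {\<beta> a b |a b. a \<in> carrier A \<and> b \<in> carrier B}\<rparr>"
    unfolding tensor_ring_def tensor_ideal_def[symmetric] image_eq by (simp only:)
  show "ring (tensor_ring A B)"
    using ideal.quotient_is_ring[OF W.kernel_is_ideal]
    unfolding tensor_ring_def tensor_ideal_def[symmetric] W_kernel .
qed

end

lemma rat_ring_simps [simp]: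
  "carrier rat_ring = UNIV"
  "p \<otimes>\<^bsub>rat_ring\<^esub> q = p * q"
  "\<one>\<^bsub>rat_ring\<^esub> = 1"
  "\<zero>\<^bsub>rat_ring\<^esub> = 0"
  "p \<oplus>\<^bsub>rat_ring\<^esub> q = p + q"
  by (simp_all add: ring_of_type_algebra_def)

lemma rat_ring_add_pow: "add_pow rat_ring (n::int) q = of_int n * q"
proof -
  interpret ring rat_ring
    by (rule ring_from_type_algebra)
  have nat: "add_pow rat_ring (k::nat) q = of_nat k * q" for k
    by (induction k) (simp_all add: add_pow_def nat_pow_def algebra_simps)
  have minus: "\<ominus>\<^bsub>rat_ring\<^esub> p = - p" for p
    by (rule minus_equality) simp_all
  show ?thesis
  proof (cases "n \<ge> 0")
    case True
    then show ?thesis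
      by (simp add: add_pow_int_ge nat)
  next
    case False
    then show ?thesis
      by (simp add: add_pow_int_lt nat minus)
  qed
qed

text \<open>As \<open>V\<close> is torsion-free and divisible, \<open>a \<otimes> n/d\<close> can be sent to the unique \<open>w\<close> with
  \<open>d w = n \<pi>(a)\<close>. Every tensor has the form \<open>a \<otimes> 1/k\<close>, so the kernel of this map is
  controlled by that of \<open>\<pi>\<close>.\<close>

lemma tensor_rat_ring_iso:
  assumes A: "ring A" and V: "ring V" and \<pi>: "\<pi> \<in> ring_hom A V"
    and div: "\<And>v k::nat. v \<in> carrier V \<Longrightarrow> k > 0 \<Longrightarrow> \<exists>w\<in>carrier V. add_pow V k w = v"
    and tf: "\<And>v k::nat. v \<in> carrier V \<Longrightarrow> k > 0 \<Longrightarrow> add_pow V k v = \<zero>\<^bsub>V\<^esub> \<Longrightarrow> v = \<zero>\<^bsub>V\<^esub>"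
    and torsion: "\<And>a. a \<in> carrier A \<Longrightarrow> \<pi> a = \<zero>\<^bsub>V\<^esub> \<Longrightarrow> \<exists>k::nat. k > 0 \<and> add_pow A k a = \<zero>\<^bsub>A\<^esub>"
  shows "ring (tensor_ring A rat_ring)" and "tensor_ring A rat_ring \<simeq>
    V\<lparr>carrier := {w \<in> carrier V. \<exists>k::nat. k > 0 \<and> add_pow V k w \<in> \<pi> ` carrier A}\<rparr>"
proof -
  interpret A: ring A by fact
  interpret V: ring V by fact
  interpret Q: ring rat_ring by (rule ring_from_type_algebra)
  interpret \<pi>: ring_hom_ring A V \<pi>
    by (rule ring_hom_ringI2[OF A V \<pi>])
  have pos: "\<exists>k::nat. k > 0 \<and> d = int k" if "d > 0" for d :: int
    using that by (intro exI[of _ "nat d"]) simp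
  have div': "\<exists>w\<in>carrier V. add_pow V d w = v" if "v \<in> carrier V" "d > 0" for v and d :: int
    using div[OF that(1)] pos[OF that(2)] by (auto simp: add_pow_int_of_nat)
  have cancel: "v = w"
    if vw: "v \<in> carrier V" "w \<in> carrier V" "d > 0" "add_pow V d v = add_pow V d w" for v w and d :: int
  proof -
    obtain k :: nat where k: "k > 0" "d = int k"
      using pos[OF vw(3)] by blast
    have "add_pow V d (v \<ominus>\<^bsub>V\<^esub> w) = \<zero>\<^bsub>V\<^esub>"
      using that by (simp add: V.minus_eq V.add.int_pow_distrib V.add.int_pow_inv V.r_neg)
    then have "v \<ominus>\<^bsub>V\<^esub> w = \<zero>\<^bsub>V\<^esub>"
      using tf[of "v \<ominus>\<^bsub>V\<^esub> w" k] that k by (simp add: add_pow_int_of_nat)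
    then show ?thesis
      using that by simp
  qed
  define \<beta> where "\<beta> a q = (SOME w. w \<in> carrier V \<and>
    add_pow V (snd (quotient_of q)) w = add_pow V (fst (quotient_of q)) (\<pi> a))" for a q
  have \<beta>: "\<beta> a q \<in> carrier V"
      "add_pow V (snd (quotient_of q)) (\<beta> a q) = add_pow V (fst (quotient_of q)) (\<pi> a)"
    if a: "a \<in> carrier A" for a q
  proof -
    have "\<exists>w. w \<in> carrier V \<and>
        add_pow V (snd (quotient_of q)) w = add_pow V (fst (quotient_of q)) (\<pi> a)"
      using div'[of _ "snd (quotient_of q)"] a by (simp add: quotient_of_denom_pos' Bex_def)
    from someI_ex[OF this] show "\<beta> a q \<in> carrier V"
      "add_pow V (snd (quotient_of q)) (\<beta> a q) = add_pow V (fst (quotient_of q)) (\<pi> a)"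
      by (simp_all add: \<beta>_def)
  qed
  have frac: "q = of_int (fst (quotient_of q)) / of_int (snd (quotient_of q))" for q
    using quotient_of_div[of q] by (simp add: prod_eq_iff)
  \<comment> \<open>The choice of \<open>\<beta>\<close> uses the reduced fraction of
    \<open>q\<close>; this removes that dependence. For any \<open>n/d\<close> equal to
    \<open>q\<close>, multiplying by both denominators gives the same multiple of
    \<open>\<pi> a\<close>, and torsion-freeness cancels the factor. Sums and products can then be
    computed over unreduced common denominators.\<close>
  have \<beta>_eq: "\<beta> a q = w"
    if a: "a \<in> carrier A" and w: "w \<in> carrier V" and d: "d > 0" and q: "q = of_int n / of_int d"
      and eq: "add_pow V d w = add_pow V n (\<pi> a)" for a q w n d
  proof (rule cancel)
    let ?n = "fst (quotient_of q)" and ?d = "snd (quotient_of q)"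
    have d': "?d > 0"
      by (rule quotient_of_denom_pos')
    have "of_int ?n / of_int ?d = (of_int n / of_int d :: rat)"
      using frac[of q] q by simp
    then have "of_int (?n * d) = (of_int (n * ?d) :: rat)"
      using d d' by (simp add: field_simps)
    then have nd: "?n * d = n * ?d"
      by (simp only: of_int_eq_iff)
    have "add_pow V (?d * d) (\<beta> a q) = add_pow V (?n * d) (\<pi> a)"
      using \<beta>[OF a, of q] a by (simp add: V.add.int_pow_pow[symmetric])
    also have "\<dots> = add_pow V (?d * d) w"
      unfolding nd mult.commute[of ?d d] using eq a w by (simp add: V.add.int_pow_pow[symmetric])
    finally show "add_pow V (?d * d) (\<beta> a q) = add_pow V (?d * d) w" .
    show "?d * d > 0"
      using d d' by simp
  qed (use \<beta> a w in auto)
  note FR = A ring_from_type_algebra[where 'a = rat]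
  let ?I = "tensor_ideal A rat_ring"
  have bal: "frag_of (add_pow A n a, q) - frag_of (a, of_int n * q) \<in> ?I"
    if "a \<in> carrier A" for a q and n :: int
    using tensor_ideal_balanced[OF FR that, of q n] by (simp add: rat_ring_add_pow)
  have iso: "ring (tensor_ring A rat_ring) \<and> tensor_ring A rat_ring \<simeq>
      V\<lparr>carrier := {\<beta> a b |a b. a \<in> carrier A \<and> b \<in> carrier rat_ring}\<rparr>"
  proof (rule tensor_ring_iso[OF FR V])
    fix a q assume a: "a \<in> carrier A"
    show "\<beta> a q \<in> carrier V"
      using \<beta> a by blast
    let ?n = "fst (quotient_of q)" and ?d = "snd (quotient_of q)"
    have d: "?d > 0"
      by (rule quotient_of_denom_pos')
    fix a' assume a': "a' \<in> carrier A"
    show "\<beta> (a \<oplus>\<^bsub>A\<^esub> a') q = \<beta> a q \<oplus>\<^bsub>V\<^esub> \<beta> a' q"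
      using \<beta> a a' by (intro \<beta>_eq[OF _ _ d frac]) (simp_all add: V.add.int_pow_distrib)
    fix q'
    let ?n' = "fst (quotient_of q')" and ?d' = "snd (quotient_of q')"
    have d': "?d' > 0"
      by (rule quotient_of_denom_pos')
    have "add_pow V (?d * ?d') (\<beta> a q \<otimes>\<^bsub>V\<^esub> \<beta> a' q') = add_pow V ?d (\<beta> a q) \<otimes>\<^bsub>V\<^esub> add_pow V ?d' (\<beta> a' q')"
      using \<beta>(1)[OF a] \<beta>(1)[OF a']
      by (simp add: V.add_pow_ldistr_int V.add_pow_rdistr_int V.add.int_pow_pow mult.commute)
    also have "\<dots> = add_pow V (?n * ?n') (\<pi> (a \<otimes>\<^bsub>A\<^esub> a'))"
      unfolding \<beta>(2)[OF a] \<beta>(2)[OF a'] using a a'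
      by (simp add: V.add_pow_ldistr_int V.add_pow_rdistr_int V.add.int_pow_pow mult.commute)
    finally show "\<beta> (a \<otimes>\<^bsub>A\<^esub> a') (q \<otimes>\<^bsub>rat_ring\<^esub> q') = \<beta> a q \<otimes>\<^bsub>V\<^esub> \<beta> a' q'"
      using d d' \<beta>(1) a a' frac[of q] frac[of q']
      by (intro \<beta>_eq[of _ _ "?d * ?d'" _ "?n * ?n'"]) (simp_all, metis times_divide_times_eq)
  next
    show "\<beta> \<one>\<^bsub>A\<^esub> \<one>\<^bsub>rat_ring\<^esub> = \<one>\<^bsub>V\<^esub>"
      by (rule \<beta>_eq[of _ _ 1 _ 1]) simp_all
  next
    fix a q q' assume a: "a \<in> carrier A"
    let ?n = "fst (quotient_of q)" and ?d = "snd (quotient_of q)"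
    let ?n' = "fst (quotient_of q')" and ?d' = "snd (quotient_of q')"
    have d: "?d > 0" "?d' > 0"
      by (rule quotient_of_denom_pos')+
    have "add_pow V (?d * ?d') (\<beta> a q \<oplus>\<^bsub>V\<^esub> \<beta> a q') =
        add_pow V ?d' (add_pow V ?d (\<beta> a q)) \<oplus>\<^bsub>V\<^esub> add_pow V ?d (add_pow V ?d' (\<beta> a q'))"
      using \<beta>(1)[OF a] by (simp add: V.add.int_pow_distrib V.add.int_pow_pow mult.commute)
    also have "\<dots> = add_pow V (?n * ?d' + ?n' * ?d) (\<pi> a)"
      unfolding \<beta>(2)[OF a] using a by (simp add: V.add.int_pow_pow V.add.int_pow_mult)
    finally show "\<beta> a (q \<oplus>\<^bsub>rat_ring\<^esub> q') = \<beta> a q \<oplus>\<^bsub>V\<^esub> \<beta> a q'"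
    proof (intro \<beta>_eq[of _ _ "?d * ?d'" _ "?n * ?d' + ?n' * ?d"])
      have "q + q' = of_int ?n / of_int ?d + of_int ?n' / of_int ?d'"
        using frac[of q] frac[of q'] by simp
      then show "q \<oplus>\<^bsub>rat_ring\<^esub> q' = of_int (?n * ?d' + ?n' * ?d) / of_int (?d * ?d')"
        using d by (simp add: add_frac_eq)
    qed (use d \<beta>(1)[OF a] a in simp_all)
  next
    fix c assume "c \<in> carrier (free_pair_ring A rat_ring)"
    then have "Poly_Mapping.keys c \<subseteq> carrier A \<times> UNIV"
      by (simp add: FR)
    \<comment> \<open>The second factor is required to be \<open>1/k\<close> so that differences can
      be formed: over the common denominator \<open>k l\<close>, the tensors of \<open>a\<close>
      with \<open>1/k\<close> and of \<open>b\<close> with \<open>1/l\<close> combine to that of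
      \<open>l a - k b\<close> with \<open>1/(k l)\<close>.\<close>
    then have "\<exists>a\<in>carrier A. \<exists>k::int. k > 0 \<and> c - frag_of (a, 1 / of_int k) \<in> ?I"
    proof (induction c rule: frag_induction)
      case zero
      have "0 - frag_of (\<zero>\<^bsub>A\<^esub>, 1 / of_int 1) \<in> ?I"
        using tensor_ideal_diff[OF FR tensor_ideal_zero[OF FR] tensor_ideal_zero_left[OF FR]] by simp
      then show ?case
        using A.zero_closed zero_less_one by blast
    next
      case (one x)
      obtain a q where x: "x = (a, q)" "a \<in> carrier A"
        using one by auto
      let ?n = "fst (quotient_of q)" and ?d = "snd (quotient_of q)"
      have "- (frag_of (add_pow A ?n a, 1 / of_int ?d) - frag_of (a, of_int ?n * (1 / of_int ?d))) \<in> ?I"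
        by (intro tensor_ideal_uminus[OF FR] bal x)
      moreover have "of_int ?n * (1 / of_int ?d) = q"
        using frac[of q] by simp
      ultimately have "frag_of x - frag_of (add_pow A ?n a, 1 / of_int ?d) \<in> ?I"
        by (simp add: x)
      moreover have "add_pow A ?n a \<in> carrier A"
        using x by simp
      ultimately show ?case
        using quotient_of_denom_pos'[of q] by blast
    next
      case (diff x y)
      then obtain a b :: 'a and k l :: int
        where a: "a \<in> carrier A" "k > 0" "x - frag_of (a, 1 / of_int k) \<in> ?I"
          and b: "b \<in> carrier A" "l > 0" "y - frag_of (b, 1 / of_int l) \<in> ?I"
        by blast
      let ?q = "1 / of_int (k * l) :: rat"
      let ?a = "add_pow A l a" and ?b = "add_pow A k b"
      have "of_int l * ?q = 1 / of_int k" "of_int k * ?q = 1 / of_int l"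
        using a(2) b(2) by (simp_all add: field_simps)
      then have ab: "frag_of (?a, ?q) - frag_of (a, 1 / of_int k) \<in> ?I"
          "frag_of (?b, ?q) - frag_of (b, 1 / of_int l) \<in> ?I"
        using bal[OF a(1), of l ?q] bal[OF b(1), of k ?q] by simp_all
      have c: "?a \<in> carrier A" "?b \<in> carrier A"
        using a b by simp_all
      have "?a \<ominus>\<^bsub>A\<^esub> ?b \<oplus>\<^bsub>A\<^esub> ?b = ?a"
        using c by (simp add: A.minus_eq A.a_assoc A.l_neg)
      then have "frag_of (?a, ?q) - frag_of (?a \<ominus>\<^bsub>A\<^esub> ?b, ?q) - frag_of (?b, ?q) \<in> ?I"
        using tensor_ideal_left[OF FR, of "?a \<ominus>\<^bsub>A\<^esub> ?b" ?b ?q] c by simp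
      from tensor_ideal_add[OF FR tensor_ideal_diff[OF FR tensor_ideal_diff[OF FR a(3) b(3)] tensor_ideal_diff[OF FR ab]] this]
      have "x - y - frag_of (?a \<ominus>\<^bsub>A\<^esub> ?b, ?q) \<in> ?I"
        by (simp add: algebra_simps)
      moreover have "k * l > 0"
        using a(2) b(2) by simp
      ultimately show ?case
        using c by blast
    qed
    then show "\<exists>a\<in>carrier A. \<exists>b\<in>carrier rat_ring. c - frag_of (a, b) \<in> ?I"
      by auto
  next
    fix a q assume a: "a \<in> carrier A" and zero: "\<beta> a q = \<zero>\<^bsub>V\<^esub>"
    let ?n = "fst (quotient_of q)" and ?d = "snd (quotient_of q)"
    \<comment> \<open>With \<open>q = n/d\<close> and value zero, \<open>n a\<close> lies in the
      kernel of \<open>\<pi>\<close>, so \<open>k n a = 0\<close> for some \<open>k > 0\<close>.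
      Writing \<open>q = n k / (d k)\<close> and moving \<open>n k\<close> across the tensor turns
      \<open>a\<close> into \<open>0\<close>.\<close>
    have "\<pi> (add_pow A ?n a) = \<zero>\<^bsub>V\<^esub>"
      using \<beta>(2)[OF a, of q] zero a by (simp add: \<pi>.hom_add_pow_int)
    then obtain k :: nat where k: "k > 0" "add_pow A k (add_pow A ?n a) = \<zero>\<^bsub>A\<^esub>"
      using torsion[of "add_pow A ?n a"] a by auto
    then have "add_pow A (?n * int k) a = \<zero>\<^bsub>A\<^esub>"
      using a by (simp add: A.add.int_pow_pow[symmetric] add_pow_int_of_nat)
    moreover have "of_int (?n * int k) * (1 / of_int (?d * int k)) = q"
      using frac[of q] k by simp
    ultimately have "frag_of (\<zero>\<^bsub>A\<^esub>, 1 / of_int (?d * int k)) - frag_of (a, q) \<in> ?I"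
      using bal[OF a, of "?n * int k" "1 / of_int (?d * int k)"] by metis
    moreover have "frag_of (\<zero>\<^bsub>A\<^esub>, 1 / of_int (?d * int k)) \<in> ?I"
      by (rule tensor_ideal_zero_left[OF FR]) simp
    ultimately show "frag_of (a, q) \<in> ?I"
      using tensor_ideal_diff[OF FR, of "frag_of (\<zero>\<^bsub>A\<^esub>, 1 / of_int (?d * int k))"
        "frag_of (\<zero>\<^bsub>A\<^esub>, 1 / of_int (?d * int k)) - frag_of (a, q)"] by simp
  qed
  have "{\<beta> a b |a b. a \<in> carrier A \<and> b \<in> carrier rat_ring} =
      {w \<in> carrier V. \<exists>k::nat. k > 0 \<and> add_pow V k w \<in> \<pi> ` carrier A}" (is "?L = ?R")
  proof (intro equalityI subsetI)
    fix w assume "w \<in> ?L"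
    then obtain a q where w: "w = \<beta> a q" "a \<in> carrier A"
      by blast
    obtain k :: nat where k: "k > 0" "snd (quotient_of q) = int k"
      using pos[OF quotient_of_denom_pos'] by blast
    have "add_pow V k w = \<pi> (add_pow A (fst (quotient_of q)) a)"
      using \<beta>(2)[OF w(2), of q] w k by (simp add: \<pi>.hom_add_pow_int add_pow_int_of_nat)
    moreover have "add_pow A (fst (quotient_of q)) a \<in> carrier A"
      using w by simp
    ultimately show "w \<in> ?R"
      using w k \<beta>(1) by blast
  next
    fix w assume "w \<in> ?R"
    then obtain k :: nat and a where w: "w \<in> carrier V" "k > 0" "a \<in> carrier A" "add_pow V k w = \<pi> a"
      by blast
    then have "\<beta> a (of_int 1 / of_int (int k)) = w"
      by (intro \<beta>_eq[of a w "int k" _ 1]) (simp_all add: add_pow_int_of_nat)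
    then show "w \<in> ?L"
      using w by auto
  qed
  with iso show "ring (tensor_ring A rat_ring)" "tensor_ring A rat_ring \<simeq>
      V\<lparr>carrier := {w \<in> carrier V. \<exists>k::nat. k > 0 \<and> add_pow V k w \<in> \<pi> ` carrier A}\<rparr>"
    by simp_all
qed

section \<open>Endomorphism rings of elementary groups\<close>

lemma end_ring_simps [simp]:
  "carrier (end_ring H) = hom H H \<inter> extensional (carrier H)"
  "f \<otimes>\<^bsub>end_ring H\<^esub> g = compose (carrier H) f g"
  "\<one>\<^bsub>end_ring H\<^esub> = (\<lambda>x\<in>carrier H. x)"
  "\<zero>\<^bsub>end_ring H\<^esub> = (\<lambda>x\<in>carrier H. \<one>\<^bsub>H\<^esub>)"
  "f \<oplus>\<^bsub>end_ring H\<^esub> g = (\<lambda>x\<in>carrier H. f x \<otimes>\<^bsub>H\<^esub> g x)"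
  by (simp_all add: end_ring_def)

lemma ring_end_ring:
  assumes "comm_group H" shows "ring (end_ring H)"
proof -
  interpret comm_group H by fact
  show ?thesis
  proof (rule ringI)
    show "abelian_group (end_ring H)"
    proof (rule abelian_groupI)
      fix f assume f: "f \<in> carrier (end_ring H)"
      show "\<exists>g\<in>carrier (end_ring H). g \<oplus>\<^bsub>end_ring H\<^esub> f = \<zero>\<^bsub>end_ring H\<^esub>"
        using f by (intro bexI[of _ "\<lambda>x\<in>carrier H. inv\<^bsub>H\<^esub> (f x)"])
          (auto simp: fun_eq_iff hom_def Pi_iff inv_mult)
    qed (auto simp: fun_eq_iff hom_def Pi_iff extensional_def m_assoc intro: m_comm m_lcomm)
    show "Group.monoid (end_ring H)"
      by (rule monoidI) (auto simp: fun_eq_iff hom_def Pi_iff extensional_def compose_def)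
  qed (auto simp: fun_eq_iff hom_def Pi_iff extensional_def compose_def)
qed

lemma end_ring_add_pow:
  assumes "x \<in> carrier H"
  shows "(add_pow (end_ring H) (k::nat) f) x = f x [^]\<^bsub>H\<^esub> k"
  using assms by (induction k) (simp_all add: add_pow_def nat_pow_def)

lemma end_ring_add_pow_eq_zero:
  assumes "\<And>x. x \<in> carrier H \<Longrightarrow> x [^]\<^bsub>H\<^esub> (k::nat) = \<one>\<^bsub>H\<^esub>" "comm_group H" "f \<in> carrier (end_ring H)"
  shows "add_pow (end_ring H) k f = \<zero>\<^bsub>end_ring H\<^esub>"
proof -
  interpret E: ring "end_ring H"
    by (rule ring_end_ring) fact
  have "add_pow (end_ring H) k f \<in> carrier (end_ring H)"
    using assms(3) by (rule E.add.nat_pow_closed)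
  then show ?thesis
    using assms(1,3)
    by (intro extensionalityI[of _ "carrier H"]) (auto simp: end_ring_add_pow hom_def)
qed

text \<open>A subgroup maximal among those meeting \<open>N\<close> trivially is a complement of \<open>N\<close>: an element
  outside \<open>N K\<close> generates, since \<open>p\<close> is prime, a subgroup meeting \<open>N K\<close> trivially.\<close>

lemma elementary_complement:
  fixes p :: nat
  assumes "comm_group H" "Factorial_Ring.prime p"
    and exponent: "\<And>x. x \<in> carrier H \<Longrightarrow> x [^]\<^bsub>H\<^esub> p = \<one>\<^bsub>H\<^esub>"
    and N: "subgroup N H"
  obtains K where "subgroup K H" "N \<inter> K = {\<one>\<^bsub>H\<^esub>}" "N <#>\<^bsub>H\<^esub> K = carrier H"
proof -
  interpret comm_group H by fact
  define C where "C = {K. subgroup K H \<and> N \<inter> K = {\<one>\<^bsub>H\<^esub>}}"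
  have one: "\<one>\<^bsub>H\<^esub> \<in> N"
    using N by (rule subgroup.one_closed)
  have "\<exists>M\<in>C. \<forall>J\<in>C. M \<subseteq> J \<longrightarrow> J = M"
  proof (rule subset_Zorn_nonempty)
    show "C \<noteq> {}"
      using triv_subgroup one by (auto simp: C_def)
    fix Ch assume Ch: "Ch \<noteq> {}" "subset.chain C Ch"
    then have sub: "subgroup K H" "N \<inter> K = {\<one>\<^bsub>H\<^esub>}" if "K \<in> Ch" for K
      using that by (auto simp: subset_chain_def C_def)
    have total: "K \<subseteq> L \<or> L \<subseteq> K" if "K \<in> Ch" "L \<in> Ch" for K L
      using Ch that by (auto simp: subset_chain_def)
    have "subgroup (\<Union>Ch) H"
    proof (rule subgroupI)
      show "\<Union>Ch \<subseteq> carrier H"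
        using sub(1) subgroup.subset by blast
      show "\<Union>Ch \<noteq> {}"
        using Ch(1) sub(1) subgroup.one_closed by blast
      show "inv\<^bsub>H\<^esub> a \<in> \<Union>Ch" if "a \<in> \<Union>Ch" for a
        using that by (auto intro: subgroup.m_inv_closed[OF sub(1)])
      show "a \<otimes>\<^bsub>H\<^esub> b \<in> \<Union>Ch" if ab: "a \<in> \<Union>Ch" "b \<in> \<Union>Ch" for a b
      proof -
        obtain K L where "K \<in> Ch" "L \<in> Ch" "a \<in> K" "b \<in> L"
          using ab by blast
        with total obtain J where "J \<in> Ch" "a \<in> J" "b \<in> J"
          by blast
        then show ?thesis
          by (auto intro: subgroup.m_closed[OF sub(1)])
      qed
    qed
    moreover have "N \<inter> \<Union>Ch = {\<one>\<^bsub>H\<^esub>}"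
      using Ch(1) sub(2) by blast
    ultimately show "\<Union>Ch \<in> C"
      by (simp add: C_def)
  qed
  then obtain K where K: "subgroup K H" "N \<inter> K = {\<one>\<^bsub>H\<^esub>}"
    and max: "\<And>J. subgroup J H \<Longrightarrow> N \<inter> J = {\<one>\<^bsub>H\<^esub>} \<Longrightarrow> K \<subseteq> J \<Longrightarrow> J = K"
    by (auto simp: C_def)
  have NK: "subgroup (N <#>\<^bsub>H\<^esub> K) H"
    using mult_subgroups[OF N K(1)] .
  have "x \<in> N <#>\<^bsub>H\<^esub> K" if x: "x \<in> carrier H" for x
  proof (rule ccontr)
    assume nx: "x \<notin> N <#>\<^bsub>H\<^esub> K"
    let ?Z = "generate H {x}"
    have Z: "subgroup ?Z H"
      using x by (intro generate_is_subgroup) simp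
    have KZ: "subgroup (K <#>\<^bsub>H\<^esub> ?Z) H"
      by (rule mult_subgroups[OF K(1) Z])
    have "a = \<one>\<^bsub>H\<^esub>" if a: "a \<in> N" "a \<in> K <#>\<^bsub>H\<^esub> ?Z" for a
    proof -
      obtain k z where k: "k \<in> K" and z: "z \<in> ?Z" and a_eq: "a = k \<otimes>\<^bsub>H\<^esub> z"
        using a(2) by (auto simp: set_mult_def)
      obtain j :: int where j: "z = x [^]\<^bsub>H\<^esub> j"
        using z generate_pow[OF x] by auto
      have kc: "k \<in> carrier H" "a \<in> carrier H" "z \<in> carrier H"
        using k K(1) a(1) N x j by (auto dest: subgroup.mem_carrier)
      have "z = a \<otimes>\<^bsub>H\<^esub> inv\<^bsub>H\<^esub> k"
        using kc a_eq m_comm[of k z] by (simp add: inv_solve_right)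
      then have zNK: "z \<in> N <#>\<^bsub>H\<^esub> K"
        using a(1) k K(1) by (auto simp: set_mult_def intro: subgroup.m_inv_closed)
      \<comment> \<open>Otherwise Bezout and \<open>x ^ p = 1\<close> express \<open>x\<close> as a
        power of \<open>z = x ^ j\<close>. As \<open>z\<close> lies in the subgroup
        \<open>N K\<close>, so would \<open>x\<close>.\<close>
      have "int p dvd j"
      proof (rule ccontr)
        assume "\<not> int p dvd j"
        then have "coprime (int p) j"
          using assms(2) by (simp add: prime_imp_coprime)
        then obtain u v where uv: "u * int p + v * j = 1"
          using bezout_int[of "int p" j] by auto
        have "x = x [^]\<^bsub>H\<^esub> (u * int p + v * j)"
          using x uv by simp
        also have "\<dots> = (x [^]\<^bsub>H\<^esub> int p) [^]\<^bsub>H\<^esub> u \<otimes>\<^bsub>H\<^esub> z [^]\<^bsub>H\<^esub> v"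
          using x by (simp add: int_pow_mult int_pow_pow j mult.commute)
        also have "\<dots> = z [^]\<^bsub>H\<^esub> v"
          using x kc exponent by (simp add: int_pow_int)
        finally have "x = z [^]\<^bsub>H\<^esub> v" .
        then show False
          using nx zNK subgroup_int_pow_closed[OF NK] by metis
      qed
      then obtain i where "j = int p * i"
        by blast
      then have "z = \<one>\<^bsub>H\<^esub>"
        using x exponent by (simp add: j int_pow_pow[symmetric] int_pow_int)
      then show ?thesis
        using a_eq a(1) k K(2) kc by auto
    qed
    then have "N \<inter> (K <#>\<^bsub>H\<^esub> ?Z) = {\<one>\<^bsub>H\<^esub>}"
      using one subgroup.one_closed[OF KZ] by blast
    moreover have "K \<subseteq> K <#>\<^bsub>H\<^esub> ?Z"
      using subgroup.one_closed[OF Z] subgroup.mem_carrier[OF K(1)] by (force simp: set_mult_def)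
    ultimately have "K <#>\<^bsub>H\<^esub> ?Z = K"
      using max KZ by blast
    moreover have "x \<in> K <#>\<^bsub>H\<^esub> ?Z"
      using subgroup.one_closed[OF K(1)] generate.incl[of x "{x}" H] x by (force simp: set_mult_def)
    ultimately have "x \<in> K"
      by simp
    then show False
      using nx one x by (force simp: set_mult_def)
  qed
  then have "N <#>\<^bsub>H\<^esub> K = carrier H"
    using subgroup.subset[OF NK] by blast
  with K that show thesis
    by blast
qed

text \<open>A quasi-inverse of \<open>f\<close> inverts \<open>f\<close> from a complement of its kernel onto its image and
  vanishes on a complement of the image.\<close>

lemma regular_end_ring:
  fixes p :: nat
  assumes "comm_group H" "Factorial_Ring.prime p"
    and exponent: "\<And>x. x \<in> carrier H \<Longrightarrow> x [^]\<^bsub>H\<^esub> p = \<one>\<^bsub>H\<^esub>"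
  shows "regular_ring (end_ring H)"
  unfolding regular_ring_def
proof (intro conjI ballI ring_end_ring)
  interpret comm_group H by fact
  fix f assume f: "f \<in> carrier (end_ring H)"
  interpret f: group_hom H H f
    using f by unfold_locales simp
  obtain K where K: "subgroup K H" "kernel H H f \<inter> K = {\<one>\<^bsub>H\<^esub>}" "kernel H H f <#>\<^bsub>H\<^esub> K = carrier H"
    using elementary_complement[OF assms f.subgroup_kernel] by blast
  obtain L where L: "subgroup L H" "f ` carrier H \<inter> L = {\<one>\<^bsub>H\<^esub>}" "f ` carrier H <#>\<^bsub>H\<^esub> L = carrier H"
    using elementary_complement[OF assms f.img_is_subgroup] by blast
  note Kc = subgroup.mem_carrier[OF K(1)] and Lc = subgroup.mem_carrier[OF L(1)]
  have split: "\<exists>n k. n \<in> kernel H H f \<and> k \<in> K \<and> x = n \<otimes>\<^bsub>H\<^esub> k" if "x \<in> carrier H" for x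
    using that K(3) by (auto simp: set_mult_def)
  have f_split: "\<exists>k\<in>K. f x = f k" if x: "x \<in> carrier H" for x
    using split[OF x] Kc by (auto simp: kernel_def)
  have ex: "\<exists>k\<in>K. \<exists>l\<in>L. x = f k \<otimes>\<^bsub>H\<^esub> l" if x: "x \<in> carrier H" for x
  proof -
    obtain y l where "y \<in> carrier H" "l \<in> L" "x = f y \<otimes>\<^bsub>H\<^esub> l"
      using x L(3) unfolding set_mult_def by blast
    with f_split[of y] show ?thesis
      by metis
  qed
  \<comment> \<open>Applied to the quotient of \<open>k\<close> by \<open>k'\<close>,
    \<open>f\<close> gives an element of both the image and \<open>L\<close>, hence
    \<open>1\<close>. So this quotient lies in the kernel and in \<open>K\<close>, which meet
    trivially.\<close>
  have unique: "k = k'"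
    if "k \<in> K" "k' \<in> K" "l \<in> L" "l' \<in> L" and eq: "f k \<otimes>\<^bsub>H\<^esub> l = f k' \<otimes>\<^bsub>H\<^esub> l'" for k k' l l'
  proof -
    have c: "k \<in> carrier H" "k' \<in> carrier H" "l \<in> carrier H" "l' \<in> carrier H"
      using that Kc Lc by auto
    have "f (k \<otimes>\<^bsub>H\<^esub> inv\<^bsub>H\<^esub> k') = f k \<otimes>\<^bsub>H\<^esub> l \<otimes>\<^bsub>H\<^esub> inv\<^bsub>H\<^esub> l \<otimes>\<^bsub>H\<^esub> inv\<^bsub>H\<^esub> (f k')"
      using c by (simp add: m_assoc)
    also have "\<dots> = (f k' \<otimes>\<^bsub>H\<^esub> inv\<^bsub>H\<^esub> (f k')) \<otimes>\<^bsub>H\<^esub> (l' \<otimes>\<^bsub>H\<^esub> inv\<^bsub>H\<^esub> l)"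
      unfolding eq using c by (simp only: m_ac f.hom_closed m_closed inv_closed)
    also have "\<dots> = l' \<otimes>\<^bsub>H\<^esub> inv\<^bsub>H\<^esub> l"
      using c by simp
    finally have "f (k \<otimes>\<^bsub>H\<^esub> inv\<^bsub>H\<^esub> k') \<in> L"
      using that L(1) by (simp add: subgroup.m_closed subgroup.m_inv_closed)
    then have "f (k \<otimes>\<^bsub>H\<^esub> inv\<^bsub>H\<^esub> k') = \<one>\<^bsub>H\<^esub>"
      using L(2) c by blast
    then have "k \<otimes>\<^bsub>H\<^esub> inv\<^bsub>H\<^esub> k' \<in> kernel H H f \<inter> K"
      using c that K(1) by (auto simp: kernel_def subgroup.m_closed subgroup.m_inv_closed)
    then show ?thesis
      using K(2) c by (simp add: inv_solve_right')
  qed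
  define g where "g = (\<lambda>x\<in>carrier H. SOME k. k \<in> K \<and> (\<exists>l\<in>L. x = f k \<otimes>\<^bsub>H\<^esub> l))"
  have g: "g x \<in> K" "\<exists>l\<in>L. x = f (g x) \<otimes>\<^bsub>H\<^esub> l" if "x \<in> carrier H" for x
    using someI_ex[OF ex[OF that, unfolded Bex_def[of K]]] that by (simp_all add: g_def)
  have g_eq: "g x = k" if "x \<in> carrier H" "k \<in> K" "l \<in> L" "x = f k \<otimes>\<^bsub>H\<^esub> l" for x k l
    using g[OF that(1)] that unique by metis
  have "g \<in> hom H H"
  proof (rule homI)
    show "g x \<in> carrier H" if "x \<in> carrier H" for x
      using g(1)[OF that] Kc by blast
    fix x y assume x: "x \<in> carrier H" and y: "y \<in> carrier H"
    obtain l m where l: "l \<in> L" "x = f (g x) \<otimes>\<^bsub>H\<^esub> l" and m: "m \<in> L" "y = f (g y) \<otimes>\<^bsub>H\<^esub> m"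
      using g(2) x y by blast
    have c: "g x \<in> carrier H" "g y \<in> carrier H" "l \<in> carrier H" "m \<in> carrier H"
      using g(1) x y l m Kc Lc by auto
    show "g (x \<otimes>\<^bsub>H\<^esub> y) = g x \<otimes>\<^bsub>H\<^esub> g y"
    proof (rule g_eq)
      show "x \<otimes>\<^bsub>H\<^esub> y = f (g x \<otimes>\<^bsub>H\<^esub> g y) \<otimes>\<^bsub>H\<^esub> (l \<otimes>\<^bsub>H\<^esub> m)"
        using c by (subst l(2), subst m(2)) (simp add: m_ac)
    qed (use x y g(1) l m K(1) L(1) in \<open>simp_all add: subgroup.m_closed\<close>)
  qed
  \<comment> \<open>The element \<open>f x\<close> decomposes with trivial \<open>L\<close>-part, so
    \<open>g\<close> returns the \<open>K\<close>-part of \<open>x\<close>, on which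
    \<open>f\<close> has the same value as on \<open>x\<close>.\<close>
  moreover have "f (g (f x)) = f x" if x: "x \<in> carrier H" for x
  proof -
    obtain k where k: "k \<in> K" "f x = f k"
      using f_split[OF x] by blast
    then have "g (f x) = k"
      using x Kc L(1) by (intro g_eq[of _ _ "\<one>\<^bsub>H\<^esub>"]) (auto simp: subgroup.one_closed)
    with k show ?thesis
      by simp
  qed
  moreover have "g \<in> extensional (carrier H)"
    by (simp add: g_def)
  ultimately show "\<exists>g\<in>carrier (end_ring H). f \<otimes>\<^bsub>end_ring H\<^esub> g \<otimes>\<^bsub>end_ring H\<^esub> f = f"
    using f by (intro bexI[of _ g]) (auto simp: fun_eq_iff compose_def extensional_def)
qed (rule assms(1))

section \<open>The components of an sp-group\<close>

text \<open>In a sum of copies of the integers modulo \<open>p\<close>, the p-th power multiplies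
  every coordinate by \<open>p\<close>, hence is trivial; injectivity of the isomorphism carries
  this back to \<open>H\<close>.\<close>

lemma elementary_group_exponent:
  assumes "elementary_group p H" "p > 0" "group H" "x \<in> carrier H"
  shows "x [^]\<^bsub>H\<^esub> p = \<one>\<^bsub>H\<^esub>"
proof -
  obtain J :: "'a set" and h where h: "h \<in> iso H (sum_group J (\<lambda>_. integer_mod_group p))"
    using assms(1) by (auto simp: elementary_group_def is_iso_def)
  let ?S = "sum_group J (\<lambda>_. integer_mod_group p)"
  interpret S: group ?S
    by simp
  interpret h: group_hom H ?S h
    using assms(3) h by (simp add: group_hom_def group_hom_axioms_def iso_def)
  have pow: "(y [^]\<^bsub>?S\<^esub> n) = (\<lambda>i\<in>J. (int n * y i) mod int p)" if "y \<in> carrier ?S" for y and n :: nat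
    using that
    by (induction n) (auto simp: fun_eq_iff nat_pow_def distrib_right mod_simps algebra_simps)
  have "h (x [^]\<^bsub>H\<^esub> p) = h \<one>\<^bsub>H\<^esub>"
    using assms(4) pow[of "h x" p] by (simp add: h.hom_nat_pow)
  then show ?thesis
    using h assms(3,4) monoid.nat_pow_closed[OF group.is_monoid[OF assms(3)] assms(4)] monoid.one_closed[OF group.is_monoid[OF assms(3)]]
    by (auto simp: iso_def bij_betw_def inj_on_def)
qed

lemma subgroup_p_component:
  assumes "comm_group G" shows "subgroup (p_component G p) G"
proof -
  interpret comm_group G by fact
  show ?thesis
  proof (rule subgroupI)
    show "p_component G p \<noteq> {}"
      by (auto simp: p_component_def intro!: exI[of _ "\<one>\<^bsub>G\<^esub>"])
    fix a assume "a \<in> p_component G p"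
    then obtain n where a: "a \<in> carrier G" "a [^]\<^bsub>G\<^esub> (p ^ n) = \<one>\<^bsub>G\<^esub>"
      by (auto simp: p_component_def)
    then show "inv\<^bsub>G\<^esub> a \<in> p_component G p"
      by (auto simp: p_component_def nat_pow_inv)
    fix b assume "b \<in> p_component G p"
    then obtain m where b: "b \<in> carrier G" "b [^]\<^bsub>G\<^esub> (p ^ m) = \<one>\<^bsub>G\<^esub>"
      by (auto simp: p_component_def)
    have "(a \<otimes>\<^bsub>G\<^esub> b) [^]\<^bsub>G\<^esub> (p ^ (n + m)) =
        (a [^]\<^bsub>G\<^esub> (p ^ n)) [^]\<^bsub>G\<^esub> (p ^ m) \<otimes>\<^bsub>G\<^esub> (b [^]\<^bsub>G\<^esub> (p ^ m)) [^]\<^bsub>G\<^esub> (p ^ n)"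
      using a(1) b(1) by (simp add: pow_mult_distrib m_comm nat_pow_pow power_add mult.commute)
    then show "a \<otimes>\<^bsub>G\<^esub> b \<in> p_component G p"
      using a b by (auto simp: p_component_def)
  qed (auto simp: p_component_def)
qed

lemma comm_group_p_part:
  assumes "comm_group G" shows "comm_group (p_part G p)"
proof -
  interpret comm_group G by fact
  have sub: "subgroup (p_component G p) G"
    by (rule subgroup_p_component) fact
  show ?thesis
    by (rule group.group_comm_groupI[OF subgroup_imp_group[OF sub]])
      (use subgroup.mem_carrier[OF sub] m_comm in auto)
qed

section \<open>Regular rings and ideals\<close>

lemma regular_ring_iso:
  assumes "regular_ring R" "R \<simeq> S" "ring S"
  shows "regular_ring S"
proof -
  obtain h where h: "h \<in> ring_hom R S" "h ` carrier R = carrier S"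
    using assms(2) by (auto simp: is_ring_iso_def ring_iso_def bij_betw_def)
  interpret R: ring R
    using assms(1) by (simp add: regular_ring_def)
  interpret h: ring_hom_ring R S h
    by (rule ring_hom_ringI2[OF R.ring_axioms assms(3) h(1)])
  have "\<exists>y\<in>carrier S. b \<otimes>\<^bsub>S\<^esub> y \<otimes>\<^bsub>S\<^esub> b = b" if b: "b \<in> carrier S" for b
  proof -
    obtain a where a: "a \<in> carrier R" "b = h a"
      using b h(2) by blast
    then obtain x where x: "x \<in> carrier R" "a \<otimes>\<^bsub>R\<^esub> x \<otimes>\<^bsub>R\<^esub> a = a"
      using assms(1) by (auto simp: regular_ring_def)
    then have "h a \<otimes>\<^bsub>S\<^esub> h x \<otimes>\<^bsub>S\<^esub> h a = h a"
      using a by (metis h.hom_mult R.m_closed)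
    then show ?thesis
      using a x by auto
  qed
  then show ?thesis
    using assms(3) by (simp add: regular_ring_def)
qed

text \<open>If \<open>b = a - a x a\<close> lies in the ideal and \<open>b = b y b\<close>, then \<open>x + (1 - x a) y (1 - a x)\<close> is a
  quasi-inverse of \<open>a\<close>.\<close>

lemma regular_ring_quotient_iff:
  assumes "ideal J R" and J: "\<And>b. b \<in> J \<Longrightarrow> \<exists>y\<in>J. b \<otimes>\<^bsub>R\<^esub> y \<otimes>\<^bsub>R\<^esub> b = b"
  shows "regular_ring (R Quot J) \<longleftrightarrow> regular_ring R"
proof -
  interpret ideal J R by fact
  have carrier_quot: "carrier (R Quot J) = (\<lambda>x. J +>\<^bsub>R\<^esub> x) ` carrier R"
    by (auto simp: FactRing_def A_RCOSETS_def')
  interpret q: ring_hom_ring R "R Quot J" "(+>\<^bsub>R\<^esub>) J"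
    by (rule rcos_ring_hom_ring)
  show ?thesis
  proof
    assume reg: "regular_ring R"
    have "\<exists>z\<in>carrier (R Quot J). w \<otimes>\<^bsub>R Quot J\<^esub> z \<otimes>\<^bsub>R Quot J\<^esub> w = w" if w: "w \<in> carrier (R Quot J)" for w
    proof -
      obtain a where a: "a \<in> carrier R" "w = J +>\<^bsub>R\<^esub> a"
        using w carrier_quot by blast
      then obtain x where x: "x \<in> carrier R" "a \<otimes>\<^bsub>R\<^esub> x \<otimes>\<^bsub>R\<^esub> a = a"
        using reg by (auto simp: regular_ring_def)
      then have "w \<otimes>\<^bsub>R Quot J\<^esub> (J +>\<^bsub>R\<^esub> x) \<otimes>\<^bsub>R Quot J\<^esub> w = w"
        using a by (metis q.hom_mult m_closed)
      then show ?thesis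
        using x q.hom_closed by blast
    qed
    then show "regular_ring (R Quot J)"
      by (simp add: regular_ring_def quotient_is_ring)
  next
    assume reg: "regular_ring (R Quot J)"
    have "\<exists>c\<in>carrier R. a \<otimes>\<^bsub>R\<^esub> c \<otimes>\<^bsub>R\<^esub> a = a" if a: "a \<in> carrier R" for a
    proof -
      obtain x where x: "x \<in> carrier R"
        and "(J +>\<^bsub>R\<^esub> a) \<otimes>\<^bsub>R Quot J\<^esub> (J +>\<^bsub>R\<^esub> x) \<otimes>\<^bsub>R Quot J\<^esub> (J +>\<^bsub>R\<^esub> a) = J +>\<^bsub>R\<^esub> a"
        using reg q.hom_closed[OF a] unfolding regular_ring_def carrier_quot by blast
      then have "J +>\<^bsub>R\<^esub> a = J +>\<^bsub>R\<^esub> (a \<otimes>\<^bsub>R\<^esub> x \<otimes>\<^bsub>R\<^esub> a)"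
        using a by (metis q.hom_mult m_closed)
      then have b: "a \<ominus>\<^bsub>R\<^esub> a \<otimes>\<^bsub>R\<^esub> x \<otimes>\<^bsub>R\<^esub> a \<in> J"
        using a x quotient_eq_iff_same_a_r_cos[OF is_ideal, of a "a \<otimes>\<^bsub>R\<^esub> x \<otimes>\<^bsub>R\<^esub> a"] by simp
      define b where "b = a \<ominus>\<^bsub>R\<^esub> a \<otimes>\<^bsub>R\<^esub> x \<otimes>\<^bsub>R\<^esub> a"
      obtain y where y: "y \<in> J" "b \<otimes>\<^bsub>R\<^esub> y \<otimes>\<^bsub>R\<^esub> b = b"
        using J[OF b] by (auto simp: b_def)
      have yc: "y \<in> carrier R"
        using y(1) by (rule a_Hcarr)
      \<comment> \<open>Chosen so that \<open>a u = b = v a\<close>; placed around \<open>y\<close>,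
        they make the correction term contribute \<open>b y b = b\<close>.\<close>
      define u v where "u = \<one>\<^bsub>R\<^esub> \<ominus>\<^bsub>R\<^esub> x \<otimes>\<^bsub>R\<^esub> a" and "v = \<one>\<^bsub>R\<^esub> \<ominus>\<^bsub>R\<^esub> a \<otimes>\<^bsub>R\<^esub> x"
      have uv: "u \<in> carrier R" "v \<in> carrier R"
        using a x by (simp_all add: u_def v_def)
      have au: "a \<otimes>\<^bsub>R\<^esub> u = b" and va: "v \<otimes>\<^bsub>R\<^esub> a = b"
        using a x by (simp_all add: u_def v_def b_def minus_eq r_distr l_distr r_minus l_minus m_assoc)
      have "a \<otimes>\<^bsub>R\<^esub> (x \<oplus>\<^bsub>R\<^esub> u \<otimes>\<^bsub>R\<^esub> y \<otimes>\<^bsub>R\<^esub> v) \<otimes>\<^bsub>R\<^esub> a =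
          a \<otimes>\<^bsub>R\<^esub> x \<otimes>\<^bsub>R\<^esub> a \<oplus>\<^bsub>R\<^esub> (a \<otimes>\<^bsub>R\<^esub> u) \<otimes>\<^bsub>R\<^esub> y \<otimes>\<^bsub>R\<^esub> (v \<otimes>\<^bsub>R\<^esub> a)"
        using a x yc uv by (simp add: r_distr l_distr m_assoc)
      also have "\<dots> = a \<otimes>\<^bsub>R\<^esub> x \<otimes>\<^bsub>R\<^esub> a \<oplus>\<^bsub>R\<^esub> b"
        by (simp add: au va y)
      also have "\<dots> = a"
        using a x by (simp add: b_def minus_eq a_lcomm r_neg)
      finally show ?thesis
        using a x yc uv by blast
    qed
    then show "regular_ring R"
      by (simp add: regular_ring_def ring_axioms)
  qed
qed

section \<open>Products of rings of prime characteristics\<close>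

lemma subring_add_pow:
  assumes "subring T R" "t \<in> T" shows "add_pow R (k::nat) t \<in> T"
  using assms subringE(2,7)[OF assms(1)] by (induction k) (simp_all add: add_pow_def nat_pow_def)

section \<open>Torsion in the product and divisibility modulo the direct sum\<close>

locale prime_char_product = ring_product primes R
  for R :: "nat \<Rightarrow> ('a, 'm) ring_scheme" +
  assumes char: "p \<in> primes \<Longrightarrow> x \<in> carrier (R p) \<Longrightarrow> add_pow (R p) p x = \<zero>\<^bsub>R p\<^esub>"
begin

abbreviation DS where "DS \<equiv> direct_sum primes R"

sublocale DS: ideal DS P
  by (rule ideal_direct_sum)

lemma P_add_pow: "p \<in> primes \<Longrightarrow> add_pow P (k::nat) x p = add_pow (R p) k (x p)"
  by (rule product_ring_add_pow)

lemma P_component: "x \<in> carrier P \<Longrightarrow> p \<in> primes \<Longrightarrow> x p \<in> carrier (R p)"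
  by auto

lemma add_pow_eq_zero:
  assumes "p \<in> primes" "x \<in> carrier (R p)" "p dvd k"
  shows "add_pow (R p) k x = \<zero>\<^bsub>R p\<^esub>"
proof -
  interpret ring "R p"
    by (rule ring_component) fact
  obtain j where "k = p * j"
    using assms(3) ..
  then show ?thesis
    using assms(1,2) char add.nat_pow_pow[of x j p] by (simp add: add.nat_pow_one)
qed

text \<open>Bezout gives \<open>v p + u k = 1\<close>; as \<open>p\<close> kills the component,
  multiplication by the integer \<open>u\<close> inverts multiplication by \<open>k\<close>.\<close>

lemma add_pow_invertible:
  assumes p: "p \<in> primes" and k: "\<not> p dvd k"
  shows "\<exists>u::int. \<forall>x\<in>carrier (R p). add_pow (R p) u (add_pow (R p) k x) = x \<and>
    add_pow (R p) k (add_pow (R p) u x) = x"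
proof -
  interpret ring "R p"
    by (rule ring_component) fact
  have "coprime (int p) (int k)"
    using assms by (simp add: prime_imp_coprime)
  then obtain v u where uv: "v * int p + u * int k = 1"
    using bezout_int[of "int p" "int k"] by auto
  have eq: "add_pow (R p) (u * int k) x = x" if x: "x \<in> carrier (R p)" for x
  proof -
    have "add_pow (R p) (v * int p) x = add_pow (R p) v (add_pow (R p) p x)"
      using x add.int_pow_pow[of x v "int p"] by (simp add: mult.commute add_pow_int_of_nat)
    also have "\<dots> = \<zero>\<^bsub>R p\<^esub>"
      using char[OF p x] by (simp add: add.int_pow_one)
    finally show ?thesis
      using x uv add.int_pow_mult[OF x, of "v * int p" "u * int k"] by simp
  qed
  have "add_pow (R p) u (add_pow (R p) k x) = x \<and> add_pow (R p) k (add_pow (R p) u x) = x"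
    if x: "x \<in> carrier (R p)" for x
    using eq[OF x] add.int_pow_pow[OF x, of u "int k"] add.int_pow_pow[OF x, of "int k" u]
    by (simp add: mult.commute add_pow_int_of_nat)
  then show ?thesis
    by blast
qed

text \<open>The product of the primes in a finite set containing the support is divisible by the
  characteristic of every component involved.\<close>

lemma direct_sum_torsion:
  assumes "x \<in> DS"
  obtains k :: nat where "k > 0" "add_pow P k x = \<zero>\<^bsub>P\<^esub>"
proof -
  obtain F where F: "x \<in> carrier P" "finite F" "\<And>p. p \<in> primes \<Longrightarrow> p \<notin> F \<Longrightarrow> x p = \<zero>\<^bsub>R p\<^esub>"
    using assms by (rule direct_sumE) blast
  let ?k = "\<Prod>(F \<inter> primes)"
  have "?k > 0"
    by (intro prod_pos) (auto intro: prime_gt_0_nat)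
  moreover have "add_pow P ?k x = \<zero>\<^bsub>P\<^esub>"
  proof (rule P_eqI[OF P.add.nat_pow_closed[OF F(1)] P.zero_closed])
    fix p assume p: "p \<in> primes"
    interpret Rp: ring "R p"
      by (rule ring_component[OF p])
    have "add_pow (R p) ?k (x p) = \<zero>\<^bsub>R p\<^esub>"
    proof (cases "p \<in> F")
      case True
      then have "p dvd ?k"
        using p F(2) by (intro dvd_prodI[of _ _ "\<lambda>p. p", simplified]) auto
      then show ?thesis
        using p F(1) by (intro add_pow_eq_zero) auto
    next
      case False
      then show ?thesis
        using F(3)[OF p] by (simp add: Rp.add.nat_pow_one)
    qed
    then show "add_pow P ?k x p = \<zero>\<^bsub>P\<^esub> p"
      using p by (simp add: P_add_pow)
  qed
  ultimately show thesis
    by (rule that)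
qed

lemma finite_prime_divisors: "(k::nat) > 0 \<Longrightarrow> finite {p \<in> primes. p dvd k}"
  by (rule finite_subset[OF _ finite_divisors_nat]) auto

text \<open>This says that the product modulo the direct sum is torsion-free. Multiplication by
  \<open>k\<close> is injective away from the finitely many primes dividing \<open>k\<close>, so the
  support of \<open>x\<close> exceeds that of \<open>k x\<close> by at most those primes.\<close>

lemma direct_sum_torsion_free:
  assumes x: "x \<in> carrier P" and k: "k > 0" "add_pow P (k::nat) x \<in> DS"
  shows "x \<in> DS"
proof -
  obtain F where F: "finite F" "\<And>p. p \<in> primes \<Longrightarrow> p \<notin> F \<Longrightarrow> add_pow P k x p = \<zero>\<^bsub>R p\<^esub>"
    using k(2) by (rule direct_sumE) blast
  show ?thesis
  proof (rule direct_sumI[OF x])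
    show "finite (F \<union> {p \<in> primes. p dvd k})"
      using F(1) finite_prime_divisors[OF k(1)] by simp
    fix p assume p: "p \<in> primes" "p \<notin> F \<union> {p \<in> primes. p dvd k}"
    interpret Rp: ring "R p"
      by (rule ring_component[OF p(1)])
    obtain u :: int where "\<forall>x\<in>carrier (R p). add_pow (R p) u (add_pow (R p) k x) = x"
      using p add_pow_invertible[of p k] by blast
    from bspec[OF this P_component[OF x p(1)]] show "x p = \<zero>\<^bsub>R p\<^esub>"
      using p F(2)[of p] by (simp add: P_add_pow Rp.add.int_pow_one)
  qed
qed

text \<open>This says that the product modulo the direct sum is divisible. Division by
  \<open>k\<close> is carried out at the primes not dividing \<open>k\<close>; at the finitely many
  others \<open>y\<close> is arbitrary, and the error stays in the direct sum.\<close>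

lemma direct_sum_divisible:
  assumes x: "x \<in> carrier P" and k: "(k::nat) > 0"
  obtains y where "y \<in> carrier P" "add_pow P k y \<ominus>\<^bsub>P\<^esub> x \<in> DS"
proof -
  have "\<exists>z. z \<in> carrier (R p) \<and> (\<not> p dvd k \<longrightarrow> add_pow (R p) k z = x p)" if p: "p \<in> primes" for p
  proof -
    interpret Rp: ring "R p"
      by (rule ring_component[OF p])
    show ?thesis
    proof (cases "p dvd k")
      case True
      then show ?thesis
        using Rp.zero_closed by blast
    next
      case False
      then obtain u :: int where "\<forall>x\<in>carrier (R p). add_pow (R p) k (add_pow (R p) u x) = x"
        using add_pow_invertible[OF p] by blast
      then show ?thesis
        using P_component[OF x p] by blast
    qed
  qed
  then obtain z where z: "\<And>p. p \<in> primes \<Longrightarrow> z p \<in> carrier (R p)"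
    "\<And>p. p \<in> primes \<Longrightarrow> \<not> p dvd k \<Longrightarrow> add_pow (R p) k (z p) = x p"
    by metis
  define y where "y = restrict z primes"
  have y: "y \<in> carrier P"
    using z(1) by (auto simp: y_def)
  moreover have "add_pow P k y \<ominus>\<^bsub>P\<^esub> x \<in> DS"
  proof (rule direct_sumI)
    show "finite {p \<in> primes. p dvd k}"
      by (rule finite_prime_divisors[OF k])
    show "add_pow P k y \<ominus>\<^bsub>P\<^esub> x \<in> carrier P"
      using x y by (intro P.minus_closed P.add.nat_pow_closed)
    fix p assume p: "p \<in> primes" "p \<notin> {p \<in> primes. p dvd k}"
    interpret Rp: ring "R p"
      by (rule ring_component[OF p(1)])
    have "add_pow P k y p = x p"
      using p z(2) by (simp add: P_add_pow y_def)
    then show "(add_pow P k y \<ominus>\<^bsub>P\<^esub> x) p = \<zero>\<^bsub>R p\<^esub>"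
      using p P_component[OF x p(1)] product_ring_a_inv[OF ring_component x p(1)]
      by (simp add: P.minus_eq Rp.r_neg)
  qed
  ultimately show thesis
    by (rule that)
qed

end

section \<open>The ring of elements with a positive multiple in \<open>T\<close>\<close>

locale prime_char_product_subring = prime_char_product R
  for R :: "nat \<Rightarrow> ('a, 'm) ring_scheme" +
  fixes T :: "(nat \<Rightarrow> 'a) set"
  assumes subring_T: "subring T (product_ring primes R)"
begin

definition M where "M = {x \<in> carrier P. \<exists>k::nat. k > 0 \<and> add_pow P k x \<in> T}"

abbreviation MR where "MR \<equiv> P\<lparr>carrier := M\<rparr>"

lemma T_subset: "T \<subseteq> carrier P"
  by (rule subringE(1)[OF subring_T])

lemma M_subset: "M \<subseteq> carrier P"
  by (auto simp: M_def)

lemma T_add_pow: "t \<in> T \<Longrightarrow> add_pow P (k::nat) t \<in> T"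
  by (rule subring_add_pow[OF subring_T])

lemma MI: "x \<in> carrier P \<Longrightarrow> (k::nat) > 0 \<Longrightarrow> add_pow P k x \<in> T \<Longrightarrow> x \<in> M"
  by (auto simp: M_def)

lemma ME:
  assumes "x \<in> M"
  obtains k :: nat where "k > 0" "x \<in> carrier P" "add_pow P k x \<in> T"
  using assms by (auto simp: M_def)

text \<open>Multipliers \<open>k\<close> of \<open>x\<close> and \<open>l\<close> of
  \<open>y\<close> combine to \<open>k l\<close>, by \<open>(k l)(x y) = (k x)(l y)\<close> and
  \<open>(k l)(x + y) = l (k x) + k (l y)\<close>.\<close>

lemma subring_M: "subring M P"
proof (rule P.subringI[OF M_subset])
  show "\<one>\<^bsub>P\<^esub> \<in> M"
    by (rule MI[OF P.one_closed zero_less_one T_add_pow[OF subringE(3)[OF subring_T]]])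
  fix x assume "x \<in> M"
  then obtain k :: nat where x: "k > 0" "x \<in> carrier P" "add_pow P k x \<in> T"
    by (rule ME)
  have "add_pow P k (\<ominus>\<^bsub>P\<^esub> x) = \<ominus>\<^bsub>P\<^esub> add_pow P k x"
    using x(2) by (rule P.add.nat_pow_inv)
  then show "\<ominus>\<^bsub>P\<^esub> x \<in> M"
    using x subringE(5)[OF subring_T x(3)] by (intro MI[of _ k] P.a_inv_closed) (simp_all only:)
  fix y assume "y \<in> M"
  then obtain l :: nat where y: "l > 0" "y \<in> carrier P" "add_pow P l y \<in> T"
    by (rule ME)
  have "add_pow P (k * l) (x \<otimes>\<^bsub>P\<^esub> y) = add_pow P k x \<otimes>\<^bsub>P\<^esub> add_pow P l y"
    using x(2) y(2) P.add_pow_ldistr P.add_pow_rdistr P.add.nat_pow_pow P.m_closed P.add.nat_pow_closed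
    by (metis mult.commute)
  then show "x \<otimes>\<^bsub>P\<^esub> y \<in> M"
    using x y subringE(6)[OF subring_T x(3) y(3)] by (intro MI[of _ "k * l"] P.m_closed) (simp_all only: nat_0_less_mult_iff)
  have "add_pow P (k * l) (x \<oplus>\<^bsub>P\<^esub> y) = add_pow P l (add_pow P k x) \<oplus>\<^bsub>P\<^esub> add_pow P k (add_pow P l y)"
    using x(2) y(2) by (simp only: P.add.nat_pow_distrib P.add.nat_pow_pow mult.commute)
  then show "x \<oplus>\<^bsub>P\<^esub> y \<in> M"
    using x y subringE(7)[OF subring_T T_add_pow[OF x(3)] T_add_pow[OF y(3)]]
    by (intro MI[of _ "k * l"] P.a_closed) (simp_all only: nat_0_less_mult_iff)
qed

text \<open>If \<open>z = n x\<close> and \<open>k z\<close> lies in \<open>T\<close>, then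
  \<open>n k\<close> is a multiplier for \<open>x\<close> itself, so \<open>x\<close> is already in
  \<open>M\<close>.\<close>

lemma pure_M: "pure_subgroup M (add_monoid P)"
proof -
  have "(\<lambda>x. add_pow P n x) ` M = M \<inter> (\<lambda>x. add_pow P n x) ` carrier P" if n: "n > 0" for n :: nat
  proof (intro equalityI subsetI)
    fix z assume "z \<in> (\<lambda>x. add_pow P n x) ` M"
    then show "z \<in> M \<inter> (\<lambda>x. add_pow P n x) ` carrier P"
      using M_subset subring_add_pow[OF subring_M] by blast
  next
    fix z assume "z \<in> M \<inter> (\<lambda>x. add_pow P n x) ` carrier P"
    then obtain x k where "x \<in> carrier P" "z = add_pow P n x" "k > 0" "add_pow P (k::nat) z \<in> T"
      by (auto simp: M_def)
    then have "x \<in> M"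
      using n by (intro MI[of x "n * k"]) (simp_all add: P.add.nat_pow_pow del: product_ring_simps)
    then show "z \<in> (\<lambda>x. add_pow P n x) ` M"
      using \<open>z = _\<close> by blast
  qed
  then show ?thesis
    using subring.axioms(1)[OF subring_M] by (simp add: pure_subgroup_def add_pow_def)
qed

lemma direct_sum_add_T_subset: "DS <+>\<^bsub>P\<^esub> T \<subseteq> M"
proof
  fix z assume "z \<in> DS <+>\<^bsub>P\<^esub> T"
  then obtain d t where d: "d \<in> DS" and t: "t \<in> T" and z: "z = d \<oplus>\<^bsub>P\<^esub> t"
    unfolding set_add_def' by blast
  obtain k :: nat where k: "k > 0" "add_pow P k d = \<zero>\<^bsub>P\<^esub>"
    using d by (rule direct_sum_torsion)
  have c: "d \<in> carrier P" "t \<in> carrier P"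
    using d t T_subset DS.a_Hcarr by auto
  have "add_pow P k z = add_pow P k t"
    unfolding z P.add.nat_pow_distrib[OF c] k(2) using c(2) by (intro P.l_zero P.add.nat_pow_closed)
  then show "z \<in> M"
    using c z k(1) T_add_pow[OF t] by (intro MI[of _ k]) (simp_all only: P.a_closed)
qed

lemma direct_sum_subset_M: "DS \<subseteq> M"
proof
  fix d assume d: "d \<in> DS"
  obtain k :: nat where "k > 0" "add_pow P k d = \<zero>\<^bsub>P\<^esub>"
    using d by (rule direct_sum_torsion)
  then show "d \<in> M"
    using DS.a_Hcarr[OF d] subringE(2)[OF subring_T] by (intro MI[of d k]) (simp_all only:)
qed

sublocale MR: ring MR
  by (rule P.subring_is_ring[OF subring_M])

lemma ideal_direct_sum_MR: "ideal DS MR"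
proof (rule idealI[OF MR.ring_axioms])
  show "subgroup DS (add_monoid MR)"
    using P.add.subgroup_incl[OF DS.a_subgroup subring.axioms(1)[OF subring_M] direct_sum_subset_M]
    by simp
  show "x \<otimes>\<^bsub>MR\<^esub> a \<in> DS" "a \<otimes>\<^bsub>MR\<^esub> x \<in> DS" if "a \<in> DS" "x \<in> carrier MR" for a x
    using that M_subset DS.I_l_closed[of a x] DS.I_r_closed[of a x] by auto
qed

text \<open>A coset of the sum is the same set in \<open>M\<close> and in the product. The quotient
  of \<open>M\<close> is thus literally the quotient of the product with a smaller carrier, the form
  in which \<open>tensor_rat_ring_iso\<close> describes the image.\<close>

lemma M_Quot: "MR Quot DS = (P Quot DS)\<lparr>carrier := (\<lambda>x. DS +>\<^bsub>P\<^esub> x) ` M\<rparr>"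
  by (auto simp: FactRing_def A_RCOSETS_def' a_r_coset_def r_coset_def rcoset_mult_def fun_eq_iff
      set_add_def set_mult_def simp del: product_ring_simps)

text \<open>The target is the product modulo the sum, which is torsion-free and divisible. The
  kernel on \<open>T\<close> consists of elements of the sum, hence of torsion elements. What
  remains is to identify the classes having a positive multiple in the image of \<open>T\<close>
  with the classes of \<open>M\<close>.\<close>

lemma tensor_ring_T:
  defines "Q \<equiv> tensor_ring (P\<lparr>carrier := T\<rparr>) rat_ring"
  shows "ring Q" and "MR Quot DS \<simeq> Q"
proof -
  let ?V = "P Quot DS" and ?A = "P\<lparr>carrier := T\<rparr>" and ?\<pi> = "\<lambda>x. DS +>\<^bsub>P\<^esub> x"
  interpret V: ring ?V
    by (rule DS.quotient_is_ring)
  interpret \<pi>: ring_hom_ring P ?V ?\<pi>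
    by (rule DS.rcos_ring_hom_ring)
  have A: "ring ?A"
    by (rule P.subring_is_ring[OF subring_T])
  have \<pi>_hom: "?\<pi> \<in> ring_hom ?A ?V"
  proof (rule ring_hom_memI)
    fix x y assume "x \<in> carrier ?A" "y \<in> carrier ?A"
    then have xy: "x \<in> carrier P" "y \<in> carrier P"
      using T_subset by auto
    show "?\<pi> x \<in> carrier ?V"
      using xy by (intro \<pi>.hom_closed)
    show "?\<pi> (x \<otimes>\<^bsub>?A\<^esub> y) = ?\<pi> x \<otimes>\<^bsub>?V\<^esub> ?\<pi> y"
      using \<pi>.hom_mult[OF xy] by (simp del: product_ring_simps)
    show "?\<pi> (x \<oplus>\<^bsub>?A\<^esub> y) = ?\<pi> x \<oplus>\<^bsub>?V\<^esub> ?\<pi> y"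
      using \<pi>.hom_add[OF xy] by (simp del: product_ring_simps)
  next
    show "?\<pi> \<one>\<^bsub>?A\<^esub> = \<one>\<^bsub>?V\<^esub>"
      using \<pi>.hom_one by (simp del: product_ring_simps)
  qed
  have carrier_V: "carrier ?V = ?\<pi> ` carrier P"
    unfolding FactRing_def A_RCOSETS_def' by (simp only: partial_object.simps UNION_singleton_eq_range)
  have \<pi>_eq: "?\<pi> x = ?\<pi> y \<longleftrightarrow> x \<ominus>\<^bsub>P\<^esub> y \<in> DS" if "x \<in> carrier P" "y \<in> carrier P" for x y
    using P.quotient_eq_iff_same_a_r_cos[OF DS.is_ideal that] by simp
  have zero_V: "\<zero>\<^bsub>?V\<^esub> = DS"
    by (simp add: FactRing_def)
  have \<pi>_zero: "?\<pi> x = \<zero>\<^bsub>?V\<^esub> \<longleftrightarrow> x \<in> DS" if "x \<in> carrier P" for x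
    unfolding zero_V using that DS.a_rcos_const DS.rcos_const_imp_mem by blast
  have add_pow_A: "add_pow ?A (k::nat) x = add_pow P k x" for k x
    by (simp add: add_pow_def nat_pow_def)
  have divisible: "\<exists>w\<in>carrier ?V. add_pow ?V k w = v" if v: "v \<in> carrier ?V" and k: "k > 0" for v and k :: nat
  proof -
    obtain x where x: "x \<in> carrier P" "v = ?\<pi> x"
      using v carrier_V by blast
    obtain y where y: "y \<in> carrier P" "add_pow P k y \<ominus>\<^bsub>P\<^esub> x \<in> DS"
      using direct_sum_divisible[OF x(1) k] by blast
    then have "add_pow ?V k (?\<pi> y) = v"
      using x \<pi>_eq[OF P.add.nat_pow_closed[OF y(1)] x(1)] by (simp only: \<pi>.hom_add_pow_nat[symmetric])
    then show ?thesis
      using \<pi>.hom_closed[OF y(1)] by blast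
  qed
  have torsion_free: "v = \<zero>\<^bsub>?V\<^esub>"
    if v: "v \<in> carrier ?V" and k: "k > 0" "add_pow ?V k v = \<zero>\<^bsub>?V\<^esub>" for v and k :: nat
  proof -
    obtain x where x: "x \<in> carrier P" "v = ?\<pi> x"
      using v carrier_V by blast
    then have "add_pow P k x \<in> DS"
      using k(2) \<pi>_zero[OF P.add.nat_pow_closed[OF x(1)]] by (simp only: \<pi>.hom_add_pow_nat)
    then show ?thesis
      using direct_sum_torsion_free[OF x(1) k(1)] \<pi>_zero x by blast
  qed
  have torsion: "\<exists>k::nat. k > 0 \<and> add_pow ?A k a = \<zero>\<^bsub>?A\<^esub>"
    if a: "a \<in> carrier ?A" "?\<pi> a = \<zero>\<^bsub>?V\<^esub>" for a
  proof -
    have "a \<in> DS"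
      using a \<pi>_zero[of a] T_subset by auto
    then obtain k :: nat where "k > 0" "add_pow P k a = \<zero>\<^bsub>P\<^esub>"
      by (rule direct_sum_torsion)
    then show ?thesis
      by (auto simp: add_pow_A)
  qed
  note iso = tensor_rat_ring_iso[OF A V.ring_axioms \<pi>_hom divisible torsion_free torsion, folded Q_def]
  have "{w \<in> carrier ?V. \<exists>k::nat. k > 0 \<and> add_pow ?V k w \<in> ?\<pi> ` carrier ?A} = ?\<pi> ` M"
  proof (intro equalityI subsetI)
    fix w assume "w \<in> {w \<in> carrier ?V. \<exists>k::nat. k > 0 \<and> add_pow ?V k w \<in> ?\<pi> ` carrier ?A}"
    then obtain x k t where x: "x \<in> carrier P" "w = ?\<pi> x" and k: "(k::nat) > 0"
      and t: "t \<in> T" "add_pow ?V k w = ?\<pi> t"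
      unfolding carrier_V by auto
    have tc: "t \<in> carrier P"
      using t T_subset by blast
    have kx: "add_pow P k x \<in> carrier P"
      by (rule P.add.nat_pow_closed[OF x(1)])
    have "?\<pi> (add_pow P k x) = ?\<pi> t"
      using t(2) x by (simp only: \<pi>.hom_add_pow_nat)
    then have "add_pow P k x \<ominus>\<^bsub>P\<^esub> t \<in> DS"
      using \<pi>_eq[OF kx tc] by blast
    \<comment> \<open>The equation \<open>k x = t\<close> holds only modulo the sum. A further
      multiplier \<open>m\<close> kills the error, so \<open>k m x = m t\<close> holds exactly and
      lies in \<open>T\<close>.\<close>
    then obtain m :: nat where m: "m > 0" "add_pow P m (add_pow P k x \<ominus>\<^bsub>P\<^esub> t) = \<zero>\<^bsub>P\<^esub>"
      by (rule direct_sum_torsion)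
    have "add_pow P m (add_pow P k x) = add_pow P m ((add_pow P k x \<ominus>\<^bsub>P\<^esub> t) \<oplus>\<^bsub>P\<^esub> t)"
      using kx tc by (simp add: P.minus_eq P.a_assoc P.l_neg del: product_ring_simps)
    also have "\<dots> = add_pow P m t"
      unfolding P.add.nat_pow_distrib[OF P.minus_closed[OF kx tc] tc] m(2)
      by (rule P.l_zero[OF P.add.nat_pow_closed[OF tc]])
    finally have "add_pow P (k * m) x \<in> T"
      using T_add_pow[OF t(1)] P.add.nat_pow_pow[OF x(1)] by (simp only:)
    then have "x \<in> M"
      using x(1) k m(1) by (intro MI[of x "k * m"]) simp_all
    then show "w \<in> ?\<pi> ` M"
      using x(2) by blast
  next
    fix w assume "w \<in> ?\<pi> ` M"
    then obtain x where x: "x \<in> M" "w = ?\<pi> x"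
      by blast
    then obtain k :: nat where k: "k > 0" "x \<in> carrier P" "add_pow P k x \<in> T"
      by (auto elim: ME)
    then have "add_pow ?V k w = ?\<pi> (add_pow P k x)"
      using x(2) by (simp only: \<pi>.hom_add_pow_nat)
    then show "w \<in> {w \<in> carrier ?V. \<exists>k::nat. k > 0 \<and> add_pow ?V k w \<in> ?\<pi> ` carrier ?A}"
      using k x(2) \<pi>.hom_closed[OF k(2)] by (auto simp del: product_ring_simps)
  qed
  with iso have "ring Q" "Q \<simeq> MR Quot DS"
    unfolding M_Quot by (simp_all only:)
  then show "ring Q" "MR Quot DS \<simeq> Q"
    by (auto intro: ring_iso_sym)
qed

text \<open>The sum is a regular ideal of \<open>M\<close>: quasi-inverses are chosen in each
  component, with value \<open>0\<close> outside a finite set containing the support so that the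
  result stays in the sum. Regularity then passes both ways through the quotient, which is the
  tensor ring.\<close>

lemma regular_M_iff:
  assumes regular: "\<And>p. p \<in> primes \<Longrightarrow> regular_ring (R p)"
  shows "regular_ring MR \<longleftrightarrow> regular_ring (tensor_ring (P\<lparr>carrier := T\<rparr>) rat_ring)"
proof -
  have "\<exists>y\<in>DS. b \<otimes>\<^bsub>MR\<^esub> y \<otimes>\<^bsub>MR\<^esub> b = b" if b: "b \<in> DS" for b
  proof -
    obtain F where F: "b \<in> carrier P" "finite F" "\<And>p. p \<in> primes \<Longrightarrow> p \<notin> F \<Longrightarrow> b p = \<zero>\<^bsub>R p\<^esub>"
      using b by (rule direct_sumE) blast
    have "\<exists>z. z \<in> carrier (R p) \<and> b p \<otimes>\<^bsub>R p\<^esub> z \<otimes>\<^bsub>R p\<^esub> b p = b p \<and> (p \<notin> F \<longrightarrow> z = \<zero>\<^bsub>R p\<^esub>)"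
      if p: "p \<in> primes" for p
    proof -
      interpret Rp: ring "R p"
        by (rule ring_component[OF p])
      show ?thesis
      proof (cases "p \<in> F")
        case True
        then show ?thesis
          using regular[OF p] P_component[OF F(1) p] by (auto simp: regular_ring_def)
      next
        case False
        then show ?thesis
          using F(3)[OF p] by (intro exI[of _ "\<zero>\<^bsub>R p\<^esub>"]) simp
      qed
    qed
    then obtain z where z: "\<And>p. p \<in> primes \<Longrightarrow> z p \<in> carrier (R p)"
      "\<And>p. p \<in> primes \<Longrightarrow> b p \<otimes>\<^bsub>R p\<^esub> z p \<otimes>\<^bsub>R p\<^esub> b p = b p"
      "\<And>p. p \<in> primes \<Longrightarrow> p \<notin> F \<Longrightarrow> z p = \<zero>\<^bsub>R p\<^esub>"
      by metis
    define y where "y = restrict z primes"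
    have y: "y \<in> carrier P"
      using z(1) by (auto simp: y_def)
    have "y \<in> DS"
      by (rule direct_sumI[OF y F(2)]) (use z(3) in \<open>simp add: y_def\<close>)
    moreover have "b \<otimes>\<^bsub>P\<^esub> y \<otimes>\<^bsub>P\<^esub> b = b"
      by (rule P_eqI[OF P.m_closed[OF P.m_closed[OF F(1) y] F(1)] F(1)]) (use z(2) in \<open>simp add: y_def\<close>)
    ultimately show ?thesis
      by (intro bexI[of _ y]) simp_all
  qed
  then have "regular_ring (MR Quot DS) \<longleftrightarrow> regular_ring MR"
    by (rule regular_ring_quotient_iff[OF ideal_direct_sum_MR])
  moreover have "regular_ring (MR Quot DS) \<longleftrightarrow> regular_ring (tensor_ring (P\<lparr>carrier := T\<rparr>) rat_ring)"
    using regular_ring_iso[OF _ tensor_ring_T(2) tensor_ring_T(1)]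
      regular_ring_iso[OF _ ring_iso_sym[OF _ tensor_ring_T(2)]] ideal.quotient_is_ring[OF ideal_direct_sum_MR]
    by auto
  ultimately show ?thesis
    by simp
qed

text \<open>The identity has infinite additive order, so \<open>T\<close> is infinite; and multiplication by \<open>k\<close> has
  finite fibres, being injective on the components prime to \<open>k\<close>.\<close>

lemma M_eqpoll_T:
  assumes fin: "\<And>p. p \<in> primes \<Longrightarrow> finite (carrier (R p))"
    and inf: "infinite {p \<in> primes. \<one>\<^bsub>R p\<^esub> \<noteq> \<zero>\<^bsub>R p\<^esub>}"
  shows "M \<approx> T"
proof (rule lepoll_antisym)
  have T_M: "T \<subseteq> M"
    using T_subset T_add_pow[of _ 1] by (auto intro: MI[of _ 1] simp del: product_ring_simps)
  then show "T \<lesssim> M"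
    by (rule subset_imp_lepoll)
  have no_torsion: "add_pow P n \<one>\<^bsub>P\<^esub> \<noteq> \<zero>\<^bsub>P\<^esub>" if n: "n > 0" for n :: nat
  proof
    assume zero: "add_pow P n \<one>\<^bsub>P\<^esub> = \<zero>\<^bsub>P\<^esub>"
    \<comment> \<open>A multiplier not divisible by \<open>p\<close> is invertible on
      \<open>R p\<close> and cannot annihilate a nonzero identity. So \<open>n\<close> would be
      divisible by infinitely many primes.\<close>
    have "p dvd n" if p: "p \<in> primes" "\<one>\<^bsub>R p\<^esub> \<noteq> \<zero>\<^bsub>R p\<^esub>" for p
    proof (rule ccontr)
      assume "\<not> p dvd n"
      interpret Rp: ring "R p"
        by (rule ring_component[OF p(1)])
      obtain u :: int where u: "\<forall>x\<in>carrier (R p). add_pow (R p) u (add_pow (R p) n x) = x"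
        using add_pow_invertible[OF p(1) \<open>\<not> p dvd n\<close>] by blast
      have "add_pow P n \<one>\<^bsub>P\<^esub> p = \<zero>\<^bsub>R p\<^esub>"
        unfolding zero using p by simp
      then have "add_pow (R p) n \<one>\<^bsub>R p\<^esub> = \<zero>\<^bsub>R p\<^esub>"
        using p by (simp add: P_add_pow)
      then show False
        using bspec[OF u Rp.one_closed] p(2) by (simp add: Rp.add.int_pow_one)
    qed
    then have "{p \<in> primes. \<one>\<^bsub>R p\<^esub> \<noteq> \<zero>\<^bsub>R p\<^esub>} \<subseteq> {p \<in> primes. p dvd n}"
      by blast
    then show False
      using inf finite_prime_divisors[OF n] finite_subset by blast
  qed
  have "infinite T"
  proof -
    have "add_pow P m \<one>\<^bsub>P\<^esub> \<noteq> add_pow P n \<one>\<^bsub>P\<^esub>" if "m < n" for m n :: nat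
    proof
      assume eq: "add_pow P m \<one>\<^bsub>P\<^esub> = add_pow P n \<one>\<^bsub>P\<^esub>"
      have "\<zero>\<^bsub>P\<^esub> \<oplus>\<^bsub>P\<^esub> add_pow P m \<one>\<^bsub>P\<^esub> = add_pow P (n - m) \<one>\<^bsub>P\<^esub> \<oplus>\<^bsub>P\<^esub> add_pow P m \<one>\<^bsub>P\<^esub>"
        unfolding P.add.nat_pow_mult[OF P.one_closed] P.l_zero[OF P.add.nat_pow_closed[OF P.one_closed]]
        using that eq by simp
      from P.add.r_cancel[OF this P.zero_closed P.add.nat_pow_closed[OF P.one_closed] P.add.nat_pow_closed[OF P.one_closed]]
      show False
        using no_torsion[of "n - m"] that by simp
    qed
    then have "inj (\<lambda>n::nat. add_pow P n \<one>\<^bsub>P\<^esub>)"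
      by (rule linorder_injI)
    moreover have "range (\<lambda>n::nat. add_pow P n \<one>\<^bsub>P\<^esub>) \<subseteq> T"
      using T_add_pow subringE(3)[OF subring_T] by blast
    ultimately show ?thesis
      by (meson finite_imageD finite_subset infinite_UNIV_nat)
  qed
  \<comment> \<open>The fibres with \<open>k > 0\<close> and \<open>t\<close> in \<open>T\<close>
    cover \<open>M\<close>.\<close>
  define fibre where "fibre = (\<lambda>(k::nat, t). {x \<in> carrier P. add_pow P k x = t})"
  have fibre: "finite (fibre (k, t))" if k: "k > 0" for k t
  proof -
    let ?D = "{p \<in> primes. p dvd k}"
    have "inj_on (\<lambda>x. restrict x ?D) (fibre (k, t))"
    proof (rule inj_onI)
      fix x y assume x: "x \<in> fibre (k, t)" and y: "y \<in> fibre (k, t)" and eq: "restrict x ?D = restrict y ?D"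
      then have c: "x \<in> carrier P" "y \<in> carrier P" and kxy: "add_pow P k x = add_pow P k y"
        by (auto simp: fibre_def simp del: product_ring_simps)
      show "x = y"
      proof (rule P_eqI[OF c])
        fix p assume p: "p \<in> primes"
        show "x p = y p"
        proof (cases "p dvd k")
          case True
          then show ?thesis
            using p fun_cong[OF eq, of p] by simp
        next
          case False
          then obtain u :: int where u: "\<forall>x\<in>carrier (R p). add_pow (R p) u (add_pow (R p) k x) = x"
            using add_pow_invertible[OF p] by blast
          have "add_pow (R p) u (add_pow (R p) k (x p)) = add_pow (R p) u (add_pow (R p) k (y p))"
            by (simp only: P_add_pow[OF p, symmetric] kxy)
          then show ?thesis
            by (simp only: bspec[OF u P_component[OF c(1) p]] bspec[OF u P_component[OF c(2) p]])
        qed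
      qed
    qed
    moreover have "(\<lambda>x. restrict x ?D) ` fibre (k, t) \<subseteq> (\<Pi>\<^sub>E p\<in>?D. carrier (R p))"
    proof (rule image_subsetI)
      fix x assume "x \<in> fibre (k, t)"
      then have "x \<in> carrier P"
        by (simp add: fibre_def)
      then show "restrict x ?D \<in> (\<Pi>\<^sub>E p\<in>?D. carrier (R p))"
        by (intro restrict_PiE_iff[THEN iffD2] ballI P_component) simp_all
    qed
    moreover have "finite (\<Pi>\<^sub>E p\<in>?D. carrier (R p))"
      using finite_prime_divisors[OF k] fin by (intro finite_PiE) auto
    ultimately show ?thesis
      using finite_imageD finite_subset by blast
  qed
  \<comment> \<open>As \<open>T\<close> is infinite, the index set is no larger than
    \<open>T\<close>, and neither is a union of finite fibres over it.\<close>
  let ?I = "{0::nat<..} \<times> T"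
  have "?I \<lesssim> T"
  proof -
    have "(UNIV :: nat set) \<lesssim> T"
      using \<open>infinite T\<close> by (simp add: infinite_le_lepoll)
    then have "{0::nat<..} \<lesssim> T"
      using lepoll_trans subset_imp_lepoll by blast
    then have "?I \<lesssim> T \<times> T"
      by (intro times_lepoll_mono) simp_all
    then show ?thesis
      using card_of_Times_same_infinite[OF \<open>infinite T\<close>] lepoll_trans2
      unfolding eqpoll_iff_card_of_ordIso[symmetric] by blast
  qed
  moreover have "fibre i \<lesssim> T" if "i \<in> ?I" for i
    using that fibre finite_lepoll_infinite[OF \<open>infinite T\<close>] by auto
  ultimately have "(\<Union>i\<in>?I. fibre i) \<lesssim> T"
    using card_of_UNION_ordLeq_infinite[OF \<open>infinite T\<close>, of ?I fibre]
    unfolding lepoll_def card_of_ordLeq by blast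
  moreover have "M \<subseteq> (\<Union>i\<in>?I. fibre i)"
    by (force simp: M_def fibre_def simp del: product_ring_simps)
  ultimately show "M \<lesssim> T"
    using subset_imp_lepoll lepoll_trans by blast
qed

end

lemma finite_carrier_end_ring:
  assumes "finite (carrier H)" shows "finite (carrier (end_ring H))"
proof (rule finite_subset)
  show "carrier (end_ring H) \<subseteq> (\<Pi>\<^sub>E x\<in>carrier H. carrier H)"
    by (auto simp: hom_def PiE_def)
  show "finite (\<Pi>\<^sub>E x\<in>carrier H. carrier H)"
    using assms by (intro finite_PiE)
qed

theorem theorem5:
  fixes G :: "('a, 'b) monoid_scheme" and T :: "(nat \<Rightarrow> 'a \<Rightarrow> 'a) set"
  assumes "sp_group G"
    and "\<And>p. p \<in> primes \<Longrightarrow> elementary_group p (p_part G p)"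
    and "subring T (end_prod G)"
  shows
    "(subring (M_set G T) (end_prod G) \<and>
      pure_subgroup (M_set G T) (add_monoid (end_prod G)) \<and>
      end_sum G <+>\<^bsub>end_prod G\<^esub> T \<subseteq> M_set G T) \<and>
     M_ring G T Quot end_sum G \<simeq> tensor_ring ((end_prod G)\<lparr>carrier := T\<rparr>) rat_ring \<and>
     (regular_ring (M_ring G T) \<longleftrightarrow>
      regular_ring (tensor_ring ((end_prod G)\<lparr>carrier := T\<rparr>) rat_ring)) \<and>
     ((\<forall>p \<in> primes. finite (p_component G p)) \<longrightarrow>
        (right_nonsingular (M_ring G T) \<and> left_nonsingular (M_ring G T)) \<and>
        (right_maximal_quotient_ring TYPE('s) (end_prod G) (M_set G T) \<and>
         left_maximal_quotient_ring TYPE('s) (end_prod G) (M_set G T)) \<and>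
        (M_set G T \<noteq> carrier (end_prod G) \<longrightarrow>
           \<not> right_aleph0_self_injective (M_ring G T) \<and>
           \<not> left_aleph0_self_injective (M_ring G T)) \<and>
        M_set G T \<approx> T)"
proof -
  define R where "R p = end_ring (p_part G p)" for p
  have "comm_group G"
    using assms(1) by (simp add: sp_group_def)
  then have comm: "comm_group (p_part G p)" for p
    by (rule comm_group_p_part)
  have exponent: "x [^]\<^bsub>p_part G p\<^esub> p = \<one>\<^bsub>p_part G p\<^esub>"
    if "p \<in> primes" "x \<in> carrier (p_part G p)" for p x
    using elementary_group_exponent[OF assms(2)[OF that(1)] _ comm_group.axioms(2)[OF comm] that(2)]
      that(1) by (simp add: prime_gt_0_nat)
  have regular: "regular_ring (R p)" if "p \<in> primes" for p
    unfolding R_def using that by (intro regular_end_ring[OF comm _ exponent]) auto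
  have end_prod: "end_prod G = product_ring primes R" and end_sum: "end_sum G = direct_sum primes R"
    by (simp_all add: end_prod_def end_sum_def R_def[abs_def])
  interpret prime_char_product_subring R T
  proof (intro prime_char_product_subring.intro prime_char_product.intro ring_product.intro
      prime_char_product_axioms.intro prime_char_product_subring_axioms.intro)
    show "ring (R p)" for p
      unfolding R_def by (rule ring_end_ring[OF comm])
    show "add_pow (R p) p x = \<zero>\<^bsub>R p\<^esub>" if "p \<in> primes" "x \<in> carrier (R p)" for p x
      using end_ring_add_pow_eq_zero[OF exponent[OF that(1)] comm] that(2) unfolding R_def by blast
    show "subring T (product_ring primes R)"
      using assms(3) unfolding end_prod .
  qed
  have M_set: "M_set G T = M"
    by (simp only: M_set_def M_def end_prod)
  interpret RP: regular_product primes R M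
    using regular subring_M direct_sum_subset_M
    by (intro regular_product.intro regular_product_axioms.intro ring_product_axioms)
  \<comment> \<open>This turns the infinitely many nonzero p-components of an sp-group into
    infinitely many nonzero rings, as \<open>M_eqpoll_T\<close> requires: evaluating
    \<open>1 = 0\<close> at \<open>x\<close> would make \<open>x\<close> trivial.\<close>
  have one_neq_zero: "\<one>\<^bsub>R p\<^esub> \<noteq> \<zero>\<^bsub>R p\<^esub>" if "p_component G p \<noteq> {\<one>\<^bsub>G\<^esub>}" for p
  proof
    assume eq: "\<one>\<^bsub>R p\<^esub> = \<zero>\<^bsub>R p\<^esub>"
    have "x = \<one>\<^bsub>G\<^esub>" if "x \<in> p_component G p" for x
      using fun_cong[OF eq, of x] that by (simp add: R_def)
    moreover have "\<one>\<^bsub>G\<^esub> \<in> p_component G p"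
      by (rule subgroup.one_closed[OF subgroup_p_component[OF \<open>comm_group G\<close>]])
    ultimately show False
      using that by blast
  qed
  have "infinite {p \<in> primes. p_component G p \<noteq> {\<one>\<^bsub>G\<^esub>}}"
    using assms(1) by (simp add: sp_group_def)
  then have "infinite {p \<in> primes. \<one>\<^bsub>R p\<^esub> \<noteq> \<zero>\<^bsub>R p\<^esub>}"
    by (rule infinite_super[rotated]) (use one_neq_zero in blast)
  moreover have "finite (carrier (R p))" if "finite (p_component G p)" for p
    unfolding R_def using that by (intro finite_carrier_end_ring) simp
  ultimately have finite_part:
    "right_maximal_quotient_ring TYPE('s) P M" "left_maximal_quotient_ring TYPE('s) P M" "M \<approx> T"
    if "\<forall>p \<in> primes. finite (p_component G p)"
    using that RP.right_maximal_quotient_ring RP.left_maximal_quotient_ring M_eqpoll_T by auto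
  have "countable primes"
    by (rule countableI_type)
  then show ?thesis
    unfolding end_prod end_sum M_set
    using subring_M pure_M direct_sum_add_T_subset tensor_ring_T(2) regular_M_iff[OF regular]
      RP.right_nonsingular RP.left_nonsingular finite_part
      RP.not_right_aleph0_self_injective RP.not_left_aleph0_self_injective
    by blast
qed

end
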